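(* Let $\varphi\in L^2(\mathbb{H}^n)$ and let $\{L_{(2k,l,m)}\varphi:(k,l,m)\in\mathbb{Z}^n\times\mathbb{Z}^n\times\mathbb{Z}\}$ be a frame sequence. For $f\in V(\varphi)=\overline{\mathrm{span}}\{L_{(2k,l,m)}\varphi:(k,l,m)\in\mathbb{Z}^n\times\mathbb{Z}^n\times\mathbb{Z}\}$ and $\lambda\in\mathbb{R}^\ast$, the transform $F_\lambda$ of $f$, defined by $F_\lambda(\xi_1,\xi_2)=\pi_{\lambda}(\xi_1,\xi_2,0)\hat{f}(\lambda)\pi_{\lambda}(-\xi_1,-\xi_2,0)$ for $(\xi_1,\xi_2)\in\mathbb{R}^{2n}$, satisfies \[F_{\lambda}(\xi_1,\xi_2)=\sum_{k,l,m}c_{2k,l,m}\,e^{2\pi i\lambda(2k\cdot\xi_2-l\cdot\xi_1+m)}\,(\Phi^{M_{\lambda,\xi_1,\xi_2}})_{\lambda}(2k,l)\,\pi_{\lambda}(2k,l,0),\] where the sum is over $(k,l,m)\in\mathbb{Z}^n\times\mathbb{Z}^n\times\mathbb{Z}$, $\{c_{2k,l,m}\}$ is the sequence of frame coefficients in a frame expansion of $f$, and $(\Phi^{M_{\lambda,\xi_1,\xi_2}})_{\lambda}$ is the corresponding transform of the modulated $\varphi$, namely of $M_{(\lambda\xi_2,-\lambda\xi_1,0)}\varphi\in L^2(\mathbb{H}^n)$; that is, \[(\Phi^{M_{\lambda,\xi_1,\xi_2}})_{\lambda}(\eta_1,\eta_2)=\pi_\lambda(\eta_1,\eta_2,0)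\,\big(M_{(\lambda\xi_2,-\lambda\xi_1,0)}\varphi\big)^{\wedge}(\lambda)\,\pi_\lambda(-\eta_1,-\eta_2,0),\quad(\eta_1,\eta_2)\in\mathbb{R}^{2n}.\]
   Context: The Heisenberg group $\mathbb{H}^n$ is $\mathbb{R}^n\times\mathbb{R}^n\times\mathbb{R}$ with group law $(x,y,t)(u,v,s)=(x+u,\,y+v,\,t+s+\frac12(u\cdot y-v\cdot x))$ and Haar measure the Lebesgue measure $dx\,dy\,dt$. For $k,l\in\mathbb{Z}^n$, $m\in\mathbb{Z}$, the left translation is $L_{(2k,l,m)}\varphi(X)=\varphi((2k,l,m)^{-1}X)$, $X\in\mathbb{H}^n$. For $\lambda\in\mathbb{R}^\ast=\mathbb{R}\setminus\{0\}$, $\pi_\lambda$ is the unitary representation of $\mathbb{H}^n$ on $L^2(\mathbb{R}^n)$ given by $\pi_\lambda(x,y,t)\phi(\xi)=e^{2\pi i\lambda t}e^{2\pi i\lambda(x\cdot\xi+\frac12 x\cdot y)}\phi(\xi+y)$. The group Fourier transform of $f\in L^1(\mathbb{H}^n)$ is $\hat f(\lambda)=\int_{\mathbb{H}^n}f(x,y,t)\pi_\lambda(x,y,t)\,dx\,dy\,dt$ (also written $f^{\wedge}(\lambda)$), and its definition is extended to $f\in L^2(\mathbb{H}^n)$ by density. It satisfies the Plancherel formula $\int_{\mathbb{R}^\ast}\|\hat f(\lambda)\|_{\mathcal{B}_2}^2|\lambda|^n d\lambda=\|f\|_{L^2(\mathbb{H}^n)}^2$, where $\mathcal{B}_2$ is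 the class of Hilbert–Schmidt operators on $L^2(\mathbb{R}^n)$. Modulation: $M_{(a,b,c)}\varphi(x,y,t)=e^{2\pi i(a\cdot x+b\cdot y+ct)}\varphi(x,y,t)$ for $a,b\in\mathbb{R}^n$, $c\in\mathbb{R}$. A sequence $\{f_j\}$ in a Hilbert space $\mathcal{H}$ is a frame for $\mathcal{H}$ if there are $A,B>0$ with $A\|f\|^2\le\sum_j|\langle f,f_j\rangle|^2\le B\|f\|^2$ for all $f\in\mathcal{H}$. It is a frame sequence if it is a frame for the closure of its linear span. A frame expansion of $f$ is a representation $f=\sum_j c_jf_j$ in terms of the frame elements with $\{c_j\}\in\ell^2$; here $f=\sum_{(k,l,m)\in\mathbb{Z}^{2n+1}}c_{2k,l,m}L_{(2k,l,m)}\varphi$.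
   Formalization: Since f̂(λ) for L² functions is defined only for a.e. λ and the series may diverge at single λ, the identity is stated as unconditional convergence in L²(R*,B₂;|λ|ⁿdλ) for each ξ, and, along a subsequence of any exhaustion, in Hilbert–Schmidt norm for a.e. λ and all ξ. *)

theory Defs
  imports "HOL-Analysis.Analysis"
begin

section \<open>Square-integrable functions\<close>

text \<open>
  Elements of \<open>L\<^sup>2\<close> are represented by square-integrable Borel functions; two representatives of
  the same class agree almost everywhere. Norms, inner products, limits and Hilbert--Schmidt norms
  below only depend on the classes.
\<close>

definition L2 :: "'a measure \<Rightarrow> ('a \<Rightarrow> complex) set" where
  "L2 M = {f \<in> borel_measurable M. integrable M (\<lambda>x. (cmod (f x))\<^sup>2)}"

definition l2_inner :: "'a measure \<Rightarrow> ('a \<Rightarrow> complex) \<Rightarrow> ('a \<Rightarrow> complex) \<Rightarrow> complex" where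
  "l2_inner M f g = (LINT x|M. f x * cnj (g x))"

definition l2_norm :: "'a measure \<Rightarrow> ('a \<Rightarrow> complex) \<Rightarrow> real" where
  "l2_norm M f = sqrt (LINT x|M. (cmod (f x))\<^sup>2)"


section \<open>Frames\<close>

definition l2_closed_span :: "'a measure \<Rightarrow> ('i \<Rightarrow> 'a \<Rightarrow> complex) \<Rightarrow> ('a \<Rightarrow> complex) set" where
  "l2_closed_span M g = {f \<in> L2 M. \<forall>\<epsilon>>0. \<exists>S a. finite S \<and>
      l2_norm M (\<lambda>x. f x - (\<Sum>i\<in>S. a i * g i x)) < \<epsilon>}"

definition is_frame :: "'a measure \<Rightarrow> ('i \<Rightarrow> 'a \<Rightarrow> complex) \<Rightarrow> ('a \<Rightarrow> complex) set \<Rightarrow> bool" where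
  "is_frame M g W \<longleftrightarrow> (\<forall>i. g i \<in> W) \<and>
     (\<exists>A>0. \<exists>B>0. \<forall>f\<in>W.
        (\<lambda>i. (cmod (l2_inner M f (g i)))\<^sup>2) summable_on UNIV \<and>
        A * (l2_norm M f)\<^sup>2 \<le> (\<Sum>\<^sub>\<infinity>i. (cmod (l2_inner M f (g i)))\<^sup>2) \<and>
        (\<Sum>\<^sub>\<infinity>i. (cmod (l2_inner M f (g i)))\<^sup>2) \<le> B * (l2_norm M f)\<^sup>2)"

definition frame_sequence :: "'a measure \<Rightarrow> ('i \<Rightarrow> 'a \<Rightarrow> complex) \<Rightarrow> bool" where
  "frame_sequence M g \<longleftrightarrow> (\<forall>i. g i \<in> L2 M) \<and> is_frame M g (l2_closed_span M g)"

text \<open>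
  The expansion converges in norm over the net of finite index sets. For a frame sequence and
  square-summable coefficients this agrees with convergence along any enumeration.
\<close>

definition frame_expansion ::
    "'a measure \<Rightarrow> ('i \<Rightarrow> 'a \<Rightarrow> complex) \<Rightarrow> ('i \<Rightarrow> complex) \<Rightarrow> ('a \<Rightarrow> complex) \<Rightarrow> bool" where
  "frame_expansion M g c f \<longleftrightarrow>
     (\<lambda>i. (cmod (c i))\<^sup>2) summable_on UNIV \<and>
     ((\<lambda>S. l2_norm M (\<lambda>x. f x - (\<Sum>i\<in>S. c i * g i x))) \<longlongrightarrow> 0) (finite_subsets_at_top UNIV)"


section \<open>Operators on \<open>L\<^sup>2(\<real>\<^sup>n)\<close>\<close>

type_synonym 'n l2op = "(real^'n \<Rightarrow> complex) \<Rightarrow> (real^'n \<Rightarrow> complex)"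

definition bounded_l2op :: "'n::finite l2op \<Rightarrow> bool" where
  "bounded_l2op T \<longleftrightarrow>
     (\<forall>u\<in>L2 lborel. T u \<in> L2 lborel) \<and>
     (\<forall>u\<in>L2 lborel. \<forall>v\<in>L2 lborel. \<forall>a b.
        AE x in lborel. T (\<lambda>y. a * u y + b * v y) x = a * T u x + b * T v x) \<and>
     (\<exists>C. \<forall>u\<in>L2 lborel. l2_norm lborel (T u) \<le> C * l2_norm lborel u)"

definition orthonormal :: "(real^'n::finite \<Rightarrow> complex) set \<Rightarrow> bool" where
  "orthonormal E \<longleftrightarrow> E \<subseteq> L2 lborel \<and>
     (\<forall>u\<in>E. \<forall>v\<in>E. l2_inner lborel u v = (if u = v then 1 else 0))"

text \<open>
  The squared Hilbert--Schmidt norm, that is, the sum of \<open>\<parallel>T e\<parallel>\<^sup>2\<close> over an orthonormal basis. For a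
  bounded \<open>T\<close> that sum does not depend on the basis, and every finite orthonormal set extends to a
  basis, so it is the supremum of the finite sums below. The value is infinite when \<open>T\<close> is
  not Hilbert--Schmidt.
\<close>

definition hs_norm2 :: "'n::finite l2op \<Rightarrow> ennreal" where
  "hs_norm2 T = (SUP E\<in>{E. finite E \<and> orthonormal E}.
      \<Sum>e\<in>E. \<integral>\<^sup>+x. ennreal ((cmod (T e x))\<^sup>2) \<partial>lborel)"


section \<open>The Heisenberg group\<close>

type_synonym 'n heis = "(real^'n) \<times> (real^'n) \<times> real"

fun heis_mult :: "'n::finite heis \<Rightarrow> 'n heis \<Rightarrow> 'n heis" where
  "heis_mult (x, y, t) (u, v, s) = (x + u, y + v, t + s + (u \<bullet> y - v \<bullet> x) / 2)"

fun heis_inv :: "'n::finite heis \<Rightarrow> 'n heis" where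
  "heis_inv (x, y, t) = (- x, - y, - t)"

definition left_translate ::
    "'n::finite heis \<Rightarrow> ('n heis \<Rightarrow> complex) \<Rightarrow> ('n heis \<Rightarrow> complex)" where
  "left_translate g \<phi> = (\<lambda>X. \<phi> (heis_mult (heis_inv g) X))"

fun modulate :: "'n::finite heis \<Rightarrow> ('n heis \<Rightarrow> complex) \<Rightarrow> ('n heis \<Rightarrow> complex)" where
  "modulate (a, b, c) \<phi> = (\<lambda>(x, y, t). cis (2 * pi * (a \<bullet> x + b \<bullet> y + c * t)) * \<phi> (x, y, t))"

type_synonym 'n lattice_index = "(int^'n) \<times> (int^'n) \<times> int"

definition real_vec :: "int^'n \<Rightarrow> real^'n" where
  "real_vec k = (\<chi> i. real_of_int (k $ i))"

fun lattice_point :: "'n::finite lattice_index \<Rightarrow> 'n heis" where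
  "lattice_point (k, l, m) = (2 *\<^sub>R real_vec k, real_vec l, real_of_int m)"

definition lattice_translates ::
    "('n::finite heis \<Rightarrow> complex) \<Rightarrow> 'n lattice_index \<Rightarrow> ('n heis \<Rightarrow> complex)" where
  "lattice_translates \<phi> p = left_translate (lattice_point p) \<phi>"

definition shift_space :: "('n::finite heis \<Rightarrow> complex) \<Rightarrow> ('n heis \<Rightarrow> complex) set" where
  "shift_space \<phi> = l2_closed_span lborel (lattice_translates \<phi>)"


section \<open>The group Fourier transform\<close>

fun schroedinger :: "real \<Rightarrow> 'n::finite heis \<Rightarrow> 'n l2op" where
  "schroedinger lam (x, y, t) u =
     (\<lambda>\<xi>. cis (2 * pi * lam * t) * cis (2 * pi * lam * (x \<bullet> \<xi> + (x \<bullet> y) / 2)) * u (\<xi> + y))"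

text \<open>
  For integrable \<open>g\<close> and \<open>u\<close> in \<open>L\<^sup>2\<close> the integral converges absolutely for almost every \<open>\<xi>\<close>, and it
  represents the operator-valued (weak) integral of \<open>g(X) \<pi>\<^sub>\<lambda>(X)\<close> applied to \<open>u\<close>.
\<close>

definition fourier_L1 :: "('n::finite heis \<Rightarrow> complex) \<Rightarrow> real \<Rightarrow> 'n l2op" where
  "fourier_L1 g lam u = (\<lambda>\<xi>. LINT X|lborel. g X * schroedinger lam X u \<xi>)"

text \<open>
  The extension to \<open>L\<^sup>2\<close> by density. A square-integrable \<open>f\<close> is approximated in \<open>L\<^sup>2\<close> by its
  truncations to balls, which are also integrable. Choosing for each \<open>j\<close> the least radius with error
  at most \<open>2\<^sup>-\<^sup>j\<close> makes the transforms of the truncations converge in Hilbert--Schmidt norm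
  for almost every \<open>\<lambda>\<close> (by Plancherel), and the limit is the transform of \<open>f\<close> at \<open>\<lambda>\<close>. At
  the exceptional \<open>\<lambda>\<close> the value is unspecified.

  Density alone determines the transform only up to a null set of \<open>\<lambda>\<close>. A definite representative is
  needed since transforms of modulations \<open>M\<^bsub>a,b,0\<^esub> \<phi>\<close> with \<open>a\<close>, \<open>b\<close> depending on \<open>\<lambda>\<close> are evaluated at
  that same \<open>\<lambda>\<close>. The radii below depend only on \<open>\<bar>f\<bar>\<close>, so that a function and its modulations are
  truncated alike.
\<close>

definition truncate :: "nat \<Rightarrow> ('n::finite heis \<Rightarrow> complex) \<Rightarrow> ('n heis \<Rightarrow> complex)" where
  "truncate N f = (\<lambda>X. if norm X \<le> real N then f X else 0)"

definition trunc_radius :: "('n::finite heis \<Rightarrow> complex) \<Rightarrow> nat \<Rightarrow> nat" where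
  "trunc_radius f j = (LEAST N. l2_norm lborel (\<lambda>X. f X - truncate N f X) \<le> (1/2) ^ j)"

definition fourier :: "('n::finite heis \<Rightarrow> complex) \<Rightarrow> real \<Rightarrow> 'n l2op" where
  "fourier f lam = (SOME T. bounded_l2op T \<and>
      (\<lambda>j. hs_norm2 (\<lambda>u x. fourier_L1 (truncate (trunc_radius f j) f) lam u x - T u x))
        \<longlonglongrightarrow> 0)"

definition conj_transform ::
    "('n::finite heis \<Rightarrow> complex) \<Rightarrow> real \<Rightarrow> real^'n \<Rightarrow> real^'n \<Rightarrow> 'n l2op" where
  "conj_transform f lam \<xi>1 \<xi>2 =
     schroedinger lam (\<xi>1, \<xi>2, 0) \<circ> fourier f lam \<circ> schroedinger lam (- \<xi>1, - \<xi>2, 0)"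

text \<open>
  Convention for series of operator fields \<open>\<lambda> \<mapsto> F\<^sub>\<lambda>\<close> with square-summable coefficients: such a
  series need not converge unconditionally at an individual \<open>\<lambda>\<close>, since already a scalar Fourier
  series \<open>\<Sum>m. c\<^sub>m e\<^bsup>2\<pi>i\<lambda>m\<^esup>\<close> need not. Its sum is understood unconditionally in
  \<open>L\<^sup>2(\<real>\<^sup>*, B\<^sub>2; \<bar>\<lambda>\<bar>\<^sup>n d\<lambda>)\<close> and, for almost every \<open>\<lambda>\<close>, in \<open>B\<^sub>2\<close> along a subsequence of any
  exhaustion of the index set by finite sets.
\<close>

end

theory Submission
  imports Defs "HOL-Probability.Characteristic_Functions"
begin

text \<open>
  With \<open>\<xi> = (\<xi>\<^sub>1, \<xi>\<^sub>2, 0)\<close>, conjugation by \<open>\<pi>\<^sub>\<lambda>(\<xi>)\<close> multiplies \<open>\<pi>\<^sub>\<lambda>(x, y, t)\<close> by the character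
  \<open>e\<^bsup>2\<pi>i\<lambda>(x\<cdot>\<xi>\<^sub>2 - y\<cdot>\<xi>\<^sub>1)\<^esup>\<close>. Hence the transform of the modulated \<open>\<phi>\<close> at \<open>\<lambda>\<close> is
  \<open>\<pi>\<^sub>\<lambda>(\<xi>) \<phi>\<^sup>\<and>(\<lambda>) \<pi>\<^sub>\<lambda>(-\<xi>)\<close>, the factors \<open>\<pi>\<^sub>\<lambda>(\<plusminus>(2k, l, 0))\<close> on the right cancel, and commuting
  \<open>\<pi>\<^sub>\<lambda>(2k, l, 0)\<close> past \<open>\<pi>\<^sub>\<lambda>(\<xi>)\<close> produces the exponential in the summand. The summand is therefore
  \<open>c \<pi>\<^sub>\<lambda>(\<xi>) \<pi>\<^sub>\<lambda>(2k, l, m) \<phi>\<^sup>\<and>(\<lambda>) \<pi>\<^sub>\<lambda>(-\<xi>)\<close>, and the error of a partial sum over \<open>S\<close> is the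
  Hilbert--Schmidt norm of the transform of \<open>f - \<Sum>p\<in>S. c\<^sub>p L\<^sub>p \<phi>\<close>, whatever \<open>\<xi>\<close> is.

  Only the inequality half of Plancherel is needed: the transform of \<open>g\<close> has the kernel
  \<open>K(\<xi>, \<xi> + y) = \<integral> g(x, y, t) e\<^bsup>2\<pi>i(\<lambda>t + \<lambda>x\<cdot>(\<xi> + y/2))\<^esup> d(x, t)\<close>, Bessel's inequality bounds the
  Hilbert--Schmidt norm by the \<open>L\<^sup>2\<close> norm of \<open>K\<close>, and substituting \<open>a = \<lambda>(\<xi> + y/2)\<close>, which produces
  the weight \<open>\<bar>\<lambda>\<bar>\<^sup>n\<close>, reduces the claim to the Euclidean Plancherel inequality in \<open>(x, t)\<close>.
\<close>

section \<open>Square-integrable functions\<close>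

abbreviation sqn :: "'a measure \<Rightarrow> ('a \<Rightarrow> complex) \<Rightarrow> ennreal" where
  "sqn M f \<equiv> \<integral>\<^sup>+x. ennreal ((cmod (f x))\<^sup>2) \<partial>M"

lemma borel_measurable_fst_comp [measurable (raw)]:
  fixes f :: "'a \<Rightarrow> 'b::second_countable_topology \<times> 'c::second_countable_topology"
  shows "f \<in> borel_measurable M \<Longrightarrow> (\<lambda>x. fst (f x)) \<in> borel_measurable M"
  by (rule measurable_compose[OF _ borel_measurable_continuous_onI]) (auto intro: continuous_intros)

lemma borel_measurable_snd_comp [measurable (raw)]:
  fixes f :: "'a \<Rightarrow> 'b::second_countable_topology \<times> 'c::second_countable_topology"
  shows "f \<in> borel_measurable M \<Longrightarrow> (\<lambda>x. snd (f x)) \<in> borel_measurable M"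
  by (rule measurable_compose[OF _ borel_measurable_continuous_onI]) (auto intro: continuous_intros)

lemma L2_iff: "f \<in> L2 M \<longleftrightarrow> f \<in> borel_measurable M \<and> sqn M f < \<infinity>"
  unfolding L2_def by (auto simp: integrable_iff_bounded)

lemma L2_lborel_measurable: "f \<in> L2 lborel \<Longrightarrow> f \<in> borel_measurable borel"
  by (simp add: L2_iff)

lemma sqn_eq_l2_norm: "f \<in> L2 M \<Longrightarrow> sqn M f = ennreal ((l2_norm M f)\<^sup>2)"
  unfolding L2_def l2_norm_def by (auto simp: nn_integral_eq_integral)

section \<open>Quadratic inequalities and closure properties of \<open>L2\<close>\<close>

lemma cmod_sum_sq_le:
  "(cmod (\<Sum>i\<in>S. f i))\<^sup>2 \<le> real (card S) * (\<Sum>i\<in>S. (cmod (f i))\<^sup>2)"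
proof -
  have "(cmod (\<Sum>i\<in>S. f i))\<^sup>2 \<le> (\<Sum>i\<in>S. 1 * cmod (f i))\<^sup>2"
    by (auto intro!: power_mono sum_norm_le)
  also have "\<dots> \<le> (\<Sum>i\<in>S. 1\<^sup>2) * (\<Sum>i\<in>S. (cmod (f i))\<^sup>2)"
    by (rule Cauchy_Schwarz_ineq_sum)
  finally show ?thesis by simp
qed

lemma cmod_add_sq_le: "(cmod (a + b))\<^sup>2 \<le> 2 * (cmod a)\<^sup>2 + 2 * (cmod b)\<^sup>2"
proof -
  have "(cmod (a + b))\<^sup>2 \<le> (cmod a + cmod b)\<^sup>2"
    by (simp add: norm_triangle_ineq power_mono)
  also have "\<dots> \<le> 2 * (cmod a)\<^sup>2 + 2 * (cmod b)\<^sup>2"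
    using zero_le_power2[of "cmod a - cmod b"] by (simp add: power2_eq_square algebra_simps)
  finally show ?thesis .
qed

lemma cmod_diff_sq_le: "(cmod (a - b))\<^sup>2 \<le> 2 * (cmod a)\<^sup>2 + 2 * (cmod b)\<^sup>2"
  using cmod_add_sq_le[of a "- b"] by simp

lemma sqn_sum_le:
  assumes "\<And>i. i \<in> S \<Longrightarrow> f i \<in> borel_measurable M"
  shows "sqn M (\<lambda>x. \<Sum>i\<in>S. f i x) \<le> of_nat (card S) * (\<Sum>i\<in>S. sqn M (f i))"
proof -
  have "sqn M (\<lambda>x. \<Sum>i\<in>S. f i x) \<le> (\<integral>\<^sup>+x. of_nat (card S) * (\<Sum>i\<in>S. ennreal ((cmod (f i x))\<^sup>2)) \<partial>M)"
  proof (rule nn_integral_mono)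
    fix x
    show "ennreal ((cmod (\<Sum>i\<in>S. f i x))\<^sup>2) \<le> of_nat (card S) * (\<Sum>i\<in>S. ennreal ((cmod (f i x))\<^sup>2))"
      using cmod_sum_sq_le[of "\<lambda>i. f i x" S]
      by (simp add: ennreal_of_nat_eq_real_of_nat sum_nonneg ennreal_leI flip: ennreal_mult')
  qed
  also have "\<dots> = of_nat (card S) * (\<Sum>i\<in>S. sqn M (f i))"
    using assms by (simp add: nn_integral_cmult nn_integral_sum del: sum_ennreal)
  finally show ?thesis .
qed

lemma sqn_add_le:
  assumes [measurable]: "f \<in> borel_measurable M" "g \<in> borel_measurable M"
  shows "sqn M (\<lambda>x. f x + g x) \<le> 2 * sqn M f + 2 * sqn M g"
proof -
  have "sqn M (\<lambda>x. f x + g x) \<le> (\<integral>\<^sup>+x. 2 * ennreal ((cmod (f x))\<^sup>2) + 2 * ennreal ((cmod (g x))\<^sup>2) \<partial>M)"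
  proof (rule nn_integral_mono)
    fix x
    have "ennreal ((cmod (f x + g x))\<^sup>2) \<le> ennreal (2 * (cmod (f x))\<^sup>2 + 2 * (cmod (g x))\<^sup>2)"
      by (intro ennreal_leI cmod_add_sq_le)
    then show "ennreal ((cmod (f x + g x))\<^sup>2) \<le> 2 * ennreal ((cmod (f x))\<^sup>2) + 2 * ennreal ((cmod (g x))\<^sup>2)"
      by (simp add: ennreal_mult)
  qed
  also have "\<dots> = 2 * sqn M f + 2 * sqn M g"
    by (simp add: nn_integral_add nn_integral_cmult)
  finally show ?thesis .
qed

lemma sqn_cmult:
  assumes [measurable]: "f \<in> borel_measurable M"
  shows "sqn M (\<lambda>x. a * f x) = ennreal ((cmod a)\<^sup>2) * sqn M f"
  by (simp add: norm_mult power_mult_distrib ennreal_mult nn_integral_cmult)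

lemma sqn_diff_le:
  assumes [measurable]: "f \<in> borel_measurable M" "g \<in> borel_measurable M"
  shows "sqn M (\<lambda>x. f x - g x) \<le> 2 * sqn M f + 2 * sqn M g"
  using sqn_add_le[of f M "\<lambda>x. - g x"] by simp

lemma L2_add: "f \<in> L2 M \<Longrightarrow> g \<in> L2 M \<Longrightarrow> (\<lambda>x. f x + g x) \<in> L2 M"
  unfolding L2_iff
  by (auto intro!: le_less_trans[OF sqn_add_le] simp: ennreal_mult_less_top)

lemma L2_diff: "f \<in> L2 M \<Longrightarrow> g \<in> L2 M \<Longrightarrow> (\<lambda>x. f x - g x) \<in> L2 M"
  unfolding L2_iff
  by (auto intro!: le_less_trans[OF sqn_diff_le] simp: ennreal_mult_less_top)

lemma L2_cmult: "f \<in> L2 M \<Longrightarrow> (\<lambda>x. a * f x) \<in> L2 M"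
  unfolding L2_iff by (auto simp: sqn_cmult ennreal_mult_less_top)

lemma L2_sum: "(\<And>i. i \<in> S \<Longrightarrow> f i \<in> L2 M) \<Longrightarrow> (\<lambda>x. \<Sum>i\<in>S. f i x) \<in> L2 M"
proof (induction S rule: infinite_finite_induct)
  case (insert i S)
  then show ?case by (simp add: L2_add)
qed (auto simp: L2_def)

lemma L2_integrable_mult:
  assumes "f \<in> L2 M" "g \<in> L2 M"
  shows "integrable M (\<lambda>x. f x * g x)"
proof (rule Bochner_Integration.integrable_bound[of M "\<lambda>x. (cmod (f x))\<^sup>2 + (cmod (g x))\<^sup>2"])
  show "AE x in M. norm (f x * g x) \<le> norm ((cmod (f x))\<^sup>2 + (cmod (g x))\<^sup>2)"
  proof (rule AE_I2)
    fix x
    have "0 \<le> (cmod (f x) - cmod (g x))\<^sup>2" "0 \<le> cmod (f x) * cmod (g x)" by simp_all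
    then show "norm (f x * g x) \<le> norm ((cmod (f x))\<^sup>2 + (cmod (g x))\<^sup>2)"
      unfolding power2_diff norm_mult real_norm_def by linarith
  qed
qed (use assms in \<open>auto simp: L2_def\<close>)

lemma borel_measurable_cnj [measurable (raw)]:
  "f \<in> borel_measurable M \<Longrightarrow> (\<lambda>x. cnj (f x)) \<in> borel_measurable M"
  by (rule measurable_compose[OF _ borel_measurable_continuous_onI]) (auto intro: continuous_intros)

lemma L2_cnj: "f \<in> L2 M \<Longrightarrow> (\<lambda>x. cnj (f x)) \<in> L2 M"
  by (auto simp: L2_iff)

text \<open>The pairing with \<open>e\<close> carries no conjugate because \<open>k\<close> will be
  the kernel of an integral operator applied to \<open>e\<close>. The conjugates of the elements of
  \<open>E\<close> are again orthonormal. Expanding the nonnegative square norm of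
  \<open>k - s\<close>, where \<open>s\<close> is the projection of \<open>k\<close> onto their
  span, gives the bound.\<close>

lemma bessel:
  assumes E: "finite E" "E \<subseteq> L2 M"
    and on: "\<And>u v. u \<in> E \<Longrightarrow> v \<in> E \<Longrightarrow> l2_inner M u v = (if u = v then 1 else 0)"
    and k: "k \<in> borel_measurable M"
  shows "(\<Sum>e\<in>E. ennreal ((cmod (LINT y|M. k y * e y))\<^sup>2)) \<le> sqn M k"
proof (cases "sqn M k = \<infinity>")
  case False
  then have kL: "k \<in> L2 M" using k by (simp add: L2_iff less_top)
  define c where "c e = (LINT y|M. k y * e y)" for e
  define s where "s y = (\<Sum>e\<in>E. c e * cnj (e y))" for y
  have sL: "s \<in> L2 M"
    unfolding s_def using E by (intro L2_sum L2_cmult L2_cnj) auto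
  have ks: "(LINT y|M. k y * cnj (s y)) = (\<Sum>e\<in>E. complex_of_real ((cmod (c e))\<^sup>2))"
  proof -
    have "(LINT y|M. k y * cnj (s y)) = (LINT y|M. (\<Sum>e\<in>E. cnj (c e) * (k y * e y)))"
      by (simp add: s_def sum_distrib_left algebra_simps)
    also have "\<dots> = (\<Sum>e\<in>E. cnj (c e) * c e)"
      using E kL by (subst Bochner_Integration.integral_sum) (auto intro!: integrable_mult_right L2_integrable_mult simp: c_def subset_iff)
    finally show ?thesis
      by (simp add: complex_norm_square mult.commute del: of_real_power)
  qed
  have ss: "(LINT y|M. s y * cnj (s y)) = (\<Sum>e\<in>E. complex_of_real ((cmod (c e))\<^sup>2))"
  proof -
    have "(LINT y|M. s y * cnj (s y)) = (LINT y|M. (\<Sum>u\<in>E. \<Sum>v\<in>E. c u * cnj (c v) * (v y * cnj (u y))))"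
      by (simp add: s_def sum_product sum_distrib_left sum_distrib_right algebra_simps)
    also have "\<dots> = (\<Sum>u\<in>E. \<Sum>v\<in>E. c u * cnj (c v) * (LINT y|M. v y * cnj (u y)))"
    proof -
      have i: "integrable M (\<lambda>y. c u * cnj (c v) * (v y * cnj (u y)))" if "u \<in> E" "v \<in> E" for u v
        using E that by (intro integrable_mult_right L2_integrable_mult L2_cnj) auto
      then show ?thesis
        by (simp add: Bochner_Integration.integral_sum Bochner_Integration.integrable_sum)
    qed
    also have "\<dots> = (\<Sum>u\<in>E. \<Sum>v\<in>E. if v = u then c u * cnj (c v) else 0)"
      using on by (intro sum.cong refl) (auto simp: l2_inner_def)
    also have "\<dots> = (\<Sum>v\<in>E. c v * cnj (c v))"
      using E by (simp add: sum.delta)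
    finally show ?thesis
      by (simp add: complex_norm_square del: of_real_power)
  qed
  have sk: "(LINT y|M. s y * cnj (k y)) = cnj (LINT y|M. k y * cnj (s y))"
    using Bochner_Integration.integral_cnj[of M "\<lambda>y. k y * cnj (s y)"] by (simp add: mult.commute)
  have "(\<Sum>e\<in>E. (cmod (c e))\<^sup>2) \<le> (LINT y|M. (cmod (k y))\<^sup>2)"
  proof -
    have "complex_of_real (LINT y|M. (cmod (k y - s y))\<^sup>2)
        = (LINT y|M. k y * cnj (k y) - k y * cnj (s y) - s y * cnj (k y) + s y * cnj (s y))"
      unfolding integral_complex_of_real[symmetric]
      by (intro Bochner_Integration.integral_cong refl)
         (simp only: complex_norm_square, simp add: algebra_simps)
    also have "\<dots> = (LINT y|M. k y * cnj (k y)) - (LINT y|M. k y * cnj (s y))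
        - (LINT y|M. s y * cnj (k y)) + (LINT y|M. s y * cnj (s y))"
      using kL sL by (simp add: L2_integrable_mult L2_cnj)
    also have "\<dots> = (LINT y|M. k y * cnj (k y)) - (\<Sum>e\<in>E. complex_of_real ((cmod (c e))\<^sup>2))"
      unfolding sk ks ss by simp
    also have "(LINT y|M. k y * cnj (k y)) = complex_of_real (LINT y|M. (cmod (k y))\<^sup>2)"
      by (simp add: integral_complex_of_real[symmetric] complex_norm_square del: integral_complex_of_real of_real_power)
    finally have "complex_of_real (LINT y|M. (cmod (k y - s y))\<^sup>2)
        = complex_of_real ((LINT y|M. (cmod (k y))\<^sup>2) - (\<Sum>e\<in>E. (cmod (c e))\<^sup>2))"
      by simp
    then have "(LINT y|M. (cmod (k y - s y))\<^sup>2) = (LINT y|M. (cmod (k y))\<^sup>2) - (\<Sum>e\<in>E. (cmod (c e))\<^sup>2)"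
      using of_real_eq_iff by blast
    moreover have "0 \<le> (LINT y|M. (cmod (k y - s y))\<^sup>2)" by simp
    ultimately show ?thesis by linarith
  qed
  then have "ennreal (\<Sum>e\<in>E. (cmod (c e))\<^sup>2) \<le> ennreal (LINT y|M. (cmod (k y))\<^sup>2)"
    by (rule ennreal_leI)
  also have "\<dots> = sqn M k"
    using kL by (simp add: L2_def nn_integral_eq_integral)
  finally show ?thesis by (simp add: c_def)
qed simp

text \<open>If the product is not integrable, the Bochner integral on the left is 0 by convention;
  otherwise this is the Cauchy-Schwarz inequality for the moduli.\<close>

lemma cauchy_schwarz_sqn:
  assumes [measurable]: "k \<in> borel_measurable M" "u \<in> borel_measurable M"
  shows "ennreal ((cmod (LINT y|M. k y * u y))\<^sup>2) \<le> sqn M k * sqn M u"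
proof (cases "integrable M (\<lambda>y. k y * u y)")
  case True
  have "ennreal ((cmod (LINT y|M. k y * u y))\<^sup>2) \<le> (ennreal (LINT y|M. norm (k y * u y)))\<^sup>2"
    by (simp add: ennreal_power power_mono ennreal_leI)
  also have "ennreal (LINT y|M. norm (k y * u y)) = (\<integral>\<^sup>+y. ennreal (cmod (k y)) * ennreal (cmod (u y)) \<partial>M)"
    using True by (subst nn_integral_eq_integral[symmetric]) (auto simp: norm_mult ennreal_mult dest: integrable_norm)
  also have "\<dots>\<^sup>2 \<le> (\<integral>\<^sup>+y. (ennreal (cmod (k y)))\<^sup>2 \<partial>M) * (\<integral>\<^sup>+y. (ennreal (cmod (u y)))\<^sup>2 \<partial>M)"
    by (rule Cauchy_Schwarz_nn_integral) auto
  finally show ?thesis by (simp add: ennreal_power)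
qed (simp add: not_integrable_integral_eq)

section \<open>The Plancherel inequality on Euclidean space\<close>

text \<open>The positive sign in the exponent is that of the Schroedinger representation. If
  \<open>h\<close> is not integrable, the Bochner integral is 0 at every \<open>z\<close>.\<close>

definition efourier :: "('a::euclidean_space \<Rightarrow> complex) \<Rightarrow> 'a \<Rightarrow> complex" where
  "efourier h z = (LINT w|lborel. h w * cis (2 * pi * (w \<bullet> z)))"

lemma borel_measurable_cis [measurable (raw)]:
  "f \<in> borel_measurable M \<Longrightarrow> (\<lambda>x. cis (f x)) \<in> borel_measurable M"
  by (rule measurable_compose[OF _ borel_measurable_continuous_onI]) (auto intro: continuous_intros)

text \<open>
  The weight makes the integral of \<open>\<bar>efourier h\<bar>\<^sup>2\<close> absolutely convergent; its transform is a probability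
  density, so the weighted integral is at most \<open>sqn lborel h\<close> by
  \<open>2 \<bar>h v\<bar> \<bar>h w\<bar> \<le> \<bar>h v\<bar>\<^sup>2 + \<bar>h w\<bar>\<^sup>2\<close>. The parameter \<open>s\<close> tends to \<open>0\<close>.
\<close>

definition gauss_weight :: "real \<Rightarrow> 'a::euclidean_space \<Rightarrow> real" where
  "gauss_weight s a = (\<Prod>b\<in>Basis. exp (- (s * (a \<bullet> b))\<^sup>2 / 2))"

text \<open>Rescaling by \<open>s\<close> reduces both claims to the standard normal density, whose
  characteristic function is \<open>exp (- t\<^sup>2 / 2)\<close>.\<close>

lemma gauss_1d:
  assumes s: "s > 0"
  shows "integrable lborel (\<lambda>x. exp (- (s * x)\<^sup>2 / 2))" (is ?I)
    and "(LINT x|lborel. complex_of_real (exp (- (s * x)\<^sup>2 / 2)) * cis (2 * pi * (x * z)))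
      = complex_of_real (normal_density 0 (s / (2 * pi)) z)" (is "?L = _")
proof -
  have ed: "exp (- (s * x)\<^sup>2 / 2) = sqrt (2 * pi) * std_normal_density (s * x)" for x
    by (simp add: std_normal_density_def)
  show ?I
  proof -
    have "integrable lborel (\<lambda>x. std_normal_density (0 + s * x))"
      using s by (intro lborel_integrable_real_affine) auto
    then show ?thesis unfolding ed by simp
  qed
  \<comment> \<open>The frequency for which substituting \<open>s * x\<close> for \<open>x\<close>
    turns \<open>iexp (t * x)\<close> into \<open>cis (2 * pi * (x * z))\<close>.\<close>
  define t where "t = 2 * pi * z / s"
  have "complex_of_real (exp (- t\<^sup>2 / 2)) = char std_normal_distribution t"
    by (simp add: char_std_normal_distribution)
  also have "\<dots> = (LINT x|lborel. complex_of_real (std_normal_density x) * iexp (t * x))"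
    unfolding char_def by (subst integral_density) (auto simp: scaleR_conv_of_real)
  also have "\<dots> = \<bar>s\<bar> *\<^sub>R (LINT x|lborel. complex_of_real (std_normal_density (0 + s * x)) * iexp (t * (0 + s * x)))"
    using s by (intro lborel_integral_real_affine) simp
  also have "\<dots> = s * (LINT x|lborel. complex_of_real (std_normal_density (s * x)) * cis (2 * pi * (x * z)))"
    using s by (simp add: t_def cis_conv_exp field_simps scaleR_conv_of_real)
  finally have 1: "(LINT x|lborel. complex_of_real (std_normal_density (s * x)) * cis (2 * pi * (x * z)))
      = complex_of_real (exp (- t\<^sup>2 / 2) / s)"
    using s by (simp add: field_simps)
  have "?L = sqrt (2 * pi) * (LINT x|lborel. complex_of_real (std_normal_density (s * x)) * cis (2 * pi * (x * z)))"
    unfolding ed by (subst integral_mult_right_zero[symmetric]) (simp add: mult_ac)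
  also have "\<dots> = complex_of_real (sqrt (2 * pi) * exp (- t\<^sup>2 / 2) / s)"
    unfolding 1 by simp
  also have "sqrt (2 * pi) * exp (- t\<^sup>2 / 2) / s = normal_density 0 (s / (2 * pi)) z"
  proof -
    \<comment> \<open>It remains to match the normalising constants \<open>sqrt (2 * pi) / s\<close>
      and \<open>1 / (sqrt (2 * pi) * \<sigma>)\<close>.\<close>
    define \<sigma> where "\<sigma> = s / (2 * pi)"
    have \<sigma>: "\<sigma> > 0" "s = 2 * pi * \<sigma>" using s by (simp_all add: \<sigma>_def)
    have t: "t = z / \<sigma>" using \<sigma> by (simp add: t_def)
    have "sqrt (2 * pi * \<sigma>\<^sup>2) = sqrt (2 * pi) * \<sigma>"
      using \<sigma> by (simp add: real_sqrt_mult)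
    moreover have "sqrt (2 * pi) / s = 1 / (sqrt (2 * pi) * \<sigma>)"
    proof -
      have "sqrt (2 * pi) * (sqrt (2 * pi) * \<sigma>) = s"
        unfolding \<sigma>(2) mult.assoc[symmetric] by (simp only: real_sqrt_mult_self) simp
      then show ?thesis using s \<sigma>(1) by (simp only: divide_eq_eq frac_eq_eq) (simp add: field_simps)
    qed
    moreover have "- t\<^sup>2 / 2 = - (z - 0)\<^sup>2 / (2 * \<sigma>\<^sup>2)"
      by (simp add: t power_divide)
    moreover have "normal_density 0 (s / (2 * pi)) z = normal_density 0 \<sigma> z"
      by (simp only: \<sigma>_def)
    ultimately show ?thesis
      unfolding normal_density_def by (metis times_divide_eq_left)
  qed
  finally show "?L = complex_of_real (normal_density 0 (s / (2 * pi)) z)" .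
qed

section \<open>Gaussians in several variables\<close>

lemma cis_sum: "finite S \<Longrightarrow> cis (\<Sum>i\<in>S. f i) = (\<Prod>i\<in>S. cis (f i))"
  by (induction S rule: finite_induct) (auto simp: cis_mult[symmetric])

interpretation lborel_PiM: product_sigma_finite "\<lambda>_. lborel :: real measure" ..

text \<open>Lebesgue measure on a Euclidean space is the image of the product of one-dimensional
  Lebesgue measures over \<open>Basis\<close>, so a product of functions of single coordinates
  integrates factor by factor.\<close>

lemma lborel_integral_prod:
  fixes f :: "'a::euclidean_space \<Rightarrow> real \<Rightarrow> complex"
  assumes "\<And>b. b \<in> Basis \<Longrightarrow> integrable lborel (f b)"
  shows "(LINT x|lborel. (\<Prod>b\<in>Basis. f b (x \<bullet> b))) = (\<Prod>b\<in>Basis. LINT x|lborel. f b x)"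
    and "integrable lborel (\<lambda>x::'a. (\<Prod>b\<in>Basis. f b (x \<bullet> b)))"
proof -
  have [measurable]: "f b \<in> borel_measurable borel" if "b \<in> Basis" for b
    using assms[OF that] by (simp add: borel_measurable_integrable)
  show "(LINT x|lborel. (\<Prod>b\<in>Basis. f b (x \<bullet> b))) = (\<Prod>b\<in>Basis. LINT x|lborel. f b x)"
    by (subst lborel_eq, subst integral_distr)
       (simp_all add: lborel_PiM.product_integral_prod assms cong: prod.cong)
  have "integrable (Pi\<^sub>M Basis (\<lambda>b. lborel)) (\<lambda>x. (\<Prod>b\<in>Basis. f b (x b)))"
    by (rule lborel_PiM.product_integrable_prod) (auto intro: assms)
  then show "integrable lborel (\<lambda>x::'a. (\<Prod>b\<in>Basis. f b (x \<bullet> b)))"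
    by (subst lborel_eq, subst integrable_distr_eq) (simp_all cong: prod.cong)
qed

text \<open>The Fourier transform of \<open>gauss_weight s\<close>; the deviation
  \<open>s / (2 * pi)\<close> is dual to the width \<open>1 / s\<close> of the weight.\<close>

definition gauss_kernel :: "real \<Rightarrow> 'a::euclidean_space \<Rightarrow> real" where
  "gauss_kernel s z = (\<Prod>b\<in>Basis. normal_density 0 (s / (2 * pi)) (z \<bullet> b))"

lemma gauss_weight_measurable [measurable]: "gauss_weight s \<in> borel_measurable borel"
  unfolding gauss_weight_def[abs_def] by measurable

lemma gauss_kernel_measurable [measurable]: "gauss_kernel s \<in> borel_measurable borel"
  unfolding gauss_kernel_def[abs_def] by measurable

lemma gauss_weight_nonneg [simp]: "0 \<le> gauss_weight s a"
  unfolding gauss_weight_def by (simp add: prod_nonneg)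

lemma gauss_kernel_nonneg [simp]: "s > 0 \<Longrightarrow> 0 \<le> gauss_kernel s a"
  unfolding gauss_kernel_def by (simp add: prod_nonneg)

lemma integrable_mult_cis:
  assumes "integrable M f" and [measurable]: "g \<in> borel_measurable M"
  shows "integrable M (\<lambda>x. f x * cis (g x))"
proof -
  have [measurable]: "f \<in> borel_measurable M" using assms by auto
  show ?thesis
    using assms(1) by (rule Bochner_Integration.integrable_bound) (auto simp: norm_mult)
qed

lemma efourier_gauss_weight:
  assumes s: "s > 0"
  shows "efourier (\<lambda>a. complex_of_real (gauss_weight s a)) z = complex_of_real (gauss_kernel s (z::'a::euclidean_space))"
proof -
  have *: "complex_of_real (gauss_weight s a) * cis (2 * pi * (a \<bullet> z))
     = (\<Prod>b\<in>Basis. complex_of_real (exp (- (s * (a \<bullet> b))\<^sup>2 / 2)) * cis (2 * pi * ((a \<bullet> b) * (z \<bullet> b))))" for a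
    by (simp add: gauss_weight_def prod.distrib cis_sum[symmetric] euclidean_inner[of a z] sum_distrib_left
       flip: of_real_prod)
  show ?thesis
    unfolding efourier_def * gauss_kernel_def of_real_prod
    by (subst lborel_integral_prod(1))
       (simp_all only: gauss_1d(2)[OF s], intro integrable_mult_cis integrable_of_real gauss_1d s, simp)
qed

lemma integrable_gauss_weight:
  assumes s: "s > 0"
  shows "integrable lborel (\<lambda>a::'a::euclidean_space. gauss_weight s a)"
proof -
  have "integrable lborel (\<lambda>a::'a. \<Prod>b\<in>Basis. complex_of_real (exp (- (s * (a \<bullet> b))\<^sup>2 / 2)))"
    by (rule lborel_integral_prod(2)) (intro integrable_of_real gauss_1d s)
  then have "integrable lborel (\<lambda>a::'a. complex_of_real (gauss_weight s a))"
    by (simp add: gauss_weight_def)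
  then show ?thesis by (simp add: complex_of_real_integrable_eq)
qed

lemma nn_integral_gauss_kernel:
  assumes s: "s > 0"
  shows "(\<integral>\<^sup>+z. ennreal (gauss_kernel s (z::'a::euclidean_space)) \<partial>lborel) = 1"
proof -
  have d1: "(\<integral>\<^sup>+x. ennreal (normal_density 0 (s / (2 * pi)) x) \<partial>lborel) = 1"
    using prob_space.emeasure_space_1[OF prob_space_normal_density[of "s / (2*pi)" 0]] s
    by (simp add: emeasure_density)
  have "(\<integral>\<^sup>+z. ennreal (gauss_kernel s (z::'a)) \<partial>lborel)
      = (\<integral>\<^sup>+z. (\<Prod>b\<in>Basis. ennreal (normal_density 0 (s / (2 * pi)) ((z::'a) \<bullet> b))) \<partial>lborel)"
    by (simp add: gauss_kernel_def prod_ennreal)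
  also have "\<dots> = (\<Prod>b\<in>(Basis::'a set). \<integral>\<^sup>+x. ennreal (normal_density 0 (s / (2 * pi)) x) \<partial>lborel)"
    by (rule nn_integral_lborel_prod) auto
  finally show ?thesis by (simp add: d1)
qed

lemma integrable_tensor:
  fixes f :: "'a::euclidean_space \<Rightarrow> complex" and g :: "'b::euclidean_space \<Rightarrow> complex"
  assumes f: "integrable lborel f" and g: "integrable lborel g"
  shows "integrable lborel (\<lambda>(x, y). f x * g y)"
proof -
  have [measurable]: "f \<in> borel_measurable borel" "g \<in> borel_measurable borel"
    using f g by (simp_all add: borel_measurable_integrable)
  have "(\<integral>\<^sup>+p. ennreal (norm (case p of (x, y) \<Rightarrow> f x * g y)) \<partial>(lborel \<Otimes>\<^sub>M lborel))
      = (\<integral>\<^sup>+x. \<integral>\<^sup>+y. ennreal (norm (f x)) * ennreal (norm (g y)) \<partial>lborel \<partial>lborel)"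
    by (subst lborel.nn_integral_fst[symmetric]) (simp_all add: norm_mult ennreal_mult)
  also have "\<dots> = (\<integral>\<^sup>+x. ennreal (norm (f x)) \<partial>lborel) * (\<integral>\<^sup>+y. ennreal (norm (g y)) \<partial>lborel)"
    by (simp add: nn_integral_cmult nn_integral_multc)
  also have "\<dots> < \<infinity>"
    using f g by (simp add: integrable_iff_bounded ennreal_mult_less_top)
  finally show ?thesis
    unfolding lborel_prod[symmetric] by (intro integrableI_bounded) auto
qed

text \<open>Fubini is applied to \<open>\<Phi>\<close>, a function of the frequency \<open>a\<close>
  and a pair \<open>(v, w)\<close>. Integrating over the pair first gives the weighted square of
  \<open>efourier h\<close>; integrating over \<open>a\<close> first gives
  \<open>h v * cnj (h w)\<close> times the probability density \<open>gauss_kernel\<close> at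
  \<open>v - w\<close>.\<close>

lemma sqn_efourier_weighted_le:
  fixes h :: "'a::euclidean_space \<Rightarrow> complex"
  assumes h: "integrable lborel h" and s: "s > 0"
  shows "(\<integral>\<^sup>+a. ennreal ((cmod (efourier h a))\<^sup>2 * gauss_weight s a) \<partial>lborel) \<le> sqn lborel h"
proof -
  have [measurable]: "h \<in> borel_measurable borel"
    using h by (simp add: borel_measurable_integrable)
  \<comment> \<open>Half of the squared modulus: each of the two variables contributes one half, and
    the halves add up to \<open>sqn lborel h\<close> at the end.\<close>
  define A where "A v = (cmod (h v))\<^sup>2 / 2" for v
  have A: "0 \<le> A v" for v by (simp add: A_def)
  have [measurable]: "A \<in> borel_measurable borel" unfolding A_def[abs_def] by measurable
  define H where "H p = h (fst p) * cnj (h (snd p))" for p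
  define \<Phi> where "\<Phi> a p = complex_of_real (gauss_weight s a) * H p * cis (2 * pi * (a \<bullet> (fst p - snd p)))" for a p
  have Hint: "integrable (lborel :: ('a \<times> 'a) measure) H"
    using integrable_tensor[OF h integrable_cnj[OF h]]
    by (simp add: H_def[abs_def] case_prod_beta')
  have [measurable]: "H \<in> borel_measurable borel"
    using Hint by (simp add: borel_measurable_integrable)
  \<comment> \<open>The Gaussian weight supplies the integrability in \<open>a\<close> that Fubini
    requires.\<close>
  have \<Phi>int: "integrable (lborel \<Otimes>\<^sub>M lborel) (case_prod \<Phi>)"
  proof -
    have "integrable lborel (\<lambda>(a, p). complex_of_real (gauss_weight s (a::'a)) * H p)"
      by (intro integrable_tensor Hint integrable_of_real integrable_gauss_weight s)
    then have "integrable (lborel \<Otimes>\<^sub>M lborel) (\<lambda>x. (case x of (a, p) \<Rightarrow> complex_of_real (gauss_weight s (a::'a)) * H p)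
       * cis (2 * pi * (fst x \<bullet> (fst (snd x) - snd (snd x)))))"
      unfolding lborel_prod by (intro integrable_mult_cis) auto
    then show ?thesis by (simp add: \<Phi>_def case_prod_beta')
  qed
  have inner: "(LINT p|lborel. \<Phi> a p) = complex_of_real ((cmod (efourier h a))\<^sup>2 * gauss_weight s a)" for a
  proof -
    define u where "u w = h w * cis (2 * pi * (w \<bullet> a))" for w
    have u: "integrable lborel u"
      unfolding u_def by (intro integrable_mult_cis h) simp
    have "(LINT p|lborel. \<Phi> a p) = gauss_weight s a * (LINT p|lborel. (case p of (v, w) \<Rightarrow> u v * cnj (u w)))"
    proof -
      have "\<Phi> a p = gauss_weight s a * (case p of (v, w) \<Rightarrow> u v * cnj (u w))" for p
        by (cases p) (simp add: \<Phi>_def H_def u_def cis_cnj inner_diff_right right_diff_distrib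
            inner_commute cis_mult mult_ac)
      then show ?thesis by simp
    qed
    also have "(LINT p|lborel. (case p of (v, w) \<Rightarrow> u v * cnj (u w)))
        = (LINT v|lborel. LINT w|lborel. u v * cnj (u w))"
      using integrable_tensor[OF u integrable_cnj[OF u]]
      unfolding lborel_prod[symmetric] by (rule lborel_pair.integral_fst[symmetric])
    also have "\<dots> = (LINT w|lborel. u w) * cnj (LINT w|lborel. u w)"
      by simp
    also have "(LINT w|lborel. u w) = efourier h a"
      by (simp add: efourier_def u_def)
    finally show ?thesis
      by (simp add: complex_norm_square del: of_real_power)
  qed
  have outer: "(LINT a|lborel. \<Phi> a p) = H p * gauss_kernel s (fst p - snd p)" for p
  proof -
    have "(LINT a|lborel. \<Phi> a p) = (LINT a|lborel. H p * (complex_of_real (gauss_weight s a) * cis (2 * pi * (a \<bullet> (fst p - snd p)))))"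
      by (simp add: \<Phi>_def mult_ac)
    then show ?thesis
      using efourier_gauss_weight[OF s, of "fst p - snd p"] by (simp add: efourier_def)
  qed
  have int1: "integrable lborel (\<lambda>a. complex_of_real ((cmod (efourier h a))\<^sup>2 * gauss_weight s a))"
    using lborel_pair.integrable_fst[OF \<Phi>int] by (simp only: inner)
  have eq: "complex_of_real (LINT a|lborel. (cmod (efourier h a))\<^sup>2 * gauss_weight s a)
      = (LINT p|lborel. H p * gauss_kernel s (fst p - snd p))"
    using lborel_pair.integral_fst[OF \<Phi>int] lborel_pair.integral_snd[OF \<Phi>int]
    by (simp only: inner outer integral_complex_of_real)
  have "(\<integral>\<^sup>+a. ennreal ((cmod (efourier h a))\<^sup>2 * gauss_weight s a) \<partial>lborel)
      = ennreal (LINT a|lborel. (cmod (efourier h a))\<^sup>2 * gauss_weight s a)"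
    using int1 unfolding complex_of_real_integrable_eq
    by (intro nn_integral_eq_integral) (auto intro!: AE_I2)
  also have "(LINT a|lborel. (cmod (efourier h a))\<^sup>2 * gauss_weight s a)
      = cmod (LINT p|lborel. H p * gauss_kernel s (fst p - snd p))"
    unfolding eq[symmetric] by simp
  also have "ennreal \<dots> \<le> (\<integral>\<^sup>+p. ennreal (cmod (H p * gauss_kernel s (fst p - snd p))) \<partial>lborel)"
  proof (cases "integrable lborel (\<lambda>p. H p * gauss_kernel s (fst p - snd p))")
    case True
    then show ?thesis by (rule integral_norm_bound_ennreal)
  qed (simp add: not_integrable_integral_eq)
  also have "\<dots> \<le> (\<integral>\<^sup>+p. ennreal (A (fst p) * gauss_kernel s (fst p - snd p))
        + ennreal (A (snd p) * gauss_kernel s (fst p - snd p)) \<partial>lborel)"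
  proof (rule nn_integral_mono)
    fix p :: "'a \<times> 'a"
    define a b where "a = cmod (h (fst p))" and "b = cmod (h (snd p))"
    have "0 \<le> (a - b)\<^sup>2" by simp
    then have "a * b \<le> a\<^sup>2 / 2 + b\<^sup>2 / 2" by (simp add: power2_diff)
    then have "a * b * gauss_kernel s (fst p - snd p)
        \<le> (a\<^sup>2 / 2 + b\<^sup>2 / 2) * gauss_kernel s (fst p - snd p)"
      by (intro mult_right_mono) (use s in auto)
    then have "cmod (H p * gauss_kernel s (fst p - snd p))
      \<le> A (fst p) * gauss_kernel s (fst p - snd p)
        + A (snd p) * gauss_kernel s (fst p - snd p)"
      using s by (simp add: H_def norm_mult a_def b_def A_def distrib_right)
    from ennreal_leI[OF this]
    show "ennreal (cmod (H p * gauss_kernel s (fst p - snd p)))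
      \<le> ennreal (A (fst p) * gauss_kernel s (fst p - snd p))
        + ennreal (A (snd p) * gauss_kernel s (fst p - snd p))"
      using s A by simp
  qed
  also have "\<dots> = (\<integral>\<^sup>+p. ennreal (A (fst p) * gauss_kernel s (fst p - snd p)) \<partial>(lborel \<Otimes>\<^sub>M lborel))
        + (\<integral>\<^sup>+p. ennreal (A (snd p) * gauss_kernel s (fst p - snd p)) \<partial>(lborel \<Otimes>\<^sub>M lborel))"
    unfolding lborel_prod by (rule nn_integral_add) measurable
  also have "(\<integral>\<^sup>+p. ennreal (A (fst p) * gauss_kernel s (fst p - snd p)) \<partial>(lborel \<Otimes>\<^sub>M lborel))
      = (\<integral>\<^sup>+v. ennreal (A v) * (\<integral>\<^sup>+w. ennreal (gauss_kernel s (v - w)) \<partial>lborel) \<partial>lborel)"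
    using s A by (subst lborel.nn_integral_fst[symmetric]) (simp_all add: ennreal_mult nn_integral_cmult)
  also have "\<dots> = (\<integral>\<^sup>+v. ennreal (A v) \<partial>lborel)"
  proof -
    \<comment> \<open>For fixed \<open>v\<close> the reflection taking \<open>w\<close> to
      \<open>v - w\<close> preserves Lebesgue measure, so the mass stays 1.\<close>
    have "(\<integral>\<^sup>+w. ennreal (gauss_kernel s (v - w)) \<partial>lborel) = 1" for v :: 'a
    proof -
      have "(\<integral>\<^sup>+w. ennreal (gauss_kernel s (w::'a)) \<partial>lborel)
         = (\<integral>\<^sup>+w. ennreal (gauss_kernel s (v - w)) \<partial>lborel)"
        by (subst lborel_affine[of "-1" v])
           (simp_all add: nn_integral_density nn_integral_distr)
      then show ?thesis using nn_integral_gauss_kernel[OF s, where 'a='a] by simp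
    qed
    then show ?thesis by simp
  qed
  also have "(\<integral>\<^sup>+p. ennreal (A (snd p) * gauss_kernel s (fst p - snd p)) \<partial>(lborel \<Otimes>\<^sub>M lborel))
      = (\<integral>\<^sup>+w. ennreal (A w) * (\<integral>\<^sup>+v. ennreal (gauss_kernel s (v - w)) \<partial>lborel) \<partial>lborel)"
    using s A by (subst lborel_pair.nn_integral_snd[symmetric]) (simp_all add: ennreal_mult nn_integral_cmult)
  also have "\<dots> = (\<integral>\<^sup>+v. ennreal (A v) \<partial>lborel)"
  proof -
    have "(\<integral>\<^sup>+v. ennreal (gauss_kernel s (v - w)) \<partial>lborel) = 1" for w :: 'a
    proof -
      have "(\<integral>\<^sup>+v. ennreal (gauss_kernel s (v::'a)) \<partial>lborel)
         = (\<integral>\<^sup>+v. ennreal (gauss_kernel s (v - w)) \<partial>lborel)"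
        by (subst lborel_affine[of 1 "- w"])
           (simp_all add: nn_integral_density nn_integral_distr)
      then show ?thesis using nn_integral_gauss_kernel[OF s, where 'a='a] by simp
    qed
    then show ?thesis by simp
  qed
  also have "(\<integral>\<^sup>+v. ennreal (A v) \<partial>lborel) + (\<integral>\<^sup>+v. ennreal (A v) \<partial>lborel)
     = sqn lborel h"
    by (subst nn_integral_add[symmetric]) (simp_all add: A_def flip: ennreal_plus)
  finally show ?thesis .
qed

lemma efourier_measurable [measurable]:
  assumes [measurable]: "h \<in> borel_measurable borel"
  shows "efourier h \<in> borel_measurable borel"
  unfolding efourier_def[abs_def] by measurable

text \<open>In the integrable case Fatou's lemma removes the Gaussian weight, which tends pointwise
  to 1 as the parameter tends to 0.\<close>

theorem sqn_efourier_le: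
  fixes h :: "'a::euclidean_space \<Rightarrow> complex"
  assumes [measurable]: "h \<in> borel_measurable borel"
  shows "sqn lborel (efourier h) \<le> sqn lborel h"
proof (cases "integrable lborel h")
  case True
  \<comment> \<open>The shift to \<open>Suc j\<close> keeps the parameter positive from the first
    term on.\<close>
  define s where "s j = 1 / real (Suc j)" for j
  have s0: "s \<longlonglongrightarrow> 0" unfolding s_def by (rule LIMSEQ_Suc[OF lim_1_over_n])
  have "(\<lambda>j. ennreal ((cmod (efourier h a))\<^sup>2 * gauss_weight (s j) a)) \<longlonglongrightarrow> ennreal ((cmod (efourier h a))\<^sup>2 * 1)" for a
  proof (intro tendsto_ennrealI tendsto_mult tendsto_const)
    have "(\<lambda>j. gauss_weight (s j) a) \<longlonglongrightarrow> (\<Prod>b\<in>(Basis::'a set). exp (- (0 * (a \<bullet> b))\<^sup>2 / 2))"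
      unfolding gauss_weight_def by (intro tendsto_intros s0) simp
    then show "(\<lambda>j. gauss_weight (s j) a) \<longlonglongrightarrow> 1" by simp
  qed
  then have "liminf (\<lambda>j. ennreal ((cmod (efourier h a))\<^sup>2 * gauss_weight (s j) a)) = ennreal ((cmod (efourier h a))\<^sup>2)" for a
    using lim_imp_Liminf[OF sequentially_bot] by fastforce
  then have "sqn lborel (efourier h) = (\<integral>\<^sup>+a. liminf (\<lambda>j. ennreal ((cmod (efourier h a))\<^sup>2 * gauss_weight (s j) a)) \<partial>lborel)"
    by simp
  also have "\<dots> \<le> liminf (\<lambda>j. \<integral>\<^sup>+a. ennreal ((cmod (efourier h a))\<^sup>2 * gauss_weight (s j) a) \<partial>lborel)"
    by (rule nn_integral_liminf) simp
  also have "\<dots> \<le> liminf (\<lambda>j. sqn lborel h)"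
    by (intro Liminf_mono always_eventually allI sqn_efourier_weighted_le True) (simp add: s_def)
  finally show ?thesis by (simp add: Liminf_const)
next
  case False
  \<comment> \<open>Multiplication by a character leaves the modulus unchanged, so the integrand is
    non-integrable at every frequency and the integral takes its default value 0.\<close>
  have "efourier h a = 0" for a
  proof -
    have "\<not> integrable lborel (\<lambda>w. h w * cis (2 * pi * (w \<bullet> a)))"
    proof
      assume "integrable lborel (\<lambda>w. h w * cis (2 * pi * (w \<bullet> a)))"
      then have "integrable lborel h"
        by (rule Bochner_Integration.integrable_bound) (auto simp: norm_mult)
      with False show False ..
    qed
    then show ?thesis by (simp add: efourier_def not_integrable_integral_eq)
  qed
  then show ?thesis by simp
qed

section \<open>Haar measure and the Schroedinger representation\<close>

lemma heis_mult_simp: "heis_mult p q = (fst p + fst q, fst (snd p) + fst (snd q),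
   snd (snd p) + snd (snd q) + (fst q \<bullet> fst (snd p) - fst (snd q) \<bullet> fst p) / 2)"
  by (cases p; cases q) simp

lemma heis_inv_mult_cancel: "heis_mult (heis_inv p) (heis_mult p q) = q"
  by (cases p; cases q) (simp add: inner_add_right inner_diff_right inner_commute field_simps)

lemma heis_mult_inv_cancel: "heis_mult p (heis_mult (heis_inv p) q) = q"
  by (cases p; cases q) (simp add: inner_add_right inner_diff_right inner_commute field_simps)

lemma heis_mult_measurable [measurable]:
  "heis_mult p \<in> borel_measurable (borel :: ('n::finite heis) measure)"
  unfolding heis_mult_simp[abs_def] by measurable

lemma nn_integral_lborel_translate:
  fixes f :: "'a::euclidean_space \<Rightarrow> ennreal"
  assumes [measurable]: "f \<in> borel_measurable borel"
  shows "(\<integral>\<^sup>+x. f (c + x) \<partial>lborel) = (\<integral>\<^sup>+x. f x \<partial>lborel)"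
  by (subst (2) lborel_affine[of 1 c])
     (simp_all add: nn_integral_density nn_integral_distr)

lemma nn_integral_heis:
  fixes F :: "'n::finite heis \<Rightarrow> ennreal"
  assumes [measurable]: "F \<in> borel_measurable borel"
  shows "(\<integral>\<^sup>+X. F X \<partial>lborel) = (\<integral>\<^sup>+x. \<integral>\<^sup>+y. \<integral>\<^sup>+t. F (x, y, t) \<partial>lborel \<partial>lborel \<partial>lborel)"
proof -
  have "(\<integral>\<^sup>+X. F X \<partial>lborel) = (\<integral>\<^sup>+x. \<integral>\<^sup>+q. F (x, q) \<partial>lborel \<partial>lborel)"
    unfolding lborel_prod[symmetric, where 'a="real^'n" and 'b="(real^'n) \<times> real"]
    by (rule lborel.nn_integral_fst[symmetric]) (simp add: lborel_prod)
  also have "\<dots> = (\<integral>\<^sup>+x. \<integral>\<^sup>+y. \<integral>\<^sup>+t. F (x, y, t) \<partial>lborel \<partial>lborel \<partial>lborel)"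
  proof (rule nn_integral_cong)
    fix x
    show "(\<integral>\<^sup>+q. F (x, q) \<partial>lborel) = (\<integral>\<^sup>+y. \<integral>\<^sup>+t. F (x, y, t) \<partial>lborel \<partial>lborel)"
      unfolding lborel_prod[symmetric, where 'a="real^'n" and 'b=real]
      by (rule lborel.nn_integral_fst[symmetric, where f="\<lambda>q. F (x, q)"]) (simp add: lborel_prod)
  qed
  finally show ?thesis .
qed

text \<open>The central coordinate is shifted by an amount depending on \<open>x\<close> and
  \<open>y\<close>. The innermost integral over \<open>t\<close> absorbs this shift; what is left
  are ordinary translations in \<open>y\<close> and then in \<open>x\<close>.\<close>

lemma nn_integral_heis_mult:
  fixes F :: "'n::finite heis \<Rightarrow> ennreal"
  assumes [measurable]: "F \<in> borel_measurable borel"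
  shows "(\<integral>\<^sup>+X. F (heis_mult p X) \<partial>lborel) = (\<integral>\<^sup>+X. F X \<partial>lborel)"
proof (cases p)
  case (fields a b c)
  have "(\<integral>\<^sup>+X. F (heis_mult p X) \<partial>lborel)
     = (\<integral>\<^sup>+x. \<integral>\<^sup>+y. \<integral>\<^sup>+t. F (a + x, b + y, (c + (x \<bullet> b - y \<bullet> a) / 2) + t) \<partial>lborel \<partial>lborel \<partial>lborel)"
    by (subst nn_integral_heis) (simp_all add: fields algebra_simps)
  also have "\<dots> = (\<integral>\<^sup>+x. \<integral>\<^sup>+y. \<integral>\<^sup>+t. F (a + x, b + y, t) \<partial>lborel \<partial>lborel \<partial>lborel)"
    by (simp add: nn_integral_lborel_translate[where f="\<lambda>t. F (_, _, t)"])
  also have "\<dots> = (\<integral>\<^sup>+x. \<integral>\<^sup>+y. \<integral>\<^sup>+t. F (a + x, y, t) \<partial>lborel \<partial>lborel \<partial>lborel)"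
    by (simp add: nn_integral_lborel_translate[where f="\<lambda>y. \<integral>\<^sup>+t. F (_, y, t) \<partial>lborel"])
  also have "\<dots> = (\<integral>\<^sup>+X. F X \<partial>lborel)"
    by (subst nn_integral_heis)
       (simp_all add: nn_integral_lborel_translate[where f="\<lambda>x. \<integral>\<^sup>+y. \<integral>\<^sup>+t. F (x, y, t) \<partial>lborel \<partial>lborel"])
  finally show ?thesis .
qed

lemma distr_heis_mult: "distr lborel borel (heis_mult p) = (lborel :: ('n::finite heis) measure)"
proof (rule measure_eqI)
  fix A assume "A \<in> sets (distr lborel borel (heis_mult p))"
  then have A: "A \<in> sets borel" by simp
  have "emeasure (distr lborel borel (heis_mult p)) A = (\<integral>\<^sup>+X. indicator A X \<partial>distr lborel borel (heis_mult p))"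
    using A by simp
  also have "\<dots> = (\<integral>\<^sup>+X. indicator A (heis_mult p X) \<partial>lborel)"
    using A by (subst nn_integral_distr) auto
  also have "\<dots> = (\<integral>\<^sup>+X. indicator A X \<partial>lborel)"
    using A by (intro nn_integral_heis_mult) auto
  also have "\<dots> = emeasure lborel A"
    using A by simp
  finally show "emeasure (distr lborel borel (heis_mult p)) A = emeasure lborel A" .
qed simp

lemma integral_heis_mult:
  fixes F :: "'n::finite heis \<Rightarrow> complex"
  assumes [measurable]: "F \<in> borel_measurable borel"
  shows "(LINT X|lborel. F (heis_mult p X)) = (LINT X|lborel. F X)"
  using integral_distr[of "heis_mult p" lborel borel F] by (simp add: distr_heis_mult)

lemma schroedinger_mult:
  "schroedinger lam (heis_mult p q) u = schroedinger lam p (schroedinger lam q u)"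
proof (cases p; cases q)
  fix x y t v w s assume pq: "p = (x, y, t)" "q = (v, w, s)"
  show ?thesis
  proof
    fix \<xi>
    \<comment> \<open>These are the phases of both sides without the factor \<open>2 * pi\<close>.
      Through the half commutator in the group law the cross term \<open>x \<bullet> w\<close>
      cancels, and the two halves of \<open>v \<bullet> y\<close> combine into the phase that the
      inner operator picks up at \<open>\<xi> + y\<close>.\<close>
    have "lam * (t + s + (v \<bullet> y - w \<bullet> x) / 2) + lam * ((x + v) \<bullet> \<xi> + ((x + v) \<bullet> (y + w)) / 2)
       = lam * t + lam * (x \<bullet> \<xi> + (x \<bullet> y) / 2) + (lam * s + lam * (v \<bullet> (\<xi> + y) + (v \<bullet> w) / 2))"
      by (simp add: inner_add_left inner_add_right inner_commute field_simps)
    from arg_cong[OF this, of "\<lambda>r. cis (2 * pi * r)"]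
    show "schroedinger lam (heis_mult p q) u \<xi> = schroedinger lam p (schroedinger lam q u) \<xi>"
      by (simp add: pq cis_mult algebra_simps)
  qed
qed

section \<open>Schroedinger operators as invertible isometries\<close>

lemma schroedinger_simp: "schroedinger lam p u \<xi> =
  cis (2 * pi * lam * snd (snd p)) * cis (2 * pi * lam * (fst p \<bullet> \<xi> + (fst p \<bullet> fst (snd p)) / 2)) * u (\<xi> + fst (snd p))"
  by (cases p) simp

lemma schroedinger_zero: "schroedinger lam (0, 0, 0) u = u"
  by (simp add: fun_eq_iff cis_zero zero_prod_def)

lemma schroedinger_inv: "schroedinger lam (heis_inv p) (schroedinger lam p u) = u"
proof -
  have "heis_mult (heis_inv p) p = (0, 0, 0)"
    by (cases p) (simp add: inner_commute)
  then show ?thesis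
    by (simp add: schroedinger_mult[symmetric] schroedinger_zero)
qed

lemma schroedinger_measurable [measurable (raw)]:
  assumes [measurable]: "u \<in> borel_measurable borel"
  shows "schroedinger lam p u \<in> borel_measurable borel"
  unfolding schroedinger_simp[abs_def] by measurable

lemma sqn_schroedinger:
  assumes [measurable]: "u \<in> borel_measurable borel"
  shows "sqn lborel (schroedinger lam p u) = sqn lborel u"
  unfolding schroedinger_simp norm_mult norm_cis mult_1
  using nn_integral_lborel_translate[of "\<lambda>x. ennreal ((cmod (u x))\<^sup>2)" "fst (snd p)"]
  by (simp add: add.commute)

lemma L2_schroedinger: "u \<in> L2 lborel \<Longrightarrow> schroedinger lam p u \<in> L2 lborel"
  by (auto simp: L2_iff sqn_schroedinger)

lemma l2_inner_schroedinger:
  fixes u v :: "real^'n::finite \<Rightarrow> complex"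
  assumes [measurable]: "u \<in> borel_measurable borel" "v \<in> borel_measurable borel"
  shows "l2_inner lborel (schroedinger lam p u) (schroedinger lam p v) = l2_inner lborel u v"
proof -
  have "l2_inner lborel (schroedinger lam p u) (schroedinger lam p v)
     = (LINT \<xi>|lborel. u (\<xi> + fst (snd p)) * cnj (v (\<xi> + fst (snd p))))"
  proof -
    have "schroedinger lam p u \<xi> * cnj (schroedinger lam p v \<xi>)
      = u (\<xi> + fst (snd p)) * cnj (v (\<xi> + fst (snd p)))" for \<xi>
      by (simp add: schroedinger_simp cis_cnj cis_mult algebra_simps)
    then show ?thesis by (simp add: l2_inner_def)
  qed
  also have "\<dots> = l2_inner lborel u v"
    using integral_distr[of "(+) (fst (snd p))" lborel borel "\<lambda>x. u x * cnj (v x)"]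
    by (simp add: l2_inner_def add.commute lborel_distr_plus)
  finally show ?thesis .
qed

section \<open>Integral kernels and Hilbert--Schmidt norms\<close>

lemma hs_norm2_leI:
  "(\<And>E. finite E \<Longrightarrow> orthonormal E \<Longrightarrow> (\<Sum>e\<in>E. sqn lborel (T e)) \<le> C) \<Longrightarrow> hs_norm2 T \<le> C"
  unfolding hs_norm2_def by (rule SUP_least) auto

lemma hs_norm2_upper:
  "finite E \<Longrightarrow> orthonormal E \<Longrightarrow> (\<Sum>e\<in>E. sqn lborel (T e)) \<le> hs_norm2 T"
  unfolding hs_norm2_def by (rule SUP_upper) auto

text \<open>The supremum runs over orthonormal sets and therefore sees an operator only on unit
  vectors and up to null sets. That is all that is known about an operator selected by
  \<open>fourier\<close>.\<close>

lemma hs_norm2_cong_AE: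
  assumes "\<And>e. e \<in> L2 lborel \<Longrightarrow> l2_inner lborel e e = 1 \<Longrightarrow> AE x in lborel. T e x = T' e x"
  shows "hs_norm2 T = hs_norm2 T'"
  unfolding hs_norm2_def
proof (intro SUP_cong refl sum.cong nn_integral_cong_AE)
  fix E and e :: "(real, 'a) vec \<Rightarrow> complex"
  assume "E \<in> {E. finite E \<and> orthonormal E}" "e \<in> E"
  then have "AE x in lborel. T e x = T' e x"
    by (intro assms) (auto simp: orthonormal_def)
  then show "AE x in lborel. ennreal ((cmod (T e x))\<^sup>2) = ennreal ((cmod (T' e x))\<^sup>2)"
    by eventually_elim simp
qed

text \<open>Cauchy-Schwarz costs the factor \<open>card S\<close>. This is harmless, since the bound
  is applied either to two terms or to a fixed \<open>S\<close> whose terms tend to 0.\<close>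

lemma hs_norm2_sum_le:
  fixes T :: "'i \<Rightarrow> 'n::finite l2op"
  assumes "\<And>i u. i \<in> S \<Longrightarrow> u \<in> L2 lborel \<Longrightarrow> T i u \<in> borel_measurable borel"
  shows "hs_norm2 (\<lambda>u x. \<Sum>i\<in>S. T i u x) \<le> of_nat (card S) * (\<Sum>i\<in>S. hs_norm2 (T i))"
proof (rule hs_norm2_leI)
  fix E :: "(real^'n \<Rightarrow> complex) set" assume E: "finite E" "orthonormal E"
  have "(\<Sum>e\<in>E. sqn lborel (\<lambda>x. \<Sum>i\<in>S. T i e x)) \<le> (\<Sum>e\<in>E. of_nat (card S) * (\<Sum>i\<in>S. sqn lborel (T i e)))"
    using E assms by (intro sum_mono sqn_sum_le) (auto simp: orthonormal_def)
  also have "\<dots> = of_nat (card S) * (\<Sum>i\<in>S. \<Sum>e\<in>E. sqn lborel (T i e))"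
    by (subst sum.swap) (simp add: sum_distrib_left)
  also have "\<dots> \<le> of_nat (card S) * (\<Sum>i\<in>S. hs_norm2 (T i))"
    by (intro mult_left_mono sum_mono hs_norm2_upper E) auto
  finally show "(\<Sum>e\<in>E. sqn lborel (\<lambda>x. \<Sum>i\<in>S. T i e x)) \<le> of_nat (card S) * (\<Sum>i\<in>S. hs_norm2 (T i))" .
qed

lemma hs_norm2_add_le:
  fixes T T' :: "'n::finite l2op"
  assumes "\<And>u. u \<in> L2 lborel \<Longrightarrow> T u \<in> borel_measurable borel" "\<And>u. u \<in> L2 lborel \<Longrightarrow> T' u \<in> borel_measurable borel"
  shows "hs_norm2 (\<lambda>u x. T u x + T' u x) \<le> 2 * hs_norm2 T + 2 * hs_norm2 T'"
  using hs_norm2_sum_le[of "UNIV :: bool set" "\<lambda>b. if b then T else T'"] assms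
  by (simp add: UNIV_bool distrib_left add.commute)

lemma hs_norm2_diff_commute: "hs_norm2 (\<lambda>u x. T u x - T' u x) = hs_norm2 (\<lambda>u x. T' u x - T u x)"
  by (simp add: hs_norm2_def norm_minus_commute)

lemma hs_norm2_cmult_le:
  fixes T :: "'n::finite l2op"
  assumes "\<And>u. u \<in> L2 lborel \<Longrightarrow> T u \<in> borel_measurable borel"
  shows "hs_norm2 (\<lambda>u x. a * T u x) \<le> ennreal ((cmod a)\<^sup>2) * hs_norm2 T"
proof (rule hs_norm2_leI)
  fix E :: "(real^'n \<Rightarrow> complex) set" assume E: "finite E" "orthonormal E"
  have "(\<Sum>e\<in>E. sqn lborel (\<lambda>x. a * T e x)) = (\<Sum>e\<in>E. ennreal ((cmod a)\<^sup>2) * sqn lborel (T e))"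
    using E assms by (intro sum.cong sqn_cmult) (auto simp: orthonormal_def)
  also have "\<dots> \<le> ennreal ((cmod a)\<^sup>2) * hs_norm2 T"
    unfolding sum_distrib_left[symmetric] by (intro mult_left_mono hs_norm2_upper E) auto
  finally show "(\<Sum>e\<in>E. sqn lborel (\<lambda>x. a * T e x)) \<le> ennreal ((cmod a)\<^sup>2) * hs_norm2 T" .
qed

lemma orthonormal_schroedinger:
  assumes "orthonormal E"
  shows "orthonormal (schroedinger lam p ` E)"
proof -
  have inj: "schroedinger lam p u = schroedinger lam p v \<longleftrightarrow> u = v" for u v
    by (metis schroedinger_inv)
  show ?thesis
    using assms unfolding orthonormal_def
    by (auto simp: L2_schroedinger inj l2_inner_schroedinger L2_lborel_measurable subset_iff)
qed

text \<open>The inner operator maps orthonormal sets to orthonormal sets, and the outer one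
  preserves every norm in the sum.\<close>

lemma hs_norm2_schroedinger_le:
  fixes T :: "'n::finite l2op"
  assumes "\<And>u. u \<in> L2 lborel \<Longrightarrow> T u \<in> borel_measurable borel"
  shows "hs_norm2 (\<lambda>u. schroedinger lam p (T (schroedinger lam q u))) \<le> hs_norm2 T"
proof (rule hs_norm2_leI)
  fix E :: "(real^'n \<Rightarrow> complex) set" assume E: "finite E" "orthonormal E"
  have "inj_on (schroedinger lam q) E" by (rule inj_onI) (metis schroedinger_inv)
  then have "(\<Sum>e\<in>E. sqn lborel (schroedinger lam p (T (schroedinger lam q e))))
     = (\<Sum>e\<in>schroedinger lam q ` E. sqn lborel (T e))"
    using E assms by (auto simp: sum.reindex sqn_schroedinger L2_schroedinger orthonormal_def intro!: sum.cong)
  also have "\<dots> \<le> hs_norm2 T"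
    using E by (intro hs_norm2_upper orthonormal_schroedinger) auto
  finally show "(\<Sum>e\<in>E. sqn lborel (schroedinger lam p (T (schroedinger lam q e)))) \<le> hs_norm2 T" .
qed

text \<open>
  Up to the shift \<open>\<eta> = \<xi> + y\<close> this is the integral kernel \<open>K(\<xi>, \<eta>)\<close> of the transform of \<open>g\<close> at \<open>lam\<close>.
\<close>

definition heis_kernel :: "('n::finite heis \<Rightarrow> complex) \<Rightarrow> real \<Rightarrow> real^'n \<Rightarrow> real^'n \<Rightarrow> complex" where
  "heis_kernel g lam \<xi> y = efourier (\<lambda>q. g (fst q, y, snd q)) (lam *\<^sub>R (\<xi> + (1/2) *\<^sub>R y), lam)"

text \<open>The middle variable is made the outer one because the kernel is a Fourier transform in
  \<open>(x, t)\<close> for each fixed \<open>y\<close>.\<close>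

lemma nn_integral_heis_swap:
  fixes F :: "'n::finite heis \<Rightarrow> ennreal"
  assumes [measurable]: "F \<in> borel_measurable borel"
  shows "(\<integral>\<^sup>+X. F X \<partial>lborel) = (\<integral>\<^sup>+y. \<integral>\<^sup>+q. F (fst q, y, snd q) \<partial>lborel \<partial>lborel)"
proof -
  have "(\<integral>\<^sup>+q. F (fst q, y, snd q) \<partial>lborel) = (\<integral>\<^sup>+x. \<integral>\<^sup>+t. F (x, y, t) \<partial>lborel \<partial>lborel)" for y
    unfolding lborel_prod[symmetric, where 'a="real^'n" and 'b=real]
    by (subst lborel.nn_integral_fst[symmetric]) (simp_all add: lborel_prod)
  then show ?thesis
    unfolding nn_integral_heis[OF assms]
    by (simp add: lborel_pair.Fubini'[where f="\<lambda>x y. \<integral>\<^sup>+t. F (x, y, t) \<partial>lborel"])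
qed

lemma integral_heis_swap:
  fixes F :: "'n::finite heis \<Rightarrow> complex"
  assumes F: "integrable lborel F"
  shows "(LINT X|lborel. F X) = (LINT y|lborel. LINT q|lborel. F (fst q, y, snd q))"
proof -
  have [measurable]: "F \<in> borel_measurable borel" using F by (simp add: borel_measurable_integrable)
  \<comment> \<open>Exchanging the first two coordinates preserves Lebesgue measure; this carries
    the reordering over to Bochner integrals.\<close>
  define \<sigma> where "\<sigma> X = (fst (snd X), fst X, snd (snd X))" for X :: "'n heis"
  have [measurable]: "\<sigma> \<in> borel_measurable borel" unfolding \<sigma>_def[abs_def] by measurable
  have d: "distr lborel borel \<sigma> = lborel"
  proof (rule measure_eqI)
    fix A assume "A \<in> sets (distr lborel borel \<sigma>)"
    then have [measurable]: "A \<in> sets borel" by simp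
    have "emeasure (distr lborel borel \<sigma>) A = (\<integral>\<^sup>+X. indicator A X \<partial>distr lborel borel \<sigma>)"
      by simp
    also have "\<dots> = (\<integral>\<^sup>+X. indicator A (\<sigma> X) \<partial>lborel)"
      by (subst nn_integral_distr) auto
    also have "\<dots> = (\<integral>\<^sup>+y. \<integral>\<^sup>+q. indicator A (y, fst q, snd q) \<partial>lborel \<partial>lborel)"
      by (subst nn_integral_heis_swap) (simp_all add: \<sigma>_def)
    also have "\<dots> = (\<integral>\<^sup>+X. indicator A X \<partial>lborel)"
      unfolding lborel_prod[symmetric, where 'a="real^'n" and 'b="(real^'n) \<times> real"]
      by (subst lborel.nn_integral_fst[symmetric]) (simp_all add: lborel_prod)
    also have "\<dots> = emeasure lborel A" by simp
    finally show "emeasure (distr lborel borel \<sigma>) A = emeasure lborel A" .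
  qed simp
  have i: "integrable lborel (\<lambda>X. F (\<sigma> X))"
    using F integrable_distr[of \<sigma> lborel borel F] by (simp add: d)
  have "(LINT X|lborel. F X) = (LINT X|lborel. F (\<sigma> X))"
    using integral_distr[of \<sigma> lborel borel F] by (simp add: d)
  also have "\<dots> = (LINT y|lborel. LINT q|lborel. F (\<sigma> (y, q)))"
    using i unfolding lborel_prod[symmetric, where 'a="real^'n" and 'b="(real^'n) \<times> real"]
    by (intro lborel_pair.integral_fst'[symmetric])
  finally show ?thesis by (simp add: \<sigma>_def)
qed

text \<open>The phase of the representation is the inner product of \<open>(x, t)\<close> with
  \<open>(lam *\<^sub>R (\<xi> + (1/2) *\<^sub>R y), lam)\<close>, while
  \<open>u (\<xi> + y)\<close> depends on \<open>y\<close> alone and leaves the inner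
  integral.\<close>

lemma fourier_L1_eq_kernel:
  assumes "integrable lborel (\<lambda>X. g X * schroedinger lam X u \<xi>)"
  shows "fourier_L1 g lam u \<xi> = (LINT y|lborel. heis_kernel g lam \<xi> y * u (\<xi> + y))"
proof -
  have "g (x, y, t) * schroedinger lam (x, y, t) u \<xi>
     = g (x, y, t) * cis (2 * pi * ((x, t) \<bullet> (lam *\<^sub>R (\<xi> + (1/2) *\<^sub>R y), lam))) * u (\<xi> + y)" for x y t
    by (simp add: cis_mult inner_add_right algebra_simps)
  then have *: "g (fst q, y, snd q) * schroedinger lam (fst q, y, snd q) u \<xi>
     = g (fst q, y, snd q) * cis (2 * pi * (q \<bullet> (lam *\<^sub>R (\<xi> + (1/2) *\<^sub>R y), lam))) * u (\<xi> + y)" for q y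
    by (metis prod.collapse)
  show ?thesis
    unfolding fourier_L1_def integral_heis_swap[OF assms] heis_kernel_def efourier_def *
    by simp
qed

section \<open>Energy of the kernel\<close>

lemma heis_kernel_measurable [measurable (raw)]:
  fixes g :: "'n::finite heis \<Rightarrow> complex"
  assumes [measurable]: "g \<in> borel_measurable borel"
    "a \<in> borel_measurable M" "b \<in> borel_measurable M" "c \<in> borel_measurable M"
  shows "(\<lambda>x. heis_kernel g (a x) (b x) (c x)) \<in> borel_measurable M"
  unfolding heis_kernel_def efourier_def by measurable

definition kernel_energy :: "('n::finite heis \<Rightarrow> complex) \<Rightarrow> real \<Rightarrow> real^'n \<Rightarrow> ennreal" where
  "kernel_energy g lam \<xi> = sqn lborel (heis_kernel g lam \<xi>)"

text \<open>The squared \<open>L2\<close> norm of the whole kernel. It dominates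
  \<open>hs_norm2\<close> and is measurable in \<open>lam\<close>, so integrals over
  \<open>lam\<close> are taken of it.\<close>

definition kernel_hs :: "('n::finite heis \<Rightarrow> complex) \<Rightarrow> real \<Rightarrow> ennreal" where
  "kernel_hs g lam = (\<integral>\<^sup>+\<xi>. kernel_energy g lam \<xi> \<partial>lborel)"

lemma kernel_energy_measurable [measurable (raw)]:
  fixes g :: "'n::finite heis \<Rightarrow> complex"
  assumes [measurable]: "g \<in> borel_measurable borel"
    "a \<in> borel_measurable M" "b \<in> borel_measurable M"
  shows "(\<lambda>x. kernel_energy g (a x) (b x)) \<in> borel_measurable M"
  unfolding kernel_energy_def by measurable

lemma kernel_hs_measurable [measurable]:
  fixes g :: "'n::finite heis \<Rightarrow> complex"
  assumes [measurable]: "g \<in> borel_measurable borel"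
  shows "kernel_hs g \<in> borel_measurable borel"
  unfolding kernel_hs_def[abs_def] by measurable

lemma fourier_L1_sq_le:
  fixes u :: "real^'n::finite \<Rightarrow> complex"
  assumes [measurable]: "g \<in> borel_measurable borel" "u \<in> borel_measurable borel"
  shows "ennreal ((cmod (fourier_L1 g lam u \<xi>))\<^sup>2) \<le> kernel_energy g lam \<xi> * sqn lborel u"
proof (cases "integrable lborel (\<lambda>X. g X * schroedinger lam X u \<xi>)")
  case True
  have "ennreal ((cmod (fourier_L1 g lam u \<xi>))\<^sup>2)
      \<le> sqn lborel (heis_kernel g lam \<xi>) * sqn lborel (\<lambda>y. u (\<xi> + y))"
    unfolding fourier_L1_eq_kernel[OF True] by (rule cauchy_schwarz_sqn) auto
  also have "sqn lborel (\<lambda>y. u (\<xi> + y)) = sqn lborel u"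
    by (rule nn_integral_lborel_translate) simp
  finally show ?thesis by (simp add: kernel_energy_def)
qed (simp add: fourier_L1_def not_integrable_integral_eq)

text \<open>Bessel's inequality for the row of the kernel at \<open>\<xi>\<close>, tested against
  the translates of \<open>E\<close>. In contrast to summing Cauchy-Schwarz over \<open>E\<close>,
  it gives a bound independent of the size of \<open>E\<close>.\<close>

lemma fourier_L1_bessel:
  fixes E :: "(real^'n::finite \<Rightarrow> complex) set"
  assumes [measurable]: "g \<in> borel_measurable borel" and E: "finite E" "orthonormal E"
  shows "(\<Sum>e\<in>E. ennreal ((cmod (fourier_L1 g lam e \<xi>))\<^sup>2)) \<le> kernel_energy g lam \<xi>"
proof -
  \<comment> \<open>The kernel formula is available only for vectors whose integral at this
    \<open>\<xi>\<close> converges; for the others \<open>fourier_L1\<close> takes the default value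
    0, so they drop out of the sum.\<close>
  define E' where "E' = {e \<in> E. integrable lborel (\<lambda>X. g X * schroedinger lam X e \<xi>)}"
  define \<tau> where "\<tau> e y = e (\<xi> + y)" for e :: "real^'n \<Rightarrow> complex" and y
  \<comment> \<open>Translation is the Schroedinger operator with parameter 0 at
    \<open>(0, \<xi>, 0)\<close>, hence injective and compatible with orthonormality.\<close>
  have \<tau>': "\<tau> e = schroedinger 0 (0, \<xi>, 0) e" for e
    by (simp add: \<tau>_def fun_eq_iff add.commute)
  have inj: "inj_on \<tau> E'" unfolding \<tau>' by (rule inj_onI) (metis schroedinger_inv)
  have "orthonormal E'" using E by (auto simp: orthonormal_def E'_def)
  then have on: "orthonormal (\<tau> ` E')" unfolding \<tau>' by (rule orthonormal_schroedinger)
  have "(\<Sum>e\<in>E. ennreal ((cmod (fourier_L1 g lam e \<xi>))\<^sup>2)) = (\<Sum>e\<in>E'. ennreal ((cmod (fourier_L1 g lam e \<xi>))\<^sup>2))"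
    using E by (intro sum.mono_neutral_right) (auto simp: E'_def fourier_L1_def not_integrable_integral_eq)
  also have "\<dots> = (\<Sum>e\<in>\<tau> ` E'. ennreal ((cmod (LINT y|lborel. heis_kernel g lam \<xi> y * e y))\<^sup>2))"
    by (subst sum.reindex[OF inj]) (auto intro!: sum.cong simp: \<tau>_def E'_def fourier_L1_eq_kernel)
  also have "\<dots> \<le> sqn lborel (heis_kernel g lam \<xi>)"
    using on E by (intro bessel) (auto simp: orthonormal_def E'_def)
  finally show ?thesis by (simp add: kernel_energy_def)
qed

lemma fourier_L1_measurable [measurable (raw)]:
  fixes u :: "real^'n::finite \<Rightarrow> complex"
  assumes [measurable]: "g \<in> borel_measurable borel" "u \<in> borel_measurable borel"
  shows "fourier_L1 g lam u \<in> borel_measurable borel"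
  unfolding fourier_L1_def[abs_def] schroedinger_simp by measurable

lemma hs_norm2_fourier_L1_le:
  fixes g :: "'n::finite heis \<Rightarrow> complex"
  assumes [measurable]: "g \<in> borel_measurable borel"
  shows "hs_norm2 (fourier_L1 g lam) \<le> kernel_hs g lam"
proof (rule hs_norm2_leI)
  fix E :: "(real^'n \<Rightarrow> complex) set" assume E: "finite E" "orthonormal E"
  then have [measurable]: "e \<in> borel_measurable borel" if "e \<in> E" for e
    using that by (auto simp: orthonormal_def L2_iff)
  have "(\<Sum>e\<in>E. sqn lborel (fourier_L1 g lam e)) = (\<integral>\<^sup>+\<xi>. (\<Sum>e\<in>E. ennreal ((cmod (fourier_L1 g lam e \<xi>))\<^sup>2)) \<partial>lborel)"
    by (subst nn_integral_sum) auto
  also have "\<dots> \<le> kernel_hs g lam"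
    unfolding kernel_hs_def by (intro nn_integral_mono fourier_L1_bessel E) auto
  finally show "(\<Sum>e\<in>E. sqn lborel (fourier_L1 g lam e)) \<le> kernel_hs g lam" .
qed

theorem nn_integral_kernel_hs_le:
  fixes g :: "'n::finite heis \<Rightarrow> complex"
  assumes [measurable]: "g \<in> borel_measurable borel"
  shows "(\<integral>\<^sup>+lam. kernel_hs g lam * ennreal (\<bar>lam\<bar> ^ CARD('n)) \<partial>lborel) \<le> sqn lborel g"
proof -
  define F where "F y z = ennreal ((cmod (efourier (\<lambda>q. g (fst q, y, snd q)) z))\<^sup>2)" for y z
  have [measurable (raw)]: "(\<lambda>x. F (a x) (b x)) \<in> borel_measurable M"
    if [measurable]: "a \<in> borel_measurable M" "b \<in> borel_measurable M" for a b and M :: "'b measure"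
    unfolding F_def efourier_def by measurable
  have 1: "kernel_hs g lam * ennreal (\<bar>lam\<bar> ^ CARD('n)) = (\<integral>\<^sup>+y. \<integral>\<^sup>+a. F y (a, lam) \<partial>lborel \<partial>lborel)"
    if "lam \<noteq> 0" for lam
  proof -
    have "kernel_hs g lam * ennreal (\<bar>lam\<bar> ^ CARD('n))
       = (\<integral>\<^sup>+\<xi>. \<integral>\<^sup>+y. F y (lam *\<^sub>R (\<xi> + (1/2) *\<^sub>R y), lam) * ennreal (\<bar>lam\<bar> ^ CARD('n)) \<partial>lborel \<partial>lborel)"
      unfolding kernel_hs_def kernel_energy_def heis_kernel_def F_def[symmetric]
      by (simp add: nn_integral_multc)
    also have "\<dots> = (\<integral>\<^sup>+y. \<integral>\<^sup>+\<xi>. F y (lam *\<^sub>R (\<xi> + (1/2) *\<^sub>R y), lam) * ennreal (\<bar>lam\<bar> ^ CARD('n)) \<partial>lborel \<partial>lborel)"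
      by (rule lborel_pair.Fubini'[symmetric]) simp
    also have "\<dots> = (\<integral>\<^sup>+y. \<integral>\<^sup>+a. F y (a, lam) \<partial>lborel \<partial>lborel)"
    proof (rule nn_integral_cong)
      fix y
      show "(\<integral>\<^sup>+\<xi>. F y (lam *\<^sub>R (\<xi> + (1/2) *\<^sub>R y), lam) * ennreal (\<bar>lam\<bar> ^ CARD('n)) \<partial>lborel)
        = (\<integral>\<^sup>+a. F y (a, lam) \<partial>lborel)"
        \<comment> \<open>The substitution
          \<open>a = lam *\<^sub>R (\<xi> + (1/2) *\<^sub>R y)\<close> has Jacobian
          \<open>\<bar>lam\<bar> ^ CARD('n)\<close>, which is exactly the weight.\<close>
        by (subst (2) lborel_affine[OF that, of "lam *\<^sub>R ((1/2) *\<^sub>R y)"])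
           (simp add: nn_integral_density nn_integral_distr scaleR_add_right add.commute mult.commute)
    qed
    finally show ?thesis .
  qed
  have "(\<integral>\<^sup>+lam. kernel_hs g lam * ennreal (\<bar>lam\<bar> ^ CARD('n)) \<partial>lborel)
      = (\<integral>\<^sup>+lam. \<integral>\<^sup>+y. \<integral>\<^sup>+a. F y (a, lam) \<partial>lborel \<partial>lborel \<partial>lborel)"
    using AE_lborel_singleton[of "0::real"] by (intro nn_integral_cong_AE) (auto simp: 1)
  also have "\<dots> = (\<integral>\<^sup>+y. \<integral>\<^sup>+lam. \<integral>\<^sup>+a. F y (a, lam) \<partial>lborel \<partial>lborel \<partial>lborel)"
    by (rule lborel_pair.Fubini'[symmetric]) simp
  also have "\<dots> = (\<integral>\<^sup>+y. \<integral>\<^sup>+z. F y z \<partial>lborel \<partial>lborel)"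
    unfolding lborel_prod[symmetric, where 'a="real^'n" and 'b=real]
    by (subst lborel_pair.nn_integral_snd) (simp_all add: lborel_prod)
  \<comment> \<open>For each fixed \<open>y\<close> the Euclidean inequality acts in the variables
    \<open>(x, t)\<close>, whose frequencies are \<open>(a, lam)\<close>.\<close>
  also have "\<dots> \<le> (\<integral>\<^sup>+y. sqn lborel (\<lambda>q. g (fst q, y, snd q)) \<partial>lborel)"
    unfolding F_def by (intro nn_integral_mono sqn_efourier_le) simp
  also have "\<dots> = sqn lborel g"
    by (subst nn_integral_heis_swap) simp_all
  finally show ?thesis .
qed

section \<open>Transforms of boundedly supported functions\<close>

text \<open>This class contains all truncations and is closed under linear combinations and left
  translations. The integral defining \<open>fourier_L1\<close> converges absolutely at every
  \<open>\<xi>\<close> on it, so identities between transforms hold pointwise and not just almost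
  everywhere.\<close>

definition heis_test :: "('n::finite heis \<Rightarrow> complex) \<Rightarrow> bool" where
  "heis_test g \<longleftrightarrow> g \<in> L2 lborel \<and> (\<exists>R. \<forall>X. g X \<noteq> 0 \<longrightarrow> norm X \<le> R)"

lemma heis_test_measurable: "heis_test g \<Longrightarrow> g \<in> borel_measurable borel"
  by (simp add: heis_test_def L2_iff)

lemma heis_test_cmult: "heis_test g \<Longrightarrow> heis_test (\<lambda>X. a * g X)"
  unfolding heis_test_def by (auto intro: L2_cmult)

lemma heis_test_add:
  assumes "heis_test g" "heis_test h"
  shows "heis_test (\<lambda>X. g X + h X)"
proof -
  obtain R R' where R: "\<And>X. g X \<noteq> 0 \<Longrightarrow> norm X \<le> R" "\<And>X. h X \<noteq> 0 \<Longrightarrow> norm X \<le> R'"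
    using assms unfolding heis_test_def by blast
  have "norm X \<le> max R R'" if "g X + h X \<noteq> 0" for X
    using that R[of X] by (cases "g X = 0") auto
  then show ?thesis using assms unfolding heis_test_def by (auto intro: L2_add)
qed

lemma heis_test_diff: "heis_test g \<Longrightarrow> heis_test h \<Longrightarrow> heis_test (\<lambda>X. g X - h X)"
  using heis_test_add[of g "\<lambda>X. -1 * h X"] heis_test_cmult[of h "-1"] by simp

lemma heis_test_zero: "heis_test (\<lambda>X. 0)"
  by (simp add: heis_test_def L2_iff)

lemma heis_test_sum: "(\<And>p. p \<in> S \<Longrightarrow> heis_test (g p)) \<Longrightarrow> heis_test (\<lambda>X. \<Sum>p\<in>S. g p X)"
  by (induction S rule: infinite_finite_induct) (auto simp: heis_test_zero intro: heis_test_add)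

lemma heis_test_truncate:
  assumes "f \<in> L2 lborel"
  shows "heis_test (truncate N f)"
proof -
  have [measurable]: "f \<in> borel_measurable borel" using assms by (simp add: L2_iff)
  have "sqn lborel (truncate N f) \<le> sqn lborel f"
    by (rule nn_integral_mono) (simp add: truncate_def)
  moreover have "truncate N f \<in> borel_measurable borel"
    unfolding truncate_def[abs_def] by measurable
  ultimately have "truncate N f \<in> L2 lborel"
    using assms by (auto simp: L2_iff)
  then show ?thesis by (auto simp: heis_test_def truncate_def split: if_splits)
qed

lemma sqn_left_translate:
  assumes [measurable]: "g \<in> borel_measurable borel"
  shows "sqn lborel (left_translate p g) = sqn lborel g"
  unfolding left_translate_def
  by (rule nn_integral_heis_mult[where F="\<lambda>X. ennreal ((cmod (g X))\<^sup>2)"]) simp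

lemma left_translate_measurable [measurable (raw)]:
  assumes [measurable]: "g \<in> borel_measurable borel"
  shows "left_translate p g \<in> borel_measurable borel"
  unfolding left_translate_def by measurable

lemma L2_left_translate: "g \<in> L2 lborel \<Longrightarrow> left_translate p g \<in> L2 lborel"
  by (auto simp: L2_iff sqn_left_translate)

text \<open>The new support lies in the image of a compact ball under the continuous map
  \<open>heis_mult p\<close>, hence in some ball again.\<close>

lemma heis_test_left_translate:
  assumes "heis_test g"
  shows "heis_test (left_translate p g)"
proof -
  obtain R where R: "\<And>X. g X \<noteq> 0 \<Longrightarrow> norm X \<le> R"
    using assms unfolding heis_test_def by blast
  have "continuous_on (cball 0 R) (heis_mult p)"
    unfolding heis_mult_simp[abs_def] by (intro continuous_intros) auto
  then have "bounded (heis_mult p ` cball 0 R)"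
    by (intro compact_imp_bounded compact_continuous_image) auto
  then obtain R' where R': "\<And>Y. Y \<in> heis_mult p ` cball 0 R \<Longrightarrow> norm Y \<le> R'"
    unfolding bounded_iff by blast
  have "norm X \<le> R'" if "left_translate p g X \<noteq> 0" for X
  proof -
    have "heis_mult (heis_inv p) X \<in> cball 0 R"
      using R that by (simp add: left_translate_def)
    then have "heis_mult p (heis_mult (heis_inv p) X) \<in> heis_mult p ` cball 0 R" by blast
    then show ?thesis by (intro R') (simp only: heis_mult_inv_cancel)
  qed
  then show ?thesis
    using assms unfolding heis_test_def by (auto intro: L2_left_translate)
qed

text \<open>On the support of \<open>g\<close> the coordinates \<open>x\<close> and \<open>t\<close>
  are bounded, while \<open>u (\<xi> + y)\<close> is square-integrable in \<open>y\<close>. The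
  integrand is thus dominated by a product of two square-integrable functions.\<close>

lemma heis_test_integrable:
  fixes u :: "real^'n::finite \<Rightarrow> complex"
  assumes g: "heis_test g" and u: "u \<in> L2 lborel"
  shows "integrable lborel (\<lambda>X. g X * schroedinger lam X u \<xi>)"
proof -
  have [measurable]: "g \<in> borel_measurable borel" "u \<in> borel_measurable borel"
    using g u by (simp_all add: heis_test_measurable L2_lborel_measurable)
  obtain R where R: "\<And>X. g X \<noteq> 0 \<Longrightarrow> norm X \<le> R"
    using g unfolding heis_test_def by blast
  \<comment> \<open>Only \<open>x\<close> and \<open>t\<close> are cut off; integrability in
    \<open>y\<close> comes from \<open>u\<close>.\<close>
  define b where "b X = (if norm (fst X) \<le> R \<and> norm (snd (snd X)) \<le> R then cmod (u (\<xi> + fst (snd X))) else 0)" for X :: "'n heis"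
  have [measurable]: "b \<in> borel_measurable borel" unfolding b_def[abs_def] by measurable
  have b0: "0 \<le> b X" for X by (simp add: b_def)
  have [measurable]: "cball (0::real^'n) R \<in> sets borel" "cball (0::real) R \<in> sets borel"
    by simp_all
  have b_eq: "ennreal ((b (x, y, t))\<^sup>2)
      = indicator (cball 0 R) x * (ennreal ((cmod (u (\<xi> + y)))\<^sup>2) * indicator (cball 0 R) t)" for x y t
    by (simp add: b_def indicator_def)
  have "(\<integral>\<^sup>+X. ennreal ((b X)\<^sup>2) \<partial>lborel)
      = (\<integral>\<^sup>+x. \<integral>\<^sup>+y. \<integral>\<^sup>+t. indicator (cball (0::real^'n) R) x * (ennreal ((cmod (u (\<xi> + y)))\<^sup>2) * indicator (cball (0::real) R) t) \<partial>lborel \<partial>lborel \<partial>lborel)"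
    by (subst nn_integral_heis) (simp_all only: b_eq, measurable)
  also have "\<dots> = emeasure lborel (cball (0::real^'n) R) * (sqn lborel (\<lambda>y. u (\<xi> + y)) * emeasure lborel (cball (0::real) R))"
    by (simp add: nn_integral_cmult nn_integral_multc)
  also have "sqn lborel (\<lambda>y. u (\<xi> + y)) = sqn lborel u"
    by (rule nn_integral_lborel_translate[where f="\<lambda>y. ennreal ((cmod (u y))\<^sup>2)"]) simp
  also have "emeasure lborel (cball (0::real^'n) R) * (sqn lborel u * emeasure lborel (cball (0::real) R)) < \<infinity>"
    using u emeasure_bounded_finite[OF bounded_cball[of "0::real^'n" R]]
      emeasure_bounded_finite[OF bounded_cball[of "0::real" R]]
    by (simp add: L2_iff ennreal_mult_less_top)
  finally have bL: "(\<lambda>X. complex_of_real (b X)) \<in> L2 lborel"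
    by (auto simp: L2_iff)
  have "integrable lborel (\<lambda>X. g X * complex_of_real (b X))"
    using g bL by (intro L2_integrable_mult) (auto simp: heis_test_def)
  then show ?thesis
  proof (rule Bochner_Integration.integrable_bound)
    show "AE X in lborel. cmod (g X * schroedinger lam X u \<xi>) \<le> cmod (g X * complex_of_real (b X))"
    proof (rule AE_I2)
      fix X
      show "cmod (g X * schroedinger lam X u \<xi>) \<le> cmod (g X * complex_of_real (b X))"
      proof (cases "g X = 0")
        case False
        then have "norm X \<le> R" by (rule R)
        moreover have "norm (fst X) \<le> norm X" "norm (snd (snd X)) \<le> norm X"
          by (metis norm_fst_le prod.collapse, metis norm_snd_le order_trans prod.collapse)
        ultimately have "b X = cmod (u (\<xi> + fst (snd X)))"
          by (simp add: b_def)
        then show ?thesis by (simp add: norm_mult schroedinger_simp)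
      qed simp
    qed
  next
    show "(\<lambda>X. g X * schroedinger lam X u \<xi>) \<in> borel_measurable lborel"
      unfolding schroedinger_simp by measurable
  qed
qed

section \<open>Linearity and covariance of \<open>fourier_L1\<close>\<close>

lemma fourier_L1_diff:
  assumes "heis_test g" "heis_test h" "u \<in> L2 lborel"
  shows "fourier_L1 (\<lambda>X. g X - h X) lam u \<xi> = fourier_L1 g lam u \<xi> - fourier_L1 h lam u \<xi>"
  using assms by (simp add: fourier_L1_def left_diff_distrib heis_test_integrable)

lemma fourier_L1_sum:
  assumes "\<And>p. p \<in> S \<Longrightarrow> heis_test (g p)" "u \<in> L2 lborel"
  shows "fourier_L1 (\<lambda>X. \<Sum>p\<in>S. c p * g p X) lam u \<xi> = (\<Sum>p\<in>S. c p * fourier_L1 (g p) lam u \<xi>)"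
  using assms
  by (simp add: fourier_L1_def sum_distrib_right mult.assoc heis_test_integrable)

lemma schroedinger_linear:
  "schroedinger lam p (\<lambda>y. a * u y + b * v y) \<xi> = a * schroedinger lam p u \<xi> + b * schroedinger lam p v \<xi>"
  by (simp add: schroedinger_simp algebra_simps)

lemma fourier_L1_linear:
  assumes "heis_test g" "u \<in> L2 lborel" "v \<in> L2 lborel"
  shows "fourier_L1 g lam (\<lambda>y. a * u y + b * v y) \<xi> = a * fourier_L1 g lam u \<xi> + b * fourier_L1 g lam v \<xi>"
proof -
  have "g X * schroedinger lam X (\<lambda>y. a * u y + b * v y) \<xi>
      = a * (g X * schroedinger lam X u \<xi>) + b * (g X * schroedinger lam X v \<xi>)" for X
    by (simp only: schroedinger_linear) (simp add: algebra_simps)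
  then show ?thesis
    using assms by (simp add: fourier_L1_def heis_test_integrable)
qed

text \<open>Substituting \<open>heis_mult p X\<close> for \<open>X\<close> undoes the translation,
  and the homomorphism property pulls the operator at \<open>p\<close> out of the integral.\<close>

lemma fourier_L1_left_translate:
  fixes u :: "real^'n::finite \<Rightarrow> complex"
  assumes [measurable]: "g \<in> borel_measurable borel" "u \<in> borel_measurable borel"
  shows "fourier_L1 (left_translate p g) lam u = schroedinger lam p (fourier_L1 g lam u)"
proof
  fix \<xi>
  have "fourier_L1 (left_translate p g) lam u \<xi>
      = (LINT X|lborel. left_translate p g (heis_mult p X) * schroedinger lam (heis_mult p X) u \<xi>)"
    unfolding fourier_L1_def
    by (rule integral_heis_mult[symmetric]) (unfold schroedinger_simp, measurable)
  also have "\<dots> = (LINT X|lborel. g X * schroedinger lam p (schroedinger lam X u) \<xi>)"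
    by (simp only: left_translate_def heis_inv_mult_cancel schroedinger_mult)
  also have "\<dots> = schroedinger lam p (fourier_L1 g lam u) \<xi>"
    unfolding schroedinger_simp[of lam p] fourier_L1_def
    by (subst integral_mult_right_zero[symmetric]) (simp add: mult_ac)
  finally show "fourier_L1 (left_translate p g) lam u \<xi> = schroedinger lam p (fourier_L1 g lam u) \<xi>" .
qed

lemma fourier_L1_modulate:
  fixes u :: "real^'n::finite \<Rightarrow> complex"
  shows "fourier_L1 (modulate (lam *\<^sub>R \<xi>2, - (lam *\<^sub>R \<xi>1), 0) g) lam u
    = schroedinger lam (\<xi>1, \<xi>2, 0) (fourier_L1 g lam (schroedinger lam (- \<xi>1, - \<xi>2, 0) u))"
proof
  fix \<xi>
  let ?p = "(\<xi>1, \<xi>2, 0) :: 'n heis"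
  have "modulate (lam *\<^sub>R \<xi>2, - (lam *\<^sub>R \<xi>1), 0) g X * schroedinger lam X u \<xi>
     = g X * schroedinger lam ?p (schroedinger lam X (schroedinger lam (- \<xi>1, - \<xi>2, 0) u)) \<xi>" for X
  proof (cases X)
    case (fields x y t)
    \<comment> \<open>Conjugation changes only the central coordinate, and the phase of that change
      is the modulating character at \<open>X\<close>.\<close>
    have "heis_mult (heis_mult ?p X) (- \<xi>1, - \<xi>2, 0) = (x, y, t + (x \<bullet> \<xi>2 - y \<bullet> \<xi>1))"
      by (simp add: fields inner_add_right inner_commute field_simps)
    then show ?thesis
      unfolding schroedinger_mult[symmetric]
      by (simp add: fields cis_mult inner_commute algebra_simps)
  qed
  then have "fourier_L1 (modulate (lam *\<^sub>R \<xi>2, - (lam *\<^sub>R \<xi>1), 0) g) lam u \<xi>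
     = (LINT X|lborel. g X * schroedinger lam ?p (schroedinger lam X (schroedinger lam (- \<xi>1, - \<xi>2, 0) u)) \<xi>)"
    by (simp only: fourier_L1_def)
  also have "\<dots> = schroedinger lam ?p (fourier_L1 g lam (schroedinger lam (- \<xi>1, - \<xi>2, 0) u)) \<xi>"
    unfolding schroedinger_simp[of lam ?p] fourier_L1_def
    by (subst integral_mult_right_zero[symmetric]) (simp add: mult_ac)
  finally show "fourier_L1 (modulate (lam *\<^sub>R \<xi>2, - (lam *\<^sub>R \<xi>1), 0) g) lam u \<xi>
    = schroedinger lam ?p (fourier_L1 g lam (schroedinger lam (- \<xi>1, - \<xi>2, 0) u)) \<xi>" .
qed

text \<open>The \<open>LEAST\<close> in \<open>trunc_radius\<close> is attained because some radius
  qualifies, by dominated convergence. Squaring the error \<open>(1/2) ^ j\<close> gives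
  \<open>(1/4) ^ j\<close>.\<close>

lemma sqn_truncate_error:
  fixes f :: "'n::finite heis \<Rightarrow> complex"
  assumes f: "f \<in> L2 lborel"
  shows "sqn lborel (\<lambda>X. f X - truncate (trunc_radius f j) f X) \<le> ennreal ((1/4) ^ j)"
proof -
  let ?d = "\<lambda>N X. f X - truncate N f X"
  have [measurable]: "f \<in> borel_measurable borel" using f by (simp add: L2_iff)
  have [measurable]: "?d N \<in> borel_measurable borel" for N
    unfolding truncate_def[abs_def] by measurable
  have dL: "?d N \<in> L2 lborel" for N
    using f heis_test_truncate[OF f] by (intro L2_diff) (auto simp: heis_test_def)
  have "(\<lambda>N. LINT X|lborel. (cmod (?d N X))\<^sup>2) \<longlonglongrightarrow> (LINT X|(lborel :: 'n heis measure). (0::real))"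
  proof (rule Bochner_Integration.integral_dominated_convergence[where w="\<lambda>X. (cmod (f X))\<^sup>2"])
    show "AE X in lborel. (\<lambda>N. (cmod (?d N X))\<^sup>2) \<longlonglongrightarrow> 0"
    proof (rule AE_I2)
      fix X :: "'n heis"
      obtain N0 where N0: "norm X \<le> real N0" using real_arch_simple by blast
      have "\<forall>\<^sub>F N in sequentially. (cmod (?d N X))\<^sup>2 = 0"
        using eventually_ge_at_top[of N0] by eventually_elim (use N0 in \<open>auto simp: truncate_def\<close>)
      then show "(\<lambda>N. (cmod (?d N X))\<^sup>2) \<longlonglongrightarrow> 0" by (rule tendsto_eventually)
    qed
  qed (use f in \<open>auto simp: L2_def truncate_def\<close>)
  then have "(\<lambda>N. l2_norm lborel (?d N)) \<longlonglongrightarrow> 0"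
    using tendsto_real_sqrt[of _ 0 sequentially] by (auto simp: l2_norm_def)
  then have "\<forall>\<^sub>F N in sequentially. l2_norm lborel (?d N) < (1/2) ^ j"
    by (rule order_tendstoD) simp
  then obtain N where "l2_norm lborel (?d N) < (1/2) ^ j"
    unfolding eventually_sequentially by blast
  then have "l2_norm lborel (?d N) \<le> (1/2) ^ j" by simp
  then have "l2_norm lborel (?d (trunc_radius f j)) \<le> (1/2) ^ j"
    unfolding trunc_radius_def by (rule LeastI)
  then have "(l2_norm lborel (?d (trunc_radius f j)))\<^sup>2 \<le> ((1/2) ^ j)\<^sup>2"
    by (intro power_mono) (auto simp: l2_norm_def)
  also have "((1/2) ^ j)\<^sup>2 = (1/4 :: real) ^ j"
    by (simp add: power_mult_distrib power2_eq_square flip: power_mult_distrib)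
  finally show ?thesis
    unfolding sqn_eq_l2_norm[OF dL] by (rule ennreal_leI)
qed

text \<open>
  Cauchy--Schwarz for the telescoping sum with weights \<open>2\<^sup>-\<^sup>m\<close> and \<open>2\<^sup>m\<close>. The right-hand side is quadratic, so that it can
  be summed over orthonormal sets and integrated.
\<close>

lemma fast_cauchy_limit:
  fixes A :: "nat \<Rightarrow> complex"
  assumes X: "(\<Sum>m. ennreal (2 ^ m * (cmod (A (Suc m) - A m))\<^sup>2)) < \<infinity>" (is "?X < _")
  shows "convergent A"
    and "ennreal ((cmod (A j - lim A))\<^sup>2) \<le> ennreal (2 * (1/2) ^ j) * (\<Sum>m. ennreal (2 ^ m * (cmod (A (Suc m) - A m))\<^sup>2))"
proof -
  define a where "a m = A (Suc m) - A m" for m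
  define x where "x m = 2 ^ m * (cmod (a m))\<^sup>2" for m
  have x0: "0 \<le> x m" for m by (simp add: x_def)
  have sx: "summable x"
    using X by (intro summable_suminf_not_top) (auto simp: x_def a_def less_top)
  have Xe: "?X = ennreal (suminf x)"
    by (subst suminf_ennreal_eq[OF x0 summable_sums[OF sx], symmetric]) (simp add: x_def a_def)
  \<comment> \<open>The tail of the geometric weights, which is the source of the factor
    \<open>2 * (1/2) ^ j\<close> in the conclusion.\<close>
  have geo: "(\<Sum>m\<in>{j..<i}. (1/2 :: real) ^ m) \<le> 2 * (1/2) ^ j" for i j
  proof (cases "j \<le> i")
    case True
    have "(\<Sum>m\<in>{j..<i}. (1/2 :: real) ^ m) = 2 * (1/2) ^ j - 2 * (1/2) ^ i"
      using True by (induction i rule: dec_induct) simp_all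
    then show ?thesis by simp
  qed simp
  have bound: "(cmod (A j - A i))\<^sup>2 \<le> 2 * (1/2) ^ j * suminf x" if "j \<le> i" for i j
  proof -
    have "A i - A j = (\<Sum>m\<in>{j..<i}. a m)"
      unfolding a_def using that by (simp add: sum_Suc_diff')
    then have "(cmod (A j - A i))\<^sup>2 = (cmod (\<Sum>m\<in>{j..<i}. a m))\<^sup>2"
      by (metis norm_minus_commute)
    also have "\<dots> \<le> (\<Sum>m\<in>{j..<i}. cmod (a m))\<^sup>2"
      by (intro power_mono norm_sum) simp
    also have "(\<Sum>m\<in>{j..<i}. cmod (a m)) = (\<Sum>m\<in>{j..<i}. sqrt ((1/2) ^ m) * (sqrt (2 ^ m) * cmod (a m)))"
      by (intro sum.cong refl) (simp add: mult.assoc[symmetric] real_sqrt_mult[symmetric] power_mult_distrib[symmetric])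
    also have "\<dots>\<^sup>2 \<le> (\<Sum>m\<in>{j..<i}. (sqrt ((1/2) ^ m))\<^sup>2) * (\<Sum>m\<in>{j..<i}. (sqrt (2 ^ m) * cmod (a m))\<^sup>2)"
      by (rule Cauchy_Schwarz_ineq_sum)
    also have "\<dots> = (\<Sum>m\<in>{j..<i}. (1/2) ^ m) * (\<Sum>m\<in>{j..<i}. x m)"
      by (simp add: x_def power_mult_distrib)
    also have "\<dots> \<le> (2 * (1/2) ^ j) * suminf x"
      by (intro mult_mono geo sum_le_suminf sx) (auto simp: x0 sum_nonneg)
    finally show ?thesis .
  qed
  show conv: "convergent A"
    unfolding Cauchy_convergent_iff[symmetric] Cauchy_altdef2
  proof (intro allI impI)
    fix e :: real assume e: "e > 0"
    have "(\<lambda>j. 2 * (1/2 :: real) ^ j * suminf x) \<longlonglongrightarrow> 2 * 0 * suminf x"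
      by (intro tendsto_intros LIMSEQ_power_zero) simp
    then have "\<forall>\<^sub>F j in sequentially. 2 * (1/2 :: real) ^ j * suminf x < e\<^sup>2"
      using e by (intro order_tendstoD) auto
    then obtain N where N: "2 * (1/2 :: real) ^ N * suminf x < e\<^sup>2"
      unfolding eventually_sequentially by blast
    have "dist (A n) (A N) < e" if "n \<ge> N" for n
    proof -
      have "(cmod (A N - A n))\<^sup>2 < e\<^sup>2" using bound[OF that] N by linarith
      then show ?thesis using e by (simp add: dist_norm norm_minus_commute power2_less_imp_less)
    qed
    then show "\<exists>N. \<forall>n\<ge>N. dist (A n) (A N) < e" by blast
  qed
  \<comment> \<open>The bound is uniform in \<open>i\<close>, so it survives the limit in
    \<open>i\<close> with \<open>j\<close> fixed.\<close>
  have "(\<lambda>i. (cmod (A j - A i))\<^sup>2) \<longlonglongrightarrow> (cmod (A j - lim A))\<^sup>2"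
    using conv by (intro tendsto_intros) (simp add: convergent_LIMSEQ_iff)
  then have "(cmod (A j - lim A))\<^sup>2 \<le> 2 * (1/2) ^ j * suminf x"
    by (rule LIMSEQ_le_const2) (use bound in blast)
  from ennreal_leI[OF this] show "ennreal ((cmod (A j - lim A))\<^sup>2) \<le> ennreal (2 * (1/2) ^ j) * ?X"
    unfolding Xe by (simp add: ennreal_mult suminf_nonneg[OF sx x0])
qed

section \<open>The transform at almost every parameter\<close>

text \<open>
  The property that \<open>fourier f lam\<close> selects; it determines \<open>T\<close> on unit vectors only up to null sets.
\<close>

definition fourier_spec :: "('n::finite heis \<Rightarrow> complex) \<Rightarrow> real \<Rightarrow> 'n l2op \<Rightarrow> bool" where
  "fourier_spec f lam T \<longleftrightarrow> bounded_l2op T \<and>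
      (\<lambda>j. hs_norm2 (\<lambda>u x. fourier_L1 (truncate (trunc_radius f j) f) lam u x - T u x)) \<longlonglongrightarrow> 0"

lemma fourier_spec_fourier:
  assumes "fourier_spec f lam T"
  shows "fourier_spec f lam (fourier f lam)"
proof -
  have "fourier f lam = (SOME T. fourier_spec f lam T)"
    by (simp add: fourier_def fourier_spec_def)
  then show ?thesis using someI[of "fourier_spec f lam", OF assms] by simp
qed

text \<open>Squared truncation errors of order \<open>(1/4) ^ m\<close> beat the weights
  \<open>2 ^ m\<close> used for fast convergence and leave a geometric series of ratio 1/2.\<close>

lemma ennreal_geometric_finite:
  "(\<Sum>m. ennreal (2 ^ m) * (C * ennreal ((1/4) ^ m))) = 2 * C"
proof -
  have "ennreal (2 ^ m) * (C * ennreal ((1/4) ^ m)) = C * ennreal ((1/2) ^ m)" for m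
  proof -
    have "ennreal (2 ^ m) * ennreal ((1/4) ^ m) = ennreal ((1/2) ^ m)"
      by (simp flip: ennreal_mult' power_mult_distrib)
    then show ?thesis by (simp add: mult.left_commute)
  qed
  then have "(\<Sum>m. ennreal (2 ^ m) * (C * ennreal ((1/4) ^ m))) = C * (\<Sum>m. ennreal ((1/2) ^ m))"
    by (simp only: ennreal_suminf_cmult)
  also have "(\<Sum>m. ennreal ((1/2) ^ m)) = ennreal 2"
    using geometric_sums[of "1/2::real"] by (intro suminf_ennreal_eq) auto
  finally show ?thesis by (simp add: mult.commute)
qed

text \<open>The transforms of the truncations converge pointwise wherever \<open>w \<xi>\<close> is
  finite. Since \<open>w\<close> does not involve \<open>u\<close>, one null set serves all vectors,
  which gives linearity of the limit. Cauchy-Schwarz on rows gives boundedness, and Bessel on rows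
  gives convergence in Hilbert-Schmidt norm.\<close>

lemma fourier_spec_exists_of_finite:
  fixes f :: "'n::finite heis \<Rightarrow> complex" and lam :: real
  defines "g \<equiv> \<lambda>j. truncate (trunc_radius f j) f"
  defines "d \<equiv> \<lambda>j X. g (Suc j) X - g j X"
  assumes f: "f \<in> L2 lborel"
    and W0: "kernel_hs (g 0) lam < \<infinity>"
    and W: "(\<Sum>m. ennreal (2 ^ m) * kernel_hs (d m) lam) < \<infinity>"
  shows "\<exists>T. fourier_spec f lam T"
proof -
  have gt: "heis_test (g j)" for j unfolding g_def by (rule heis_test_truncate[OF f])
  have dt: "heis_test (d j)" for j unfolding d_def by (intro heis_test_diff gt)
  have [measurable]: "g j \<in> borel_measurable borel" "d j \<in> borel_measurable borel" for j
    using gt dt by (simp_all add: heis_test_measurable)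
  define W' where "W' = (\<Sum>m. ennreal (2 ^ m) * kernel_hs (d m) lam)"
  define w where "w \<xi> = (\<Sum>m. ennreal (2 ^ m) * kernel_energy (d m) lam \<xi>)" for \<xi>
  have [measurable]: "w \<in> borel_measurable borel" unfolding w_def[abs_def] by measurable
  have w_int: "(\<integral>\<^sup>+\<xi>. w \<xi> \<partial>lborel) = W'"
    unfolding w_def W'_def by (simp add: nn_integral_suminf nn_integral_cmult kernel_hs_def)
  then have w_fin: "AE \<xi> in lborel. w \<xi> < \<infinity>"
    using W nn_integral_PInf_AE[of w lborel] by (auto simp: W'_def less_top)
  define T where "T u \<xi> = lim (\<lambda>j. fourier_L1 (g j) lam u \<xi>)" for u \<xi>
  have step: "fourier_L1 (g (Suc m)) lam u \<xi> - fourier_L1 (g m) lam u \<xi> = fourier_L1 (d m) lam u \<xi>"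
    if "u \<in> L2 lborel" for u \<xi> m
    unfolding d_def using that by (simp add: fourier_L1_diff gt)
  have energy: "(\<Sum>m. ennreal (2 ^ m * (cmod (fourier_L1 (d m) lam u \<xi>))\<^sup>2)) \<le> w \<xi> * sqn lborel u"
    if u: "u \<in> L2 lborel" for u \<xi>
  proof -
    have "(\<Sum>m. ennreal (2 ^ m * (cmod (fourier_L1 (d m) lam u \<xi>))\<^sup>2))
       \<le> (\<Sum>m. ennreal (2 ^ m) * (kernel_energy (d m) lam \<xi> * sqn lborel u))"
      using u by (intro suminf_le summableI)
        (auto simp: ennreal_mult L2_lborel_measurable intro!: mult_left_mono fourier_L1_sq_le)
    also have "\<dots> = w \<xi> * sqn lborel u"
      unfolding w_def by (simp add: mult.assoc[symmetric])
    finally show ?thesis .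
  qed
  \<comment> \<open>The bound keeps the series in \<open>u\<close> instead of estimating it by
    \<open>energy\<close>: summed over an orthonormal set, the series can be controlled by Bessel,
    whereas \<open>energy\<close> would cost the number of vectors.\<close>
  have lim: "(\<lambda>j. fourier_L1 (g j) lam u \<xi>) \<longlonglongrightarrow> T u \<xi>"
    and bound: "ennreal ((cmod (fourier_L1 (g j) lam u \<xi> - T u \<xi>))\<^sup>2)
      \<le> ennreal (2 * (1/2) ^ j) * (\<Sum>m. ennreal (2 ^ m * (cmod (fourier_L1 (d m) lam u \<xi>))\<^sup>2))"
    if "u \<in> L2 lborel" "w \<xi> < \<infinity>" for u \<xi> j
  proof -
    have "w \<xi> * sqn lborel u < \<infinity>"
      using that by (simp add: ennreal_mult_less_top L2_iff)
    then have fin: "(\<Sum>m. ennreal (2 ^ m * (cmod (fourier_L1 (g (Suc m)) lam u \<xi> - fourier_L1 (g m) lam u \<xi>))\<^sup>2)) < \<infinity>"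
      unfolding step[OF that(1)] by (rule le_less_trans[OF energy[OF that(1)]])
    show "(\<lambda>j. fourier_L1 (g j) lam u \<xi>) \<longlonglongrightarrow> T u \<xi>"
      using fast_cauchy_limit(1)[OF fin] by (simp add: T_def convergent_LIMSEQ_iff)
    show "ennreal ((cmod (fourier_L1 (g j) lam u \<xi> - T u \<xi>))\<^sup>2)
      \<le> ennreal (2 * (1/2) ^ j) * (\<Sum>m. ennreal (2 ^ m * (cmod (fourier_L1 (d m) lam u \<xi>))\<^sup>2))"
      using fast_cauchy_limit(2)[OF fin] unfolding step[OF that(1)] T_def .
  qed
  have Tm: "T u \<in> borel_measurable borel" if "u \<in> L2 lborel" for u
  proof -
    have [measurable]: "u \<in> borel_measurable borel" using that by (rule L2_lborel_measurable)
    show ?thesis unfolding T_def[abs_def] by measurable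
  qed
  \<comment> \<open>From \<open>T u = a - (a - T u)\<close> with \<open>a\<close> the transform of
    \<open>g 0\<close> at \<open>u\<close>. The squares of the two terms enter with factor 2, and
    \<open>bound\<close> at \<open>j = 0\<close> contributes another 2 to the second.\<close>
  define C where "C = 2 * kernel_hs (g 0) lam + 4 * W'"
  have C: "C < \<infinity>" using W W0 by (simp add: C_def W'_def ennreal_mult_less_top)
  have Tbd: "sqn lborel (T u) \<le> C * sqn lborel u" if u: "u \<in> L2 lborel" for u
  proof -
    have [measurable]: "u \<in> borel_measurable borel" using u by (rule L2_lborel_measurable)
    have "sqn lborel (T u) \<le> (\<integral>\<^sup>+\<xi>. (2 * kernel_energy (g 0) lam \<xi> + 4 * w \<xi>) * sqn lborel u \<partial>lborel)"
    proof (rule nn_integral_mono_AE)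
      show "AE \<xi> in lborel. ennreal ((cmod (T u \<xi>))\<^sup>2) \<le> (2 * kernel_energy (g 0) lam \<xi> + 4 * w \<xi>) * sqn lborel u"
        using w_fin
      proof eventually_elim
        case (elim \<xi>)
        have "ennreal ((cmod (fourier_L1 (g 0) lam u \<xi> - T u \<xi>))\<^sup>2) \<le> 2 * (w \<xi> * sqn lborel u)"
          using order_trans[OF bound[OF u elim, of 0] mult_left_mono[OF energy[OF u, of \<xi>]]]
          by simp
        note A = this
        have B: "ennreal ((cmod (fourier_L1 (g 0) lam u \<xi>))\<^sup>2) \<le> kernel_energy (g 0) lam \<xi> * sqn lborel u"
          by (rule fourier_L1_sq_le) auto
        have "ennreal ((cmod (T u \<xi>))\<^sup>2)
          \<le> 2 * ennreal ((cmod (fourier_L1 (g 0) lam u \<xi>))\<^sup>2) + 2 * ennreal ((cmod (fourier_L1 (g 0) lam u \<xi> - T u \<xi>))\<^sup>2)"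
          using ennreal_leI[OF cmod_diff_sq_le[of "fourier_L1 (g 0) lam u \<xi>" "fourier_L1 (g 0) lam u \<xi> - T u \<xi>"]]
          by (simp add: ennreal_mult)
        also have "\<dots> \<le> 2 * (kernel_energy (g 0) lam \<xi> * sqn lborel u) + 2 * (2 * (w \<xi> * sqn lborel u))"
          by (intro add_mono mult_left_mono A B) auto
        also have "\<dots> = (2 * kernel_energy (g 0) lam \<xi> + 4 * w \<xi>) * sqn lborel u"
          by (simp add: distrib_right mult.assoc[symmetric])
        finally show ?case .
      qed
    qed
    also have "\<dots> = C * sqn lborel u"
      by (simp add: nn_integral_multc nn_integral_add nn_integral_cmult C_def kernel_hs_def w_int)
    finally show ?thesis .
  qed
  have TL: "T u \<in> L2 lborel" if u: "u \<in> L2 lborel" for u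
    using u Tm[OF u] C by (auto simp: L2_iff ennreal_mult_less_top intro!: le_less_trans[OF Tbd])
  have "bounded_l2op T"
    unfolding bounded_l2op_def
  proof (intro conjI ballI allI)
    fix u v :: "real^'n \<Rightarrow> complex" and a b assume uv: "u \<in> L2 lborel" "v \<in> L2 lborel"
    then have uvL: "(\<lambda>y. a * u y + b * v y) \<in> L2 lborel" by (intro L2_add L2_cmult)
    show "AE x in lborel. T (\<lambda>y. a * u y + b * v y) x = a * T u x + b * T v x"
      using w_fin
    proof eventually_elim
      case (elim x)
      have "(\<lambda>j. a * fourier_L1 (g j) lam u x + b * fourier_L1 (g j) lam v x) \<longlonglongrightarrow> a * T u x + b * T v x"
        by (intro tendsto_intros lim uv elim)
      then have "(\<lambda>j. fourier_L1 (g j) lam (\<lambda>y. a * u y + b * v y) x) \<longlonglongrightarrow> a * T u x + b * T v x"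
        using uv by (simp add: fourier_L1_linear gt)
      with lim[OF uvL elim] show ?case by (rule LIMSEQ_unique)
    qed
  next
    show "\<exists>K. \<forall>u\<in>L2 lborel. l2_norm lborel (T u) \<le> K * l2_norm lborel u"
    proof (intro exI ballI)
      fix u :: "real^'n \<Rightarrow> complex" assume u: "u \<in> L2 lborel"
      have "ennreal ((l2_norm lborel (T u))\<^sup>2) \<le> ennreal (enn2real C) * ennreal ((l2_norm lborel u)\<^sup>2)"
        using Tbd[OF u] C by (simp add: sqn_eq_l2_norm[OF TL[OF u]] sqn_eq_l2_norm[OF u] less_top)
      then have "(l2_norm lborel (T u))\<^sup>2 \<le> enn2real C * (l2_norm lborel u)\<^sup>2"
        by (simp flip: ennreal_mult' add: ennreal_le_iff)
      then have "sqrt ((l2_norm lborel (T u))\<^sup>2) \<le> sqrt (enn2real C * (l2_norm lborel u)\<^sup>2)"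
        by (rule real_sqrt_le_mono)
      then show "l2_norm lborel (T u) \<le> sqrt (enn2real C) * l2_norm lborel u"
        by (simp add: real_sqrt_mult l2_norm_def)
    qed
  qed (use TL in auto)
  moreover have "(\<lambda>j. hs_norm2 (\<lambda>u x. fourier_L1 (g j) lam u x - T u x)) \<longlonglongrightarrow> 0"
  proof (rule tendsto_sandwich[OF _ _ tendsto_const])
    have le: "hs_norm2 (\<lambda>u x. fourier_L1 (g j) lam u x - T u x) \<le> ennreal (2 * (1/2) ^ j) * W'" for j
    proof (rule hs_norm2_leI)
      fix E :: "(real^'n \<Rightarrow> complex) set" assume E: "finite E" "orthonormal E"
      then have EL: "e \<in> L2 lborel" if "e \<in> E" for e using that by (auto simp: orthonormal_def)
      have [measurable]: "e \<in> borel_measurable borel" "T e \<in> borel_measurable borel" if "e \<in> E" for e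
        using that EL Tm by (auto simp: L2_lborel_measurable)
      have "(\<Sum>e\<in>E. sqn lborel (\<lambda>x. fourier_L1 (g j) lam e x - T e x))
         = (\<integral>\<^sup>+x. (\<Sum>e\<in>E. ennreal ((cmod (fourier_L1 (g j) lam e x - T e x))\<^sup>2)) \<partial>lborel)"
        by (subst nn_integral_sum) auto
      also have "\<dots> \<le> (\<integral>\<^sup>+x. ennreal (2 * (1/2) ^ j) * w x \<partial>lborel)"
      proof (rule nn_integral_mono_AE)
        show "AE x in lborel. (\<Sum>e\<in>E. ennreal ((cmod (fourier_L1 (g j) lam e x - T e x))\<^sup>2)) \<le> ennreal (2 * (1/2) ^ j) * w x"
          using w_fin
        proof eventually_elim
          case (elim x)
          have "(\<Sum>e\<in>E. ennreal ((cmod (fourier_L1 (g j) lam e x - T e x))\<^sup>2))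
            \<le> (\<Sum>e\<in>E. ennreal (2 * (1/2) ^ j) * (\<Sum>m. ennreal (2 ^ m * (cmod (fourier_L1 (d m) lam e x))\<^sup>2)))"
            by (intro sum_mono bound EL elim)
          \<comment> \<open>The sum over \<open>E\<close> is moved inside, so that Bessel applies to
            each increment \<open>d m\<close> separately.\<close>
          also have "\<dots> = ennreal (2 * (1/2) ^ j) * (\<Sum>m. \<Sum>e\<in>E. ennreal (2 ^ m * (cmod (fourier_L1 (d m) lam e x))\<^sup>2))"
            unfolding sum_distrib_left[symmetric] by (subst suminf_sum) auto
          also have "\<dots> = ennreal (2 * (1/2) ^ j) * (\<Sum>m. ennreal (2 ^ m) * (\<Sum>e\<in>E. ennreal ((cmod (fourier_L1 (d m) lam e x))\<^sup>2)))"
            by (simp add: ennreal_mult sum_distrib_left del: sum_ennreal)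
          also have "\<dots> \<le> ennreal (2 * (1/2) ^ j) * w x"
            unfolding w_def
            by (intro mult_left_mono suminf_le summableI fourier_L1_bessel E) auto
          finally show ?case .
        qed
      qed
      also have "\<dots> = ennreal (2 * (1/2) ^ j) * W'"
        by (simp add: nn_integral_cmult w_int)
      finally show "(\<Sum>e\<in>E. sqn lborel (\<lambda>x. fourier_L1 (g j) lam e x - T e x)) \<le> ennreal (2 * (1/2) ^ j) * W'" .
    qed
    then show "\<forall>\<^sub>F j in sequentially. hs_norm2 (\<lambda>u x. fourier_L1 (g j) lam u x - T u x) \<le> ennreal (2 * (1/2) ^ j) * W'"
      by simp
    have "(\<lambda>j. 2 * (1/2 :: real) ^ j * enn2real W') \<longlonglongrightarrow> 2 * 0 * enn2real W'"
      by (intro tendsto_intros LIMSEQ_power_zero) simp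
    then have "(\<lambda>j. ennreal (2 * (1/2 :: real) ^ j * enn2real W')) \<longlonglongrightarrow> ennreal 0"
      by (intro tendsto_ennrealI) simp
    then show "(\<lambda>j. ennreal (2 * (1/2) ^ j) * W') \<longlonglongrightarrow> 0"
      using W by (simp add: ennreal_mult W'_def less_top)
  qed simp
  ultimately show ?thesis unfolding fourier_spec_def g_def by blast
qed

text \<open>By the Plancherel inequality, the weighted integral over \<open>lam\<close> of the two
  quantities required to be finite for existence is itself finite. They are therefore finite almost
  everywhere off \<open>lam = 0\<close>, where the weight does not vanish.\<close>

theorem AE_fourier_spec:
  fixes f :: "'n::finite heis \<Rightarrow> complex"
  assumes f: "f \<in> L2 lborel"
  shows "AE lam in lborel. lam \<noteq> 0 \<longrightarrow> fourier_spec f lam (fourier f lam)"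
proof -
  define g where "g j = truncate (trunc_radius f j) f" for j
  define d where "d j X = g (Suc j) X - g j X" for j X
  have gt: "heis_test (g j)" for j unfolding g_def by (rule heis_test_truncate[OF f])
  have dt: "heis_test (d j)" for j unfolding d_def[abs_def] by (intro heis_test_diff gt)
  have [measurable]: "f \<in> borel_measurable borel" "g j \<in> borel_measurable borel" "d j \<in> borel_measurable borel" for j
    using f gt dt by (simp_all add: heis_test_measurable L2_lborel_measurable)
  have fg: "sqn lborel (\<lambda>X. f X - g j X) \<le> ennreal ((1/4) ^ j)" for j
    unfolding g_def by (rule sqn_truncate_error[OF f])
  \<comment> \<open>Each increment is a difference of two truncation errors, both at most
    \<open>(1/4) ^ j\<close> in square norm; the factor 4 is 2 + 2.\<close>
  have sd: "sqn lborel (d j) \<le> 4 * ennreal ((1/4) ^ j)" for j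
  proof -
    have "sqn lborel (d j) = sqn lborel (\<lambda>X. (f X - g j X) - (f X - g (Suc j) X))"
      by (simp add: d_def)
    also have "\<dots> \<le> 2 * sqn lborel (\<lambda>X. f X - g j X) + 2 * sqn lborel (\<lambda>X. f X - g (Suc j) X)"
      by (rule sqn_diff_le) auto
    also have "\<dots> \<le> 2 * ennreal ((1/4) ^ j) + 2 * ennreal ((1/4) ^ j)"
      using fg[of j] fg[of "Suc j"]
      by (intro add_mono mult_left_mono) (auto intro: order_trans ennreal_leI)
    finally show ?thesis by (simp add: distrib_right[symmetric])
  qed
  define W where "W lam = kernel_hs (g 0) lam + (\<Sum>m. ennreal (2 ^ m) * kernel_hs (d m) lam)" for lam
  have [measurable]: "W \<in> borel_measurable borel" unfolding W_def[abs_def] by measurable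
  have "(\<integral>\<^sup>+lam. W lam * ennreal (\<bar>lam\<bar> ^ CARD('n)) \<partial>lborel)
     = (\<integral>\<^sup>+lam. kernel_hs (g 0) lam * ennreal (\<bar>lam\<bar> ^ CARD('n)) \<partial>lborel)
       + (\<Sum>m. ennreal (2 ^ m) * (\<integral>\<^sup>+lam. kernel_hs (d m) lam * ennreal (\<bar>lam\<bar> ^ CARD('n)) \<partial>lborel))"
  proof -
    have "W lam * ennreal (\<bar>lam\<bar> ^ CARD('n)) = kernel_hs (g 0) lam * ennreal (\<bar>lam\<bar> ^ CARD('n))
        + (\<Sum>m. ennreal (2 ^ m) * (kernel_hs (d m) lam * ennreal (\<bar>lam\<bar> ^ CARD('n))))" for lam
      unfolding W_def distrib_right by (simp add: mult.assoc[symmetric])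
    then show ?thesis
      by (simp add: nn_integral_add nn_integral_suminf nn_integral_cmult)
  qed
  also have "\<dots> \<le> sqn lborel (g 0) + (\<Sum>m. ennreal (2 ^ m) * (4 * ennreal ((1/4) ^ m)))"
  proof -
    have "(\<integral>\<^sup>+lam. kernel_hs (d m) lam * ennreal (\<bar>lam\<bar> ^ CARD('n)) \<partial>lborel) \<le> 4 * ennreal ((1/4) ^ m)" for m
      by (rule order_trans[OF nn_integral_kernel_hs_le sd]) simp
    then have "(\<Sum>m. ennreal (2 ^ m) * (\<integral>\<^sup>+lam. kernel_hs (d m) lam * ennreal (\<bar>lam\<bar> ^ CARD('n)) \<partial>lborel))
      \<le> (\<Sum>m. ennreal (2 ^ m) * (4 * ennreal ((1/4) ^ m)))"
      by (intro suminf_le summableI mult_left_mono) auto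
    then show ?thesis by (intro add_mono nn_integral_kernel_hs_le) auto
  qed
  also have "\<dots> < \<infinity>"
    using gt[of 0] unfolding ennreal_geometric_finite
    by (auto simp: heis_test_def L2_iff ennreal_mult_less_top)
  finally have "AE lam in lborel. W lam * ennreal (\<bar>lam\<bar> ^ CARD('n)) \<noteq> \<infinity>"
    by (intro nn_integral_PInf_AE) auto
  then show ?thesis
  proof eventually_elim
    case (elim lam)
    show ?case
    proof
      assume "lam \<noteq> 0"
      with elim have "W lam < \<infinity>"
        by (auto simp: ennreal_mult_eq_top_iff less_top)
      then have "\<exists>T. fourier_spec f lam T"
        using fourier_spec_exists_of_finite[OF f, of lam]
        by (simp add: W_def g_def[symmetric] d_def[abs_def])
      then show "fourier_spec f lam (fourier f lam)"
        using fourier_spec_fourier by blast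
    qed
  qed
qed

section \<open>Modulations and the error of a partial sum\<close>

lemma AE_schroedinger:
  fixes u v :: "real^'n::finite \<Rightarrow> complex"
  assumes "AE x in lborel. u x = v x"
  shows "AE x in lborel. schroedinger lam p u x = schroedinger lam p v x"
proof -
  have "AE x in distr lborel borel ((+) (fst (snd p))). u x = v x"
    unfolding lborel_distr_plus by (rule assms)
  then have "AE x in lborel. u (fst (snd p) + x) = v (fst (snd p) + x)"
    by (rule AE_distrD[rotated]) simp
  then show ?thesis
    by eventually_elim (simp add: schroedinger_simp add.commute)
qed

lemma l2_norm_schroedinger:
  fixes u :: "real^'n::finite \<Rightarrow> complex"
  assumes "u \<in> L2 lborel"
  shows "l2_norm lborel (schroedinger lam p u) = l2_norm lborel u"
proof -
  have "ennreal ((l2_norm lborel (schroedinger lam p u))\<^sup>2) = ennreal ((l2_norm lborel u)\<^sup>2)"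
    using assms
    by (simp add: sqn_eq_l2_norm[symmetric] L2_schroedinger sqn_schroedinger L2_lborel_measurable)
  then show ?thesis by (simp add: l2_norm_def)
qed

lemma bounded_l2op_L2: "bounded_l2op T \<Longrightarrow> u \<in> L2 lborel \<Longrightarrow> T u \<in> L2 lborel"
  by (simp add: bounded_l2op_def)

lemma bounded_l2op_measurable: "bounded_l2op T \<Longrightarrow> u \<in> L2 lborel \<Longrightarrow> T u \<in> borel_measurable borel"
  by (rule L2_lborel_measurable) (rule bounded_l2op_L2)

lemma bounded_l2op_conj:
  fixes T :: "'n::finite l2op"
  assumes T: "bounded_l2op T"
  shows "bounded_l2op (schroedinger lam p \<circ> T \<circ> schroedinger lam q)"
  unfolding bounded_l2op_def o_apply
proof (intro conjI ballI allI)
  fix u v :: "real^'n \<Rightarrow> complex" and a b assume uv: "u \<in> L2 lborel" "v \<in> L2 lborel"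
  have "schroedinger lam q (\<lambda>y. a * u y + b * v y) = (\<lambda>y. a * schroedinger lam q u y + b * schroedinger lam q v y)"
    by (intro ext schroedinger_linear)
  moreover have "AE x in lborel. T (\<lambda>y. a * schroedinger lam q u y + b * schroedinger lam q v y) x
      = a * T (schroedinger lam q u) x + b * T (schroedinger lam q v) x"
    using T uv by (simp add: bounded_l2op_def L2_schroedinger)
  ultimately have "AE x in lborel. schroedinger lam p (T (schroedinger lam q (\<lambda>y. a * u y + b * v y))) x
      = schroedinger lam p (\<lambda>x. a * T (schroedinger lam q u) x + b * T (schroedinger lam q v) x) x"
    by (intro AE_schroedinger) simp
  then show "AE x in lborel. schroedinger lam p (T (schroedinger lam q (\<lambda>y. a * u y + b * v y))) x
      = a * schroedinger lam p (T (schroedinger lam q u)) x + b * schroedinger lam p (T (schroedinger lam q v)) x"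
    unfolding schroedinger_linear .
next
  obtain C where "\<And>u. u \<in> L2 lborel \<Longrightarrow> l2_norm lborel (T u) \<le> C * l2_norm lborel u"
    using T unfolding bounded_l2op_def by blast
  then show "\<exists>C. \<forall>u\<in>L2 lborel. l2_norm lborel (schroedinger lam p (T (schroedinger lam q u))) \<le> C * l2_norm lborel u"
    by (metis T L2_schroedinger bounded_l2op_L2 l2_norm_schroedinger)
qed (use T in \<open>auto intro: L2_schroedinger bounded_l2op_L2\<close>)

section \<open>The transform of a modulated function\<close>

lemma truncate_modulate: "truncate N (modulate a f) = modulate a (truncate N f)"
  by (cases a) (auto simp: truncate_def fun_eq_iff)

lemma cmod_modulate: "cmod (modulate a f X) = cmod (f X)"
  by (cases a; cases X) (simp add: norm_mult)

lemma modulate_diff: "modulate a f X - modulate a g X = modulate a (\<lambda>X. f X - g X) X"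
  by (cases a; cases X) (simp add: right_diff_distrib)

lemma trunc_radius_modulate: "trunc_radius (modulate a f) j = trunc_radius f j"
  unfolding trunc_radius_def l2_norm_def truncate_modulate modulate_diff cmod_modulate ..

text \<open>A function and its modulation have the same truncation radii, so every approximant of
  the modulated function is the exact conjugate of the corresponding approximant of
  \<open>\<phi>\<close>. Conjugation does not increase the Hilbert-Schmidt norm, so convergence
  carries over.\<close>

lemma fourier_spec_modulate:
  fixes \<phi> :: "'n::finite heis \<Rightarrow> complex"
  assumes \<phi>: "\<phi> \<in> L2 lborel" and T: "fourier_spec \<phi> lam T"
  shows "fourier_spec (modulate (lam *\<^sub>R \<xi>2, - (lam *\<^sub>R \<xi>1), 0) \<phi>) lam
    (schroedinger lam (\<xi>1, \<xi>2, 0) \<circ> T \<circ> schroedinger lam (- \<xi>1, - \<xi>2, 0))"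
  unfolding fourier_spec_def
proof
  have bT: "bounded_l2op T" using T by (simp add: fourier_spec_def)
  then show "bounded_l2op (schroedinger lam (\<xi>1, \<xi>2, 0) \<circ> T \<circ> schroedinger lam (- \<xi>1, - \<xi>2, 0))"
    by (rule bounded_l2op_conj)
  let ?g = "\<lambda>j. truncate (trunc_radius \<phi> j) \<phi>"
  let ?D = "\<lambda>j u x. fourier_L1 (?g j) lam u x - T u x"
  have [measurable]: "?g j \<in> borel_measurable borel" for j
    by (intro heis_test_measurable heis_test_truncate \<phi>)
  have "hs_norm2 (\<lambda>u x. schroedinger lam (\<xi>1, \<xi>2, 0) (fourier_L1 (?g j) lam (schroedinger lam (- \<xi>1, - \<xi>2, 0) u)) x
      - schroedinger lam (\<xi>1, \<xi>2, 0) (T (schroedinger lam (- \<xi>1, - \<xi>2, 0) u)) x) \<le> hs_norm2 (?D j)" for j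
  proof -
    have m: "?D j u \<in> borel_measurable borel" if "u \<in> L2 lborel" for u
      using L2_lborel_measurable[OF that] bounded_l2op_measurable[OF bT that] by measurable
    show ?thesis
      using hs_norm2_schroedinger_le[of "?D j" lam "(\<xi>1, \<xi>2, 0)" "(- \<xi>1, - \<xi>2, 0)", OF m]
      by (simp add: schroedinger_simp[abs_def] right_diff_distrib)
  qed
  then show "(\<lambda>j. hs_norm2 (\<lambda>u x. fourier_L1 (truncate (trunc_radius (modulate (lam *\<^sub>R \<xi>2, - (lam *\<^sub>R \<xi>1), 0) \<phi>) j)
      (modulate (lam *\<^sub>R \<xi>2, - (lam *\<^sub>R \<xi>1), 0) \<phi>)) lam u x
      - (schroedinger lam (\<xi>1, \<xi>2, 0) \<circ> T \<circ> schroedinger lam (- \<xi>1, - \<xi>2, 0)) u x)) \<longlonglongrightarrow> 0"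
    unfolding trunc_radius_modulate truncate_modulate fourier_L1_modulate o_apply
    using T by - (rule tendsto_sandwich[OF _ _ tendsto_const, where h="\<lambda>j. hs_norm2 (?D j)"],
      auto simp: fourier_spec_def)
qed

lemma hs_norm2_eq_0_AE:
  assumes "hs_norm2 D = 0" "e \<in> L2 lborel" "l2_inner lborel e e = 1" "D e \<in> borel_measurable borel"
  shows "AE x in lborel. D e x = 0"
proof -
  have "sqn lborel (D e) \<le> hs_norm2 D"
    using hs_norm2_upper[of "{e}" D] assms(2,3) by (simp add: orthonormal_def)
  then have "sqn lborel (D e) = 0" using assms(1) by simp
  then show ?thesis using assms(4) by (subst (asm) nn_integral_0_iff_AE) auto
qed

text \<open>Both operators are limits of the same approximants, so their difference has
  Hilbert-Schmidt norm 0, which is then tested on the singleton of \<open>e\<close>.\<close>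

lemma fourier_spec_unique:
  fixes f :: "'n::finite heis \<Rightarrow> complex"
  assumes f: "f \<in> L2 lborel" and T: "fourier_spec f lam T" and T': "fourier_spec f lam T'"
    and e: "e \<in> L2 lborel" "l2_inner lborel e e = 1"
  shows "AE x in lborel. T e x = T' e x"
proof -
  have bT: "bounded_l2op T" "bounded_l2op T'" using T T' by (simp_all add: fourier_spec_def)
  let ?g = "\<lambda>j. truncate (trunc_radius f j) f"
  have [measurable]: "?g j \<in> borel_measurable borel" for j
    by (intro heis_test_measurable heis_test_truncate f)
  have m: "fourier_L1 (?g j) lam u \<in> borel_measurable borel" "T u \<in> borel_measurable borel" "T' u \<in> borel_measurable borel"
    if "u \<in> L2 lborel" for u j
    using that bT by (simp_all add: bounded_l2op_measurable fourier_L1_measurable L2_lborel_measurable)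
  let ?a = "\<lambda>j. hs_norm2 (\<lambda>u x. fourier_L1 (?g j) lam u x - T u x)"
  let ?b = "\<lambda>j. hs_norm2 (\<lambda>u x. fourier_L1 (?g j) lam u x - T' u x)"
  have "hs_norm2 (\<lambda>u x. T u x - T' u x) \<le> 2 * ?a j + 2 * ?b j" for j
    using hs_norm2_add_le[of "\<lambda>u x. T u x - fourier_L1 (?g j) lam u x" "\<lambda>u x. fourier_L1 (?g j) lam u x - T' u x"] m
    by (simp add: hs_norm2_diff_commute[of T] borel_measurable_diff)
  moreover have "(\<lambda>j. 2 * ?a j + 2 * ?b j) \<longlonglongrightarrow> 2 * 0 + 2 * 0"
    using T T' by (intro tendsto_add ennreal_tendsto_cmult) (auto simp: fourier_spec_def)
  ultimately have "hs_norm2 (\<lambda>u x. T u x - T' u x) \<le> 2 * 0 + 2 * 0"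
    by (intro LIMSEQ_le_const) auto
  then have "AE x in lborel. T e x - T' e x = 0"
    using e m by (intro hs_norm2_eq_0_AE[where D="\<lambda>u x. T u x - T' u x"]) auto
  then show ?thesis by simp
qed

text \<open>The transform of the modulated function is a choice. Uniqueness identifies it with the
  explicit conjugate of \<open>T\<close>, but only on unit vectors and almost everywhere, which
  accounts for the form of the statement.\<close>

lemma conj_transform_modulate_AE:
  fixes \<phi> :: "'n::finite heis \<Rightarrow> complex"
  assumes \<phi>: "\<phi> \<in> L2 lborel" and T: "fourier_spec \<phi> lam T"
    and e: "e \<in> L2 lborel" "l2_inner lborel e e = 1"
  shows "AE x in lborel. cis (2 * pi * lam * (a \<bullet> \<xi>2 - b \<bullet> \<xi>1 + m))
      * (conj_transform (modulate (lam *\<^sub>R \<xi>2, - (lam *\<^sub>R \<xi>1), 0) \<phi>) lam a b \<circ> schroedinger lam (a, b, 0)) e x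
    = schroedinger lam (\<xi>1, \<xi>2, 0) (schroedinger lam (a, b, m) (T (schroedinger lam (- \<xi>1, - \<xi>2, 0) e))) x"
proof -
  let ?\<psi> = "modulate (lam *\<^sub>R \<xi>2, - (lam *\<^sub>R \<xi>1), 0) \<phi>"
  let ?T = "schroedinger lam (\<xi>1, \<xi>2, 0) \<circ> T \<circ> schroedinger lam (- \<xi>1, - \<xi>2, 0)"
  have s: "fourier_spec ?\<psi> lam ?T" by (rule fourier_spec_modulate[OF \<phi> T])
  then have s': "fourier_spec ?\<psi> lam (fourier ?\<psi> lam)"
    by (rule fourier_spec_fourier)
  have [measurable]: "\<phi> \<in> borel_measurable borel" using \<phi> by (rule L2_lborel_measurable)
  have "?\<psi> \<in> borel_measurable borel"
    by (simp add: case_prod_beta' )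
  then have "?\<psi> \<in> L2 lborel" using \<phi> by (simp add: L2_iff cmod_modulate del: modulate.simps)
  then have "AE x in lborel. fourier ?\<psi> lam e x = ?T e x"
    using s' s e by (rule fourier_spec_unique)
  then have A: "AE x in lborel. schroedinger lam (a, b, 0) (fourier ?\<psi> lam e) x = schroedinger lam (a, b, 0) (?T e) x"
    by (rule AE_schroedinger)
  \<comment> \<open>The right factor of \<open>conj_transform\<close> cancels against the operator
    at \<open>(a, b, 0)\<close> composed on its right.\<close>
  have B: "(conj_transform ?\<psi> lam a b \<circ> schroedinger lam (a, b, 0)) e = schroedinger lam (a, b, 0) (fourier ?\<psi> lam e)"
    using schroedinger_inv[of lam "(a, b, 0)" e] by (simp add: conj_transform_def del: schroedinger.simps)
  \<comment> \<open>The two orders of multiplication differ by a central element: each contributes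
    half of the commutator, and together with \<open>m\<close> they make up the exponential.\<close>
  have C: "cis (2 * pi * lam * (a \<bullet> \<xi>2 - b \<bullet> \<xi>1 + m)) * schroedinger lam (a, b, 0) (schroedinger lam (\<xi>1, \<xi>2, 0) v) x
     = schroedinger lam (\<xi>1, \<xi>2, 0) (schroedinger lam (a, b, m) v) x" for v x
  proof -
    have "schroedinger lam (heis_mult (\<xi>1, \<xi>2, 0) (a, b, m)) v x
       = cis (2 * pi * lam * (a \<bullet> \<xi>2 - b \<bullet> \<xi>1 + m)) * schroedinger lam (heis_mult (a, b, 0) (\<xi>1, \<xi>2, 0)) v x"
      by (simp add: cis_mult inner_commute field_simps)
    then show ?thesis by (simp only: schroedinger_mult)
  qed
  show ?thesis
    using A unfolding B by eventually_elim (simp only: o_apply C)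
qed

text \<open>The error of the partial sum before conjugation and modulation. It does not involve
  \<open>\<xi>1\<close> and \<open>\<xi>2\<close>, so one null set of parameters will serve all of
  them.\<close>

definition defect ::
    "('n::finite heis \<Rightarrow> complex) \<Rightarrow> ('n heis \<Rightarrow> complex) \<Rightarrow> ('n lattice_index \<Rightarrow> complex) \<Rightarrow> 'n lattice_index set
      \<Rightarrow> real \<Rightarrow> ennreal" where
  "defect f \<phi> c S lam = hs_norm2 (\<lambda>u x. fourier f lam u x
      - (\<Sum>p\<in>S. c p * schroedinger lam (lattice_point p) (fourier \<phi> lam u) x))"

text \<open>As \<open>S\<close> is finite, the exceptional null sets of its terms can be united.
  Outside them the whole error on a unit vector is the conjugate of the unconjugated error.\<close>

lemma hs_norm2_conj_series_le:
  fixes A B :: "'n::finite l2op" and s :: "'n lattice_index \<Rightarrow> 'n l2op"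
  assumes b: "bounded_l2op A" "bounded_l2op B" and S: "finite S"
    and s: "\<And>p e. p \<in> S \<Longrightarrow> e \<in> L2 lborel \<Longrightarrow> l2_inner lborel e e = 1 \<Longrightarrow>
      AE x in lborel. s p e x = c p * schroedinger lam q (schroedinger lam (lattice_point p) (B (schroedinger lam q' e))) x"
  shows "hs_norm2 (\<lambda>u x. schroedinger lam q (A (schroedinger lam q' u)) x - (\<Sum>p\<in>S. s p u x))
    \<le> hs_norm2 (\<lambda>u x. A u x - (\<Sum>p\<in>S. c p * schroedinger lam (lattice_point p) (B u) x))"
proof -
  define D where "D u x = A u x - (\<Sum>p\<in>S. c p * schroedinger lam (lattice_point p) (B u) x)" for u x
  have "hs_norm2 (\<lambda>u x. schroedinger lam q (A (schroedinger lam q' u)) x - (\<Sum>p\<in>S. s p u x))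
     = hs_norm2 (\<lambda>u. schroedinger lam q (D (schroedinger lam q' u)))"
  proof (rule hs_norm2_cong_AE)
    fix e :: "real^'n \<Rightarrow> complex" assume e: "e \<in> L2 lborel" "l2_inner lborel e e = 1"
    have "AE x in lborel. \<forall>p\<in>S. s p e x = c p * schroedinger lam q (schroedinger lam (lattice_point p) (B (schroedinger lam q' e))) x"
      by (intro eventually_ball_finite S ballI s e)
    then show "AE x in lborel. schroedinger lam q (A (schroedinger lam q' e)) x - (\<Sum>p\<in>S. s p e x)
        = schroedinger lam q (D (schroedinger lam q' e)) x"
    proof eventually_elim
      case (elim x)
      then show ?case
        unfolding schroedinger_simp[of lam q] D_def
        by (simp add: right_diff_distrib sum_distrib_left mult_ac)
    qed
  qed
  also have "\<dots> \<le> hs_norm2 D"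
  proof (rule hs_norm2_schroedinger_le)
    fix u :: "real^'n \<Rightarrow> complex" assume "u \<in> L2 lborel"
    then have [measurable]: "A u \<in> borel_measurable borel" "B u \<in> borel_measurable borel"
      using b by (simp_all add: bounded_l2op_measurable)
    show "D u \<in> borel_measurable borel" unfolding D_def by measurable
  qed
  finally show ?thesis by (simp add: D_def[abs_def])
qed

text \<open>\<open>f\<close> and \<open>\<phi>\<close> are cut off at their own radii before the
  combination is formed, and the combination itself is not truncated. Its transform thus involves
  exactly the approximants that define \<open>fourier f\<close> and
  \<open>fourier \<phi>\<close>.\<close>

definition truncated_residual ::
    "('n::finite heis \<Rightarrow> complex) \<Rightarrow> ('n heis \<Rightarrow> complex) \<Rightarrow> ('n lattice_index \<Rightarrow> complex) \<Rightarrow> 'n lattice_index set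
      \<Rightarrow> nat \<Rightarrow> 'n heis \<Rightarrow> complex" where
  "truncated_residual f \<phi> c S j X = truncate (trunc_radius f j) f X
     - (\<Sum>p\<in>S. c p * left_translate (lattice_point p) (truncate (trunc_radius \<phi> j) \<phi>) X)"

text \<open>
  Nothing is known about measurability of \<open>defect\<close> in \<open>lam\<close>, so sums over partial sums and Fatou's lemma are
  applied to a measurable majorant. It already contains the weight \<open>\<bar>lam\<bar>\<^sup>n\<close>.
\<close>

definition defect_majorant ::
    "('n::finite heis \<Rightarrow> complex) \<Rightarrow> ('n heis \<Rightarrow> complex) \<Rightarrow> ('n lattice_index \<Rightarrow> complex) \<Rightarrow> 'n lattice_index set
      \<Rightarrow> real \<Rightarrow> ennreal" where
  "defect_majorant f \<phi> c S lam =
     liminf (\<lambda>j. 2 * kernel_hs (truncated_residual f \<phi> c S j) lam * ennreal (\<bar>lam\<bar> ^ CARD('n)))"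

lemma heis_test_truncated_residual:
  assumes "f \<in> L2 lborel" "\<phi> \<in> L2 lborel"
  shows "heis_test (truncated_residual f \<phi> c S j)"
  unfolding truncated_residual_def[abs_def]
  by (intro heis_test_diff heis_test_sum heis_test_cmult heis_test_left_translate heis_test_truncate assms)

lemma defect_majorant_measurable:
  assumes "f \<in> L2 lborel" "\<phi> \<in> L2 lborel"
  shows "defect_majorant f \<phi> c S \<in> borel_measurable borel"
proof -
  have [measurable]: "truncated_residual f \<phi> c S j \<in> borel_measurable borel" for j
    by (intro heis_test_measurable heis_test_truncated_residual assms)
  show ?thesis unfolding defect_majorant_def[abs_def] by measurable
qed

text \<open>Along a subsequence realising the lower limit of \<open>a\<close>, the perturbation
  \<open>b\<close> still tends to 0.\<close>

lemma le_liminf_add_null: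
  fixes a b :: "nat \<Rightarrow> ennreal"
  assumes "\<And>j. x \<le> a j + b j" "b \<longlonglongrightarrow> 0"
  shows "x \<le> liminf a"
proof -
  obtain r where r: "strict_mono r" "(a \<circ> r) \<longlonglongrightarrow> liminf a"
    using liminf_subseq_lim by blast
  have "(\<lambda>j. (a \<circ> r) j + (b \<circ> r) j) \<longlonglongrightarrow> liminf a + 0"
    by (rule tendsto_add[OF r(2) LIMSEQ_subseq_LIMSEQ[OF assms(2) r(1)]])
  then have "x \<le> liminf a + 0"
    by (rule LIMSEQ_le_const) (use assms(1) in auto)
  then show ?thesis by simp
qed

text \<open>For every \<open>j\<close> the defect operator is the transform of the truncated
  residual plus an approximation error that tends to 0 in Hilbert-Schmidt norm for the given
  \<open>lam\<close> and \<open>S\<close>.\<close>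

lemma defect_le_majorant:
  fixes f \<phi> :: "'n::finite heis \<Rightarrow> complex"
  assumes f: "f \<in> L2 lborel" and \<phi>: "\<phi> \<in> L2 lborel"
    and sf: "fourier_spec f lam (fourier f lam)" and s\<phi>: "fourier_spec \<phi> lam (fourier \<phi> lam)"
  shows "defect f \<phi> c S lam * ennreal (\<bar>lam\<bar> ^ CARD('n)) \<le> defect_majorant f \<phi> c S lam"
proof -
  let ?w = "ennreal (\<bar>lam\<bar> ^ CARD('n))"
  let ?f = "\<lambda>j. truncate (trunc_radius f j) f" and ?\<phi> = "\<lambda>j. truncate (trunc_radius \<phi> j) \<phi>"
  let ?h = "truncated_residual f \<phi> c S"
  let ?A = "\<lambda>j u x. fourier_L1 (?f j) lam u x - fourier f lam u x"
  let ?B = "\<lambda>j u x. fourier_L1 (?\<phi> j) lam u x - fourier \<phi> lam u x"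
  \<comment> \<open>The approximation error of \<open>f\<close>, plus that of \<open>\<phi>\<close>
    carried through the finitely many translates.\<close>
  define \<epsilon> where "\<epsilon> j = 2 * hs_norm2 (?A j) + 2 * (of_nat (card S) * (\<Sum>p\<in>S. ennreal ((cmod (c p))\<^sup>2) * hs_norm2 (?B j)))" for j
  have ht: "heis_test (?f j)" "heis_test (?\<phi> j)" "heis_test (?h j)" for j
    by (intro heis_test_truncate heis_test_truncated_residual f \<phi>)+
  have b: "bounded_l2op (fourier f lam)" "bounded_l2op (fourier \<phi> lam)"
    using sf s\<phi> by (simp_all add: fourier_spec_def)
  have [measurable]: "?f j \<in> borel_measurable borel" "?\<phi> j \<in> borel_measurable borel" "?h j \<in> borel_measurable borel" for j
    using ht by (simp_all add: heis_test_measurable)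
  have mA: "?A j u \<in> borel_measurable borel" and mB: "?B j u \<in> borel_measurable borel"
    and mh: "fourier_L1 (?h j) lam u \<in> borel_measurable borel" if "u \<in> L2 lborel" for j u
  proof -
    have [measurable]: "u \<in> borel_measurable borel" "fourier f lam u \<in> borel_measurable borel" "fourier \<phi> lam u \<in> borel_measurable borel"
      using that b by (simp_all add: bounded_l2op_measurable L2_lborel_measurable)
    show "?A j u \<in> borel_measurable borel" "?B j u \<in> borel_measurable borel"
      "fourier_L1 (?h j) lam u \<in> borel_measurable borel"
      by measurable
  qed
  have mp: "(\<lambda>x. c p * schroedinger lam (lattice_point p) (?B j u) x) \<in> borel_measurable borel"
    if "u \<in> L2 lborel" for j u p
    using schroedinger_measurable[OF mB[OF that]] by measurable
  have mR: "(\<lambda>x. - ?A j u x) \<in> borel_measurable borel"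
    "(\<lambda>x. \<Sum>p\<in>S. c p * schroedinger lam (lattice_point p) (?B j u) x) \<in> borel_measurable borel"
    "(\<lambda>x. - ?A j u x + (\<Sum>p\<in>S. c p * schroedinger lam (lattice_point p) (?B j u) x)) \<in> borel_measurable borel"
    if "u \<in> L2 lborel" for j u
    subgoal by (rule borel_measurable_uminus[OF mA[OF that]])
    subgoal by (rule borel_measurable_sum) (rule mp[OF that])
    subgoal by (rule borel_measurable_add[OF borel_measurable_uminus[OF mA[OF that]] borel_measurable_sum]) (rule mp[OF that])
    done
  have \<epsilon>: "\<epsilon> \<longlonglongrightarrow> 0"
  proof -
    have "\<epsilon> \<longlonglongrightarrow> 2 * 0 + 2 * (of_nat (card S) * (\<Sum>p\<in>S. ennreal ((cmod (c p))\<^sup>2) * 0))"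
      unfolding \<epsilon>_def using sf s\<phi>
      by (intro tendsto_add ennreal_tendsto_cmult tendsto_sum) (auto simp: fourier_spec_def of_nat_less_top)
    then show ?thesis by simp
  qed
  have L1h: "fourier_L1 (?h j) lam u x = fourier_L1 (?f j) lam u x
      - (\<Sum>p\<in>S. c p * schroedinger lam (lattice_point p) (fourier_L1 (?\<phi> j) lam u) x)"
    if u: "u \<in> L2 lborel" for j u x
  proof -
    have "fourier_L1 (?h j) lam u x = fourier_L1 (?f j) lam u x
      - fourier_L1 (\<lambda>X. \<Sum>p\<in>S. c p * left_translate (lattice_point p) (?\<phi> j) X) lam u x"
      unfolding truncated_residual_def[abs_def]
      by (intro fourier_L1_diff heis_test_sum heis_test_cmult heis_test_left_translate ht u)
    then show ?thesis
      using u by (simp add: fourier_L1_sum heis_test_left_translate ht fourier_L1_left_translate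
          heis_test_measurable L2_lborel_measurable)
  qed
  have le: "defect f \<phi> c S lam \<le> 2 * kernel_hs (?h j) lam + 2 * \<epsilon> j" for j
  proof -
    let ?R = "\<lambda>u x. - ?A j u x + (\<Sum>p\<in>S. c p * schroedinger lam (lattice_point p) (?B j u) x)"
    have "defect f \<phi> c S lam = hs_norm2 (\<lambda>u x. fourier_L1 (?h j) lam u x + ?R u x)"
      unfolding defect_def
    proof (rule hs_norm2_cong_AE, rule AE_I2)
      fix e :: "real^'n \<Rightarrow> complex" and x assume "e \<in> L2 lborel"
      then show "fourier f lam e x - (\<Sum>p\<in>S. c p * schroedinger lam (lattice_point p) (fourier \<phi> lam e) x)
          = fourier_L1 (?h j) lam e x + ?R e x"
        by (simp add: L1h schroedinger_simp right_diff_distrib sum_subtractf)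
    qed
    also have "\<dots> \<le> 2 * hs_norm2 (fourier_L1 (?h j) lam) + 2 * hs_norm2 ?R"
      by (rule hs_norm2_add_le) (rule mh mR, assumption)+
    also have "hs_norm2 ?R \<le> \<epsilon> j"
    proof -
      have "hs_norm2 ?R \<le> 2 * hs_norm2 (\<lambda>u x. - ?A j u x)
         + 2 * hs_norm2 (\<lambda>u x. \<Sum>p\<in>S. c p * schroedinger lam (lattice_point p) (?B j u) x)"
        by (rule hs_norm2_add_le) (rule mR, assumption)+
      also have "hs_norm2 (\<lambda>u x. - ?A j u x) = hs_norm2 (?A j)"
        by (simp add: hs_norm2_diff_commute[of "fourier f lam"])
      also have "hs_norm2 (\<lambda>u x. \<Sum>p\<in>S. c p * schroedinger lam (lattice_point p) (?B j u) x)
         \<le> of_nat (card S) * (\<Sum>p\<in>S. hs_norm2 (\<lambda>u x. c p * schroedinger lam (lattice_point p) (?B j u) x))"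
        by (rule hs_norm2_sum_le) (rule mp)
      also have "\<dots> \<le> of_nat (card S) * (\<Sum>p\<in>S. ennreal ((cmod (c p))\<^sup>2) * hs_norm2 (?B j))"
      proof (intro mult_left_mono sum_mono)
        fix p
        have "hs_norm2 (\<lambda>u. schroedinger lam (lattice_point p) (?B j u)) \<le> hs_norm2 (?B j)"
          \<comment> \<open>The identity operator at \<open>(0, 0, 0)\<close> takes the inner place,
            as only the outer one is present.\<close>
          using hs_norm2_schroedinger_le[of "?B j" lam "lattice_point p" "(0, 0, 0)"]
          by (simp add: schroedinger_zero mB del: schroedinger.simps)
        then show "hs_norm2 (\<lambda>u x. c p * schroedinger lam (lattice_point p) (?B j u) x)
          \<le> ennreal ((cmod (c p))\<^sup>2) * hs_norm2 (?B j)"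
          using mB by (intro order_trans[OF hs_norm2_cmult_le] mult_left_mono schroedinger_measurable) auto
      qed auto
      finally show ?thesis by (simp add: \<epsilon>_def mult_left_mono add_left_mono)
    qed
    also have "hs_norm2 (fourier_L1 (?h j) lam) \<le> kernel_hs (?h j) lam"
      by (rule hs_norm2_fourier_L1_le) simp
    finally show ?thesis by (simp add: mult_left_mono add_mono)
  qed
  have "defect f \<phi> c S lam * ?w \<le> 2 * kernel_hs (?h j) lam * ?w + ?w * (2 * \<epsilon> j)" for j
  proof -
    have "defect f \<phi> c S lam * ?w \<le> (2 * kernel_hs (?h j) lam + 2 * \<epsilon> j) * ?w"
      by (rule mult_right_mono[OF le]) simp
    also have "\<dots> = 2 * kernel_hs (?h j) lam * ?w + ?w * (2 * \<epsilon> j)"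
      by (subst distrib_right) (simp only: mult.commute)
    finally show ?thesis .
  qed
  moreover have "(\<lambda>j. ?w * (2 * \<epsilon> j)) \<longlonglongrightarrow> 0"
    using ennreal_tendsto_cmult[OF _ ennreal_tendsto_cmult[OF _ \<epsilon>, of 2], of ?w] by simp
  ultimately show ?thesis
    unfolding defect_majorant_def by (rule le_liminf_add_null)
qed

section \<open>The series expansion\<close>

text \<open>Fatou's lemma puts the integral under the lower limit, and the Plancherel inequality
  bounds it by the square norms of the truncated residuals. These differ from the residual
  \<open>F\<close> by a vanishing truncation error. The 4 comes from the 2 in the majorant and the 2
  from splitting that error off.\<close>

lemma nn_integral_defect_majorant_le:
  fixes f \<phi> :: "'n::finite heis \<Rightarrow> complex"
  assumes f: "f \<in> L2 lborel" and \<phi>: "\<phi> \<in> L2 lborel"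
  shows "(\<integral>\<^sup>+lam. defect_majorant f \<phi> c S lam \<partial>lborel)
    \<le> 4 * sqn lborel (\<lambda>X. f X - (\<Sum>p\<in>S. c p * lattice_translates \<phi> p X))"
proof -
  let ?h = "truncated_residual f \<phi> c S"
  let ?w = "\<lambda>lam. ennreal (\<bar>lam\<bar> ^ CARD('n))"
  define F where "F X = f X - (\<Sum>p\<in>S. c p * lattice_translates \<phi> p X)" for X
  define df where "df j X = f X - truncate (trunc_radius f j) f X" for j X
  define d\<phi> where "d\<phi> j X = \<phi> X - truncate (trunc_radius \<phi> j) \<phi> X" for j X
  \<comment> \<open>The total factor on \<open>(1/4) ^ j\<close>: the first 2 belongs to the tail of
    \<open>f\<close>, the rest to the tails of the translates of \<open>\<phi>\<close>.\<close>
  define K where "K = 2 + 2 * (of_nat (card S) * (\<Sum>p\<in>S. ennreal ((cmod (c p))\<^sup>2)))"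
  have [measurable]: "f \<in> borel_measurable borel" "\<phi> \<in> borel_measurable borel"
    using f \<phi> by (simp_all add: L2_lborel_measurable)
  have [measurable]: "?h j \<in> borel_measurable borel" "truncate (trunc_radius f j) f \<in> borel_measurable borel"
    "truncate (trunc_radius \<phi> j) \<phi> \<in> borel_measurable borel" for j
    by (rule heis_test_measurable, rule heis_test_truncated_residual heis_test_truncate, fact+)+
  have [measurable]: "df j \<in> borel_measurable borel" "d\<phi> j \<in> borel_measurable borel" for j
    unfolding df_def[abs_def] d\<phi>_def[abs_def] by measurable
  have [measurable]: "F \<in> borel_measurable borel"
    unfolding F_def[abs_def] lattice_translates_def by measurable
  have R: "sqn lborel (\<lambda>X. df j X - (\<Sum>p\<in>S. c p * left_translate (lattice_point p) (d\<phi> j) X)) \<le> K * ennreal ((1/4) ^ j)" for j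
  proof -
    have "sqn lborel (\<lambda>X. df j X - (\<Sum>p\<in>S. c p * left_translate (lattice_point p) (d\<phi> j) X))
      \<le> 2 * sqn lborel (df j) + 2 * sqn lborel (\<lambda>X. \<Sum>p\<in>S. c p * left_translate (lattice_point p) (d\<phi> j) X)"
      by (rule sqn_diff_le) measurable
    also have "\<dots> \<le> 2 * ennreal ((1/4) ^ j) + 2 * (of_nat (card S) * (\<Sum>p\<in>S. ennreal ((cmod (c p))\<^sup>2) * ennreal ((1/4) ^ j)))"
    proof (intro add_mono mult_left_mono)
      show "sqn lborel (df j) \<le> ennreal ((1/4) ^ j)"
        unfolding df_def by (rule sqn_truncate_error[OF f])
      have "sqn lborel (\<lambda>X. \<Sum>p\<in>S. c p * left_translate (lattice_point p) (d\<phi> j) X)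
        \<le> of_nat (card S) * (\<Sum>p\<in>S. sqn lborel (\<lambda>X. c p * left_translate (lattice_point p) (d\<phi> j) X))"
        by (rule sqn_sum_le) measurable
      also have "\<dots> = of_nat (card S) * (\<Sum>p\<in>S. ennreal ((cmod (c p))\<^sup>2) * sqn lborel (d\<phi> j))"
        by (simp add: sqn_cmult sqn_left_translate left_translate_measurable)
      also have "\<dots> \<le> of_nat (card S) * (\<Sum>p\<in>S. ennreal ((cmod (c p))\<^sup>2) * ennreal ((1/4) ^ j))"
        unfolding d\<phi>_def by (intro mult_left_mono sum_mono sqn_truncate_error[OF \<phi>]) auto
      finally show "sqn lborel (\<lambda>X. \<Sum>p\<in>S. c p * left_translate (lattice_point p) (d\<phi> j) X)
        \<le> of_nat (card S) * (\<Sum>p\<in>S. ennreal ((cmod (c p))\<^sup>2) * ennreal ((1/4) ^ j))" .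
    qed auto
    also have "\<dots> = K * ennreal ((1/4) ^ j)"
      by (simp add: K_def distrib_right sum_distrib_right[symmetric] mult.assoc)
    finally show ?thesis .
  qed
  have h: "sqn lborel (?h j) \<le> 2 * sqn lborel F + 2 * (K * ennreal ((1/4) ^ j))" for j
  proof -
    have "?h j X = F X - (df j X - (\<Sum>p\<in>S. c p * left_translate (lattice_point p) (d\<phi> j) X))" for X
      by (simp add: truncated_residual_def F_def df_def d\<phi>_def lattice_translates_def left_translate_def
          right_diff_distrib sum_subtractf)
    then have "sqn lborel (?h j) = sqn lborel (\<lambda>X. F X - (df j X - (\<Sum>p\<in>S. c p * left_translate (lattice_point p) (d\<phi> j) X)))"
      by (simp only:)
    also have "\<dots> \<le> 2 * sqn lborel F + 2 * sqn lborel (\<lambda>X. df j X - (\<Sum>p\<in>S. c p * left_translate (lattice_point p) (d\<phi> j) X))"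
      by (rule sqn_diff_le) measurable
    also have "\<dots> \<le> 2 * sqn lborel F + 2 * (K * ennreal ((1/4) ^ j))"
      by (intro add_left_mono mult_left_mono R) auto
    finally show ?thesis .
  qed
  have "(\<integral>\<^sup>+lam. defect_majorant f \<phi> c S lam \<partial>lborel)
      \<le> liminf (\<lambda>j. \<integral>\<^sup>+lam. 2 * kernel_hs (?h j) lam * ?w lam \<partial>lborel)"
    unfolding defect_majorant_def by (rule nn_integral_liminf) measurable
  also have "\<dots> \<le> liminf (\<lambda>j. 2 * (2 * sqn lborel F + 2 * (K * ennreal ((1/4) ^ j))))"
  proof (intro Liminf_mono always_eventually allI)
    fix j
    have "(\<integral>\<^sup>+lam. 2 * kernel_hs (?h j) lam * ?w lam \<partial>lborel) = 2 * (\<integral>\<^sup>+lam. kernel_hs (?h j) lam * ?w lam \<partial>lborel)"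
      by (simp add: nn_integral_cmult mult.assoc)
    also have "\<dots> \<le> 2 * (2 * sqn lborel F + 2 * (K * ennreal ((1/4) ^ j)))"
      by (rule mult_left_mono[OF order_trans[OF nn_integral_kernel_hs_le h]]) auto
    finally show "(\<integral>\<^sup>+lam. 2 * kernel_hs (?h j) lam * ?w lam \<partial>lborel) \<le> 2 * (2 * sqn lborel F + 2 * (K * ennreal ((1/4) ^ j)))" .
  qed
  also have "\<dots> = 4 * sqn lborel F"
  proof (rule lim_imp_Liminf[OF sequentially_bot])
    have "(\<lambda>j. ennreal ((1/4) ^ j)) \<longlonglongrightarrow> ennreal 0"
      by (intro tendsto_ennrealI LIMSEQ_power_zero) simp
    then have 0: "(\<lambda>j. ennreal ((1/4) ^ j)) \<longlonglongrightarrow> 0" by simp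
    have "K < top"
      by (simp add: K_def ennreal_mult_less_top of_nat_less_top)
    then have "(\<lambda>j. 2 * (2 * sqn lborel F + 2 * (K * ennreal ((1/4) ^ j)))) \<longlonglongrightarrow> 2 * (2 * sqn lborel F + 2 * (K * 0))"
      by (intro ennreal_tendsto_cmult tendsto_add tendsto_const 0) auto
    then show "(\<lambda>j. 2 * (2 * sqn lborel F + 2 * (K * ennreal ((1/4) ^ j)))) \<longlonglongrightarrow> 4 * sqn lborel F"
      by (simp add: mult.assoc[symmetric])
  qed
  finally show ?thesis by (simp add: F_def)
qed

section \<open>Subsequences and exhaustions of the index set\<close>

lemma subseq_power_bound:
  fixes b :: "nat \<Rightarrow> real"
  assumes "b \<longlonglongrightarrow> 0"
  shows "\<exists>r :: nat \<Rightarrow> nat. strict_mono r \<and> (\<forall>k. b (r k) \<le> (1/2) ^ k)"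
proof -
  have "\<forall>k. \<exists>N. \<forall>n\<ge>N. b n < (1/2) ^ k"
    using order_tendstoD(2)[OF assms, of "(1/2) ^ k" for k] by (simp add: eventually_sequentially)
  then obtain N where N: "\<And>k n. n \<ge> N k \<Longrightarrow> b n < (1/2) ^ k" by metis
  \<comment> \<open>Cumulative sums of positive terms are strictly increasing and at least as large
    as each threshold \<open>N k\<close>.\<close>
  define r where "r k = (\<Sum>i\<le>k. Suc (N i))" for k
  have "strict_mono r" by (simp add: strict_mono_Suc_iff r_def)
  moreover have "N k \<le> r k" for k
    unfolding r_def using member_le_sum[of k "{..k}" "\<lambda>i. Suc (N i)"] by simp
  ultimately show ?thesis using N by (intro exI[of _ r]) (auto intro: less_imp_le)
qed

lemma ennreal_suminf_finite_imp_LIMSEQ_0: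
  fixes x :: "nat \<Rightarrow> ennreal"
  assumes "suminf x \<noteq> \<infinity>"
  shows "x \<longlonglongrightarrow> 0"
proof -
  have "x k \<noteq> top" for k
    using ennreal_suminf_lessD[of x top k] assms by (simp add: less_top)
  then have x: "x = (\<lambda>k. ennreal (enn2real (x k)))" by (simp add: less_top)
  have "(\<Sum>k. ennreal (enn2real (x k))) \<noteq> top" using assms x by simp
  then have "summable (\<lambda>k. enn2real (x k))" by (intro summable_suminf_not_top) auto
  then have "(\<lambda>k. enn2real (x k)) \<longlonglongrightarrow> 0" by (rule summable_LIMSEQ_zero)
  then have "(\<lambda>k. ennreal (enn2real (x k))) \<longlonglongrightarrow> ennreal 0" by (rule tendsto_ennrealI)
  then show ?thesis using x by simp
qed

text \<open>Every finite set is eventually swallowed by the exhaustion, so limits over the net of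
  finite sets pass to it.\<close>

lemma filterlim_exhaustion:
  fixes S :: "nat \<Rightarrow> 'a set"
  assumes S: "\<And>N. finite (S N)" "incseq S" "(\<Union>N. S N) = UNIV"
  shows "filterlim S (finite_subsets_at_top UNIV) sequentially"
proof -
  have ev: "\<forall>\<^sub>F N in sequentially. finite (S N) \<and> X \<subseteq> S N \<and> S N \<subseteq> UNIV" if X: "finite X" for X
  proof -
    have "\<exists>N. X \<subseteq> S N" using X
    proof (induction X)
      case (insert x X)
      then obtain N where "X \<subseteq> S N" by blast
      moreover obtain M where "x \<in> S M" using S(3) by blast
      ultimately have "insert x X \<subseteq> S (max N M)"
        using incseqD[OF S(2), of N "max N M"] incseqD[OF S(2), of M "max N M"] by auto
      then show ?case by blast
    qed simp
    then obtain N0 where "X \<subseteq> S N0" by blast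
    then show ?thesis
      using S(1) incseqD[OF S(2)] by (intro eventually_sequentiallyI[of N0]) (meson order_trans subset_UNIV)
  qed
  show ?thesis
    unfolding filterlim_iff eventually_finite_subsets_at_top
  proof (intro allI impI, elim exE conjE)
    fix P and X :: "'a set" assume X: "finite X" and P: "\<forall>Y. finite Y \<and> X \<subseteq> Y \<and> Y \<subseteq> UNIV \<longrightarrow> P Y"
    show "\<forall>\<^sub>F N in sequentially. P (S N)"
      by (rule eventually_mono[OF ev[OF X]]) (use P in blast)
  qed
qed

theorem theorem3p4:
  fixes \<phi> f :: "'n::finite heis \<Rightarrow> complex"
    and c :: "'n lattice_index \<Rightarrow> complex"
  assumes "\<phi> \<in> L2 lborel"
    and "frame_sequence lborel (lattice_translates \<phi>)"
    and "f \<in> shift_space \<phi>"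
    and "frame_expansion lborel (lattice_translates \<phi>) c f"
  shows "let summand = (\<lambda>lam \<xi>1 \<xi>2 (k, l, m) u x.
               c (k, l, m)
               * cis (2 * pi * lam * (2 *\<^sub>R real_vec k \<bullet> \<xi>2 - real_vec l \<bullet> \<xi>1 + real_of_int m))
               * (conj_transform (modulate (lam *\<^sub>R \<xi>2, - (lam *\<^sub>R \<xi>1), 0) \<phi>) lam
                    (2 *\<^sub>R real_vec k) (real_vec l)
                  \<circ> schroedinger lam (2 *\<^sub>R real_vec k, real_vec l, 0)) u x);
             err = (\<lambda>S lam \<xi>1 \<xi>2. hs_norm2 (\<lambda>u x. conj_transform f lam \<xi>1 \<xi>2 u x
                      - (\<Sum>p\<in>S. summand lam \<xi>1 \<xi>2 p u x)))
         in (\<forall>\<xi>1 \<xi>2. ((\<lambda>S. \<integral>\<^sup>+lam\<in>- {0}. (err S lam \<xi>1 \<xi>2 * ennreal (\<bar>lam\<bar> ^ CARD('n))) \<partial>lborel)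
                         \<longlongrightarrow> 0) (finite_subsets_at_top UNIV))
          \<and> (\<forall>S :: nat \<Rightarrow> 'n lattice_index set.
               (\<forall>N. finite (S N)) \<and> incseq S \<and> (\<Union>N. S N) = UNIV \<longrightarrow>
               (\<exists>r. strict_mono r \<and>
                  (AE lam in lborel. lam \<noteq> 0 \<longrightarrow>
                     (\<forall>\<xi>1 \<xi>2. (\<lambda>N. err (S (r N)) lam \<xi>1 \<xi>2) \<longlonglongrightarrow> 0))))"
proof -
  note \<phi> = assms(1)
  have f: "f \<in> L2 lborel" using assms(3) by (simp add: shift_space_def l2_closed_span_def)
  define summand where "summand = (\<lambda>lam \<xi>1 \<xi>2 (k, l, m) u x.
               c (k, l, m)
               * cis (2 * pi * lam * (2 *\<^sub>R real_vec k \<bullet> \<xi>2 - real_vec l \<bullet> \<xi>1 + real_of_int m))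
               * (conj_transform (modulate (lam *\<^sub>R \<xi>2, - (lam *\<^sub>R \<xi>1), 0) \<phi>) lam
                    (2 *\<^sub>R real_vec k) (real_vec l)
                  \<circ> schroedinger lam (2 *\<^sub>R real_vec k, real_vec l, 0)) u x)"
  define err where "err = (\<lambda>S lam \<xi>1 \<xi>2. hs_norm2 (\<lambda>u x. conj_transform f lam \<xi>1 \<xi>2 u x
                      - (\<Sum>p\<in>S. summand lam \<xi>1 \<xi>2 p u x)))"
  let ?w = "\<lambda>lam. ennreal (\<bar>lam\<bar> ^ CARD('n))"
  let ?M = "defect_majorant f \<phi> c"
  define b where "b S = l2_norm lborel (\<lambda>X. f X - (\<Sum>p\<in>S. c p * lattice_translates \<phi> p X))" for S
  have b0: "(b \<longlongrightarrow> 0) (finite_subsets_at_top UNIV)"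
    using assms(4) unfolding frame_expansion_def b_def[abs_def] by blast
  have b_nonneg: "0 \<le> b S" for S by (simp add: b_def l2_norm_def)
  have [measurable]: "?M S \<in> borel_measurable borel" for S
    by (rule defect_majorant_measurable[OF f \<phi>])
  have M_int: "(\<integral>\<^sup>+lam. ?M S lam \<partial>lborel) \<le> ennreal (4 * (b S)\<^sup>2)" for S
  proof -
    have "(\<lambda>X. f X - (\<Sum>p\<in>S. c p * lattice_translates \<phi> p X)) \<in> L2 lborel"
      unfolding lattice_translates_def by (intro L2_diff L2_sum L2_cmult L2_left_translate f \<phi>)
    from sqn_eq_l2_norm[OF this] nn_integral_defect_majorant_le[OF f \<phi>, of c S]
    show ?thesis by (simp add: b_def ennreal_mult)
  qed
  \<comment> \<open>The majorant involves neither \<open>\<xi>1\<close> nor \<open>\<xi>2\<close>,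
    and the exceptional parameters depend only on \<open>f\<close> and \<open>\<phi>\<close>: a
    single null set serves all conjugations and all finite \<open>S\<close>.\<close>
  have good: "AE lam in lborel. lam \<noteq> 0 \<longrightarrow>
      (\<forall>S \<xi>1 \<xi>2. finite S \<longrightarrow> err S lam \<xi>1 \<xi>2 * ?w lam \<le> ?M S lam)"
    using AE_fourier_spec[OF f] AE_fourier_spec[OF \<phi>]
  proof eventually_elim
    case (elim lam)
    show ?case
    proof (intro impI allI)
      fix S :: "'n lattice_index set" and \<xi>1 \<xi>2 :: "real^'n"
      assume lam: "lam \<noteq> 0" and S: "finite S"
      have sf: "fourier_spec f lam (fourier f lam)" and s\<phi>: "fourier_spec \<phi> lam (fourier \<phi> lam)"
        using elim lam by simp_all
      have "err S lam \<xi>1 \<xi>2 \<le> defect f \<phi> c S lam"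
        unfolding err_def defect_def conj_transform_def o_apply
      proof (rule hs_norm2_conj_series_le[OF _ _ S])
        show "bounded_l2op (fourier f lam)" "bounded_l2op (fourier \<phi> lam)"
          using sf s\<phi> by (simp_all add: fourier_spec_def)
        fix p :: "'n lattice_index" and e :: "real^'n \<Rightarrow> complex"
        assume e: "e \<in> L2 lborel" "l2_inner lborel e e = 1"
        obtain k l m where p: "p = (k, l, m)" by (cases p)
        show "AE x in lborel. summand lam \<xi>1 \<xi>2 p e x = c p * schroedinger lam (\<xi>1, \<xi>2, 0)
            (schroedinger lam (lattice_point p) (fourier \<phi> lam (schroedinger lam (- \<xi>1, - \<xi>2, 0) e))) x"
          using conj_transform_modulate_AE[OF \<phi> s\<phi> e, of "2 *\<^sub>R real_vec k" \<xi>2 "real_vec l" \<xi>1 "real_of_int m"]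
        proof eventually_elim
          case (elim x)
          show ?case
            by (simp only: p summand_def prod.case lattice_point.simps mult.assoc[of "c (k, l, m)"] elim)
        qed
      qed
      then have "err S lam \<xi>1 \<xi>2 * ?w lam \<le> defect f \<phi> c S lam * ?w lam"
        by (rule mult_right_mono) simp
      also have "\<dots> \<le> ?M S lam"
        by (rule defect_le_majorant[OF f \<phi> sf s\<phi>])
      finally show "err S lam \<xi>1 \<xi>2 * ?w lam \<le> ?M S lam" .
    qed
  qed
  have part1: "((\<lambda>S. \<integral>\<^sup>+lam\<in>- {0}. (err S lam \<xi>1 \<xi>2 * ?w lam) \<partial>lborel) \<longlongrightarrow> 0) (finite_subsets_at_top UNIV)" for \<xi>1 \<xi>2
  proof (rule tendsto_sandwich[OF _ _ tendsto_const])
    show "\<forall>\<^sub>F S in finite_subsets_at_top UNIV.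
        (\<integral>\<^sup>+lam\<in>- {0}. (err S lam \<xi>1 \<xi>2 * ?w lam) \<partial>lborel) \<le> ennreal (4 * (b S)\<^sup>2)"
      using eventually_finite_subsets_at_top_weakI[of UNIV finite, OF _ ]
    proof (rule eventually_mono)
      fix S :: "'n lattice_index set" assume S: "finite S"
      have "(\<integral>\<^sup>+lam\<in>- {0}. (err S lam \<xi>1 \<xi>2 * ?w lam) \<partial>lborel) \<le> (\<integral>\<^sup>+lam. ?M S lam \<partial>lborel)"
        using good by (intro nn_integral_mono_AE) (auto elim!: eventually_mono simp: S split: split_indicator)
      also note M_int
      finally show "(\<integral>\<^sup>+lam\<in>- {0}. (err S lam \<xi>1 \<xi>2 * ?w lam) \<partial>lborel) \<le> ennreal (4 * (b S)\<^sup>2)" .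
    qed simp
    have "((\<lambda>S. ennreal (4 * (b S)\<^sup>2)) \<longlongrightarrow> ennreal (4 * 0\<^sup>2)) (finite_subsets_at_top UNIV)"
      by (intro tendsto_ennrealI tendsto_intros b0)
    then show "((\<lambda>S. ennreal (4 * (b S)\<^sup>2)) \<longlongrightarrow> 0) (finite_subsets_at_top UNIV)" by simp
  qed simp
  \<comment> \<open>A Borel-Cantelli argument: along a fast subsequence the integrals of the
    majorants are summable, so almost everywhere the majorants themselves are summable and hence
    tend to 0.\<close>
  have part2: "\<exists>r. strict_mono r \<and> (AE lam in lborel. lam \<noteq> 0 \<longrightarrow> (\<forall>\<xi>1 \<xi>2. (\<lambda>N. err (S (r N)) lam \<xi>1 \<xi>2) \<longlonglongrightarrow> 0))"
    if S: "\<And>N. finite (S N)" "incseq S" "(\<Union>N. S N) = UNIV" for S :: "nat \<Rightarrow> 'n lattice_index set"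
  proof -
    have bS: "(\<lambda>N. b (S N)) \<longlonglongrightarrow> 0"
      by (rule filterlim_compose[OF b0 filterlim_exhaustion[OF S]])
    obtain r where r: "strict_mono r" "\<And>k. b (S (r k)) \<le> (1/2) ^ k"
      using subseq_power_bound[OF bS] by blast
    have "(\<integral>\<^sup>+lam. (\<Sum>N. ?M (S (r N)) lam) \<partial>lborel) = (\<Sum>N. \<integral>\<^sup>+lam. ?M (S (r N)) lam \<partial>lborel)"
      by (rule nn_integral_suminf) measurable
    also have "\<dots> \<le> (\<Sum>N. ennreal (4 * (1/2) ^ N))"
    proof (intro suminf_le summableI)
      fix N
      have "(b (S (r N)))\<^sup>2 \<le> (1/2) ^ N"
      proof -
        have "(b (S (r N)))\<^sup>2 \<le> ((1/2) ^ N)\<^sup>2" by (intro power_mono r b_nonneg)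
        also have "\<dots> \<le> (1/2) ^ N" by (simp add: power2_eq_square mult_le_one power_le_one mult_left_le)
        finally show ?thesis .
      qed
      then show "(\<integral>\<^sup>+lam. ?M (S (r N)) lam \<partial>lborel) \<le> ennreal (4 * (1/2) ^ N)"
        by (intro order_trans[OF M_int] ennreal_leI) simp
    qed
    also have "\<dots> = ennreal (\<Sum>N. 4 * (1/2) ^ N)"
      by (intro suminf_ennreal2 summable_mult summable_geometric) auto
    finally have "(\<integral>\<^sup>+lam. (\<Sum>N. ?M (S (r N)) lam) \<partial>lborel) \<noteq> \<infinity>"
      by (auto simp: top_unique)
    then have "AE lam in lborel. (\<Sum>N. ?M (S (r N)) lam) \<noteq> \<infinity>"
      by (intro nn_integral_PInf_AE) auto
    with good have "AE lam in lborel. lam \<noteq> 0 \<longrightarrow> (\<forall>\<xi>1 \<xi>2. (\<lambda>N. err (S (r N)) lam \<xi>1 \<xi>2) \<longlonglongrightarrow> 0)"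
    proof eventually_elim
      case (elim lam)
      show ?case
      proof (intro impI allI)
        fix \<xi>1 \<xi>2 :: "real^'n" assume lam: "lam \<noteq> 0"
        \<comment> \<open>The reciprocal of the weight, legitimate for nonzero \<open>lam\<close>;
          it converts convergence of the weighted errors into convergence of the errors
          themselves.\<close>
        let ?v = "ennreal (1 / \<bar>lam\<bar> ^ CARD('n))"
        have wv: "?w lam * ?v = 1"
          using lam by (simp flip: ennreal_mult')
        have "(\<lambda>N. ?M (S (r N)) lam) \<longlonglongrightarrow> 0"
          using elim(2) by (rule ennreal_suminf_finite_imp_LIMSEQ_0)
        then have lim: "(\<lambda>N. ?v * ?M (S (r N)) lam) \<longlonglongrightarrow> 0"
          using ennreal_tendsto_cmult[of ?v "\<lambda>N. ?M (S (r N)) lam" 0 sequentially] by simp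
        have "err (S (r N)) lam \<xi>1 \<xi>2 \<le> ?v * ?M (S (r N)) lam" for N
        proof -
          have "err (S (r N)) lam \<xi>1 \<xi>2 = ?v * (err (S (r N)) lam \<xi>1 \<xi>2 * ?w lam)"
            using wv by (metis mult.commute mult.left_commute mult_1)
          also have "\<dots> \<le> ?v * ?M (S (r N)) lam"
            using elim(1) lam S(1) by (intro mult_left_mono) auto
          finally show ?thesis .
        qed
        then show "(\<lambda>N. err (S (r N)) lam \<xi>1 \<xi>2) \<longlonglongrightarrow> 0"
          by (intro tendsto_sandwich[OF always_eventually always_eventually tendsto_const lim]) auto
      qed
    qed
    with r(1) show ?thesis by blast
  qed
  show ?thesis
    unfolding Let_def summand_def[symmetric]
    using part1[unfolded err_def] part2[unfolded err_def] by simp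
qed

end
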